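(* Let $F_2:=(6,\{01,04\})$. Then $\lambda_{F_2}=-\frac{255}{8}\alpha_0^2+\frac{591}{10}\alpha_0-\frac{129}{5}$, where $\alpha_0=0.7210\ldots$ is a root of the polynomial $\alpha^3+2\alpha^2-\frac{32}{5}\alpha+\frac{16}{5}$. Furthermore, the $F_2$-problem is perfectly $B$-stable with $B:=(5,\{01,23\})$. Also, the unique (up to automorphisms of $B$) maximiser of $p(F_2,B(\boldsymbol x))$ over $\boldsymbol x\in\mathbb S_5$ is $\boldsymbol x=\left(\frac14\alpha_0,\frac14\alpha_0,\frac14\alpha_0,\frac14\alpha_0,1-\alpha_0\right)$.
   Context: All graphs are finite and simple. $(m,E)$ denotes the graph or pattern with vertex set $\{0,\dots,m-1\}$ and edge set $E$; $ij$ abbreviates $\{i,j\}$ ($ii$ is a loop). For graphs $F,G$ with $\kappa\le n$ vertices, $p(F,G)$ is the number of $\kappa$-subsets of $V(G)$ inducing a subgraph isomorphic to $F$, divided by $\binom n\kappa$; $p(F,n)$ is the maximum of $p(F,G)$ over $n$-vertex graphs $G$; $\lambda_F=\lim_{n\to\infty}p(F,n)$ (the limit exists). A pattern is a graph in which loops are allowed; its automorphisms are the bijections of the vertex set preserving edges, non-edges, loops and non-loops. For a pattern $B$ on $\{0,\dots,m-1\}$ and disjoint (possibly empty) sets $V_0,\dots,V_{m-1}$, the blowup $B(V_0,\dots,V_{m-1})$ is the simple graph on $\bigcup V_i$ in which distinct $x\in V_i$, $y\in V_j$ are adjacent iff $\{i,j\}\in E(B)$ (so $V_i$ is a clique if $i$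 has a loop and independent otherwise); $B()$ is the family of all blowups. $\mathbb S_m=\{\boldsymbol x\in\mathbb R^m:x_i\ge0,\sum x_i=1\}$, and $p(F,B(\boldsymbol x))$ is the limit as $n\to\infty$ of $p(F,B(V_0,\dots,V_{m-1}))$ with $|V_i|=(x_i+o(1))n$. $\delta_{\mathrm{edit}}(G,B())$ is the minimum number of vertex pairs whose adjacency must be changed to turn $G$ into a graph isomorphic to a blowup of $B$ (of the same order). The $F$-problem is perfectly $B$-stable if there is $C>0$ such that every graph $G$ with $n\ge C$ vertices satisfies $\delta_{\mathrm{edit}}(G,B())\le C\,(p(F,n)-p(F,G))\,n^2$. *)

theory Defs
  imports "HOL-Analysis.Analysis" "HOL-Library.Disjoint_Sets" "HOL-Library.More_List"
begin

text \<open>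
  Patterns and graphs share one type. An edge is a set \<open>{u, v}\<close> of vertices, the singleton
  \<open>{v} = {v, v}\<close> being a loop at \<open>v\<close>. Vertices are natural numbers; the vertex set may be any
  finite subset of \<open>nat\<close>, so every finite graph occurs up to isomorphism.
\<close>

record pattern =
  verts :: "nat set"
  edges :: "nat set set"

definition wf_pattern :: "pattern \<Rightarrow> bool" where
  "wf_pattern P \<longleftrightarrow> finite (verts P) \<and> edges P \<subseteq> {{u, v} |u v. u \<in> verts P \<and> v \<in> verts P}"

definition simple_graph :: "pattern \<Rightarrow> bool" where
  "simple_graph G \<longleftrightarrow> wf_pattern G \<and> (\<forall>v. {v} \<notin> edges G)"

definition num_verts :: "pattern \<Rightarrow> nat" where
  "num_verts G = card (verts G)"

definition mk_pattern :: "nat \<Rightarrow> nat set set \<Rightarrow> pattern" where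
  "mk_pattern m E = \<lparr>verts = {0..<m}, edges = E\<rparr>"

text \<open>The case \<open>u = v\<close> says that loops and non-loops are preserved.\<close>

definition is_isomorphism :: "pattern \<Rightarrow> pattern \<Rightarrow> (nat \<Rightarrow> nat) \<Rightarrow> bool" where
  "is_isomorphism P Q f \<longleftrightarrow> bij_betw f (verts P) (verts Q) \<and>
     (\<forall>u\<in>verts P. \<forall>v\<in>verts P. {u, v} \<in> edges P \<longleftrightarrow> {f u, f v} \<in> edges Q)"

definition isomorphic :: "pattern \<Rightarrow> pattern \<Rightarrow> bool" where
  "isomorphic P Q \<longleftrightarrow> (\<exists>f. is_isomorphism P Q f)"

definition is_automorphism :: "pattern \<Rightarrow> (nat \<Rightarrow> nat) \<Rightarrow> bool" where
  "is_automorphism P f \<longleftrightarrow> is_isomorphism P P f"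

definition induced_subgraph :: "pattern \<Rightarrow> nat set \<Rightarrow> pattern" where
  "induced_subgraph G S = \<lparr>verts = S, edges = {e \<in> edges G. e \<subseteq> S}\<rparr>"

text \<open>If \<open>num_verts G < num_verts F\<close>, the quotient is \<open>0 / 0 = 0\<close>.\<close>

definition ind_density :: "pattern \<Rightarrow> pattern \<Rightarrow> real" where
  "ind_density F G =
     real (card {S. S \<subseteq> verts G \<and> card S = num_verts F \<and> isomorphic (induced_subgraph G S) F})
     / real (num_verts G choose num_verts F)"

text \<open>
  There are infinitely many \<open>G\<close> of order \<open>n\<close> (with vertices in \<open>nat\<close>), but the densities are
  quotients \<open>k / (n choose num_verts F)\<close> with \<open>k \<le> n choose num_verts F\<close>, so the set below is finite.
\<close>

definition max_density :: "pattern \<Rightarrow> nat \<Rightarrow> real" where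
  "max_density F n = Max {ind_density F G |G. simple_graph G \<and> num_verts G = n}"

definition inducibility :: "pattern \<Rightarrow> real" where
  "inducibility F = lim (max_density F)"

definition blowup :: "pattern \<Rightarrow> (nat \<Rightarrow> nat set) \<Rightarrow> pattern" where
  "blowup B V = \<lparr>verts = (\<Union>i\<in>verts B. V i),
     edges = {{x, y} |x y i j. i \<in> verts B \<and> j \<in> verts B \<and> x \<in> V i \<and> y \<in> V j \<and>
                               x \<noteq> y \<and> {i, j} \<in> edges B}\<rparr>"

definition blowup_parts :: "pattern \<Rightarrow> (nat \<Rightarrow> nat set) \<Rightarrow> bool" where
  "blowup_parts B V \<longleftrightarrow> disjoint_family_on V (verts B) \<and> (\<forall>i\<in>verts B. finite (V i))"

definition blowups :: "pattern \<Rightarrow> pattern set" where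
  "blowups B = {blowup B V |V. blowup_parts B V}"

text \<open>
  Vectors in \<open>\<real>\<^sup>m\<close> are indexed by \<open>0, \<dots>, m - 1\<close> and extended by \<open>0\<close>, so that equality of
  functions is equality of vectors.
\<close>

definition std_simplex :: "nat \<Rightarrow> (nat \<Rightarrow> real) set" where
  "std_simplex m = {x. (\<forall>i<m. 0 \<le> x i) \<and> (\<forall>i\<ge>m. x i = 0) \<and> (\<Sum>i<m. x i) = 1}"

text \<open>
  The limit of the density along blowups with \<open>\<bar>V\<^sub>i\<bar> = (x\<^sub>i + o(1)) n\<close> is required to be \<open>L\<close>
  for every such choice of the parts.
\<close>

definition is_blowup_density :: "pattern \<Rightarrow> pattern \<Rightarrow> (nat \<Rightarrow> real) \<Rightarrow> real \<Rightarrow> bool" where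
  "is_blowup_density F B x L \<longleftrightarrow>
     (\<forall>V :: nat \<Rightarrow> nat \<Rightarrow> nat set.
        (\<forall>n. blowup_parts B (V n)) \<and>
        (\<forall>i\<in>verts B. (\<lambda>n. real (card (V n i)) / real n) \<longlonglongrightarrow> x i) \<longrightarrow>
        (\<lambda>n. ind_density F (blowup B (V n))) \<longlonglongrightarrow> L)"

definition blowup_density :: "pattern \<Rightarrow> pattern \<Rightarrow> (nat \<Rightarrow> real) \<Rightarrow> real" where
  "blowup_density F B x = (THE L. is_blowup_density F B x L)"

definition blowup_maximisers :: "pattern \<Rightarrow> pattern \<Rightarrow> (nat \<Rightarrow> real) set" where
  "blowup_maximisers F B =
     {x \<in> std_simplex (num_verts B). \<forall>y\<in>std_simplex (num_verts B). blowup_density F B y \<le> blowup_density F B x}"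

text \<open>
  \<open>Inf\<close> of a nonempty set of natural numbers is its minimum; the set is nonempty
  whenever \<open>B\<close> has a vertex.
\<close>

definition edit_distance :: "pattern \<Rightarrow> pattern \<Rightarrow> nat" where
  "edit_distance G B =
     Inf {card (sym_diff (edges G) (edges H)) |H.
            simple_graph H \<and> verts H = verts G \<and> (\<exists>K\<in>blowups B. isomorphic H K)}"

definition perfectly_stable :: "pattern \<Rightarrow> pattern \<Rightarrow> bool" where
  "perfectly_stable F B \<longleftrightarrow>
     (\<exists>C>0. \<forall>G. simple_graph G \<and> C \<le> real (num_verts G) \<longrightarrow>
        real (edit_distance G B) \<le>
          C * (max_density F (num_verts G) - ind_density F G) * (real (num_verts G))\<^sup>2)"

definition F2 :: pattern where
  "F2 = mk_pattern 6 {{0, 1}, {0, 4}}"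

definition B_F2 :: pattern where
  "B_F2 = mk_pattern 5 {{0, 1}, {2, 3}}"

lemma simple_graph_F2: "simple_graph F2"
  unfolding simple_graph_def wf_pattern_def F2_def mk_pattern_def
  by (fastforce simp: doubleton_eq_iff)

lemma wf_pattern_B_F2: "wf_pattern B_F2"
  unfolding wf_pattern_def B_F2_def mk_pattern_def by fastforce

end

theory Submission
  imports Defs "HOL-Combinatorics.Permutations" "HOL-Library.FuncSet"
begin

text \<open>
  The graph \<open>F2\<close> is a cherry (a path with two edges) together with three isolated vertices. Let \<open>\<lambda>\<close> be the claimed
  value of its inducibility.

  The upper bound is a flag algebra certificate with graphs on seven vertices. For every choice of three of the
  seven vertices as roots, and every way to split the other four into two pairs, a quadratic form is evaluated at
  the two flags that arise; there is one form for each of three types of roots. Adding the number of copies of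
  \<open>F2\<close> that contain the roots as their cherry, the sum over all choices is at most \<open>315 \<lambda>\<close> for every graph on
  seven vertices, with equality only if the graph embeds into a blowup of the pattern, and otherwise with a fixed
  deficit (\<open>total_le\<close>). This is a finite statement; it is verified by generating all graphs on seven vertices,
  with integer bounds, and for the graphs with equality by exact computation in the cubic field of \<open>\<alpha>\<close>. Summed
  over all seven-tuples of vertices of a weighted graph, repetitions allowed, the forms become values of positive
  semidefinite forms, and what remains is the theorem \<open>certificate\<close>: the density of \<open>F2\<close>, plus a constant times
  the weight of all seven-tuples that do not embed into a blowup, is at most \<open>\<lambda>\<close>.

  The density in a blowup is an explicit polynomial. For fixed sums of the two pairs of adjacent parts it is
  bilinear in the products of the two pairs, so its maximum is attained at a corner; the corner with equal parts
  in each pair leaves two variables, and these are settled by elementary estimates (\<open>profile_le\<close>). The maximiser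
  is unique (\<open>blowup_poly_le\<close>) and its value is \<open>\<lambda>\<close>, which gives the matching lower bound and the limit
  (\<open>max_density_limit\<close>).

  For stability, a graph with density near \<open>\<lambda>\<close> contains few tuples that do not embed, hence many induced matchings
  with two edges (\<open>many_matchings\<close>). Every such matching \<open>\<tau>\<close> suggests a partition of the vertices, by their
  neighbours in \<open>\<tau>\<close>, and every pair of vertices whose adjacency contradicts this partition forms with \<open>\<tau>\<close> a graph
  that does not embed (\<open>wrong_uncolourable\<close>). For a matching with the least number \<open>w\<close> of contradicting pairs, the
  number of tuples that do not embed is therefore at least of order \<open>w n ^ 5\<close>. Giving the parts their optimal
  weights, the corresponding blowup has density exactly \<open>\<lambda>\<close>, while by the certificate the graph loses a constant
  times \<open>w / n ^ 2\<close>. The two graphs differ only in tuples through contradicting pairs, so that passing to uniform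
  weights and to injective tuples costs only a small fraction of this (\<open>reweighted_gain\<close>). Hence the density of
  the graph is smaller than that of a blowup by a constant times \<open>w / n ^ 2\<close>, and \<open>w\<close> bounds the edit distance.
\<close>

section \<open>Integer arithmetic in the field of the optimum\<close>

text \<open>
  A triple \<open>(a, b, c)\<close> stands for \<open>a + b \<beta> + c \<beta>\<^sup>2\<close>, where \<open>\<beta> = 5 \<alpha>\<close>. The factor 5 makes the minimal polynomial
  \<open>x ^ 3 + 10 x ^ 2 - 160 x + 400\<close> monic, so integer triples are closed under multiplication.
\<close>

type_synonym cubic = "int \<times> int \<times> int"

fun kadd :: "cubic \<Rightarrow> cubic \<Rightarrow> cubic" where
  "kadd (a0, a1, a2) (b0, b1, b2) = (a0 + b0, a1 + b1, a2 + b2)"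

text \<open>
  Reduction of a polynomial of degree four in \<open>\<beta>\<close>, by \<open>\<beta> ^ 3 = 160 \<beta> - 10 \<beta> ^ 2 - 400\<close>.
\<close>

definition kred :: "int \<Rightarrow> int \<Rightarrow> int \<Rightarrow> int \<Rightarrow> int \<Rightarrow> cubic" where
  "kred p0 p1 p2 p3 p4 = (p0 - 400 * p3 + 4000 * p4, p1 + 160 * p3 - 2000 * p4, p2 - 10 * p3 + 260 * p4)"

declare kred_def [simp]

fun kmul :: "cubic \<Rightarrow> cubic \<Rightarrow> cubic" where
  "kmul (a0, a1, a2) (b0, b1, b2) =
     kred (a0 * b0) (a0 * b1 + a1 * b0) (a0 * b2 + a1 * b1 + a2 * b0) (a1 * b2 + a2 * b1) (a2 * b2)"

primrec ksum :: "cubic list \<Rightarrow> cubic" where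
  "ksum [] = (0, 0, 0)"
| "ksum (x # xs) = kadd x (ksum xs)"

text \<open>
  An upper bound for \<open>10 ^ 12\<close> times the represented number, from enclosures of \<open>\<beta>\<close> and \<open>\<beta> ^ 2\<close>: it reduces an
  inequality in the field to one between integers.
\<close>

fun kub :: "cubic \<Rightarrow> int" where
  "kub (a, b, c) = (a * 1000000000000
     + b * (if 0 \<le> b then 3605223282211 else 3605223282210)
     + c * (if 0 \<le> c then 12997634914594 else 12997634914593))"

section \<open>The data of the certificate\<close>

text \<open>
  A flag consists of three roots and two free vertices; its type is the graph on the roots. Three types occur: no
  edge, one edge, and two edges (a cherry). Flags that differ by a permutation of the roots or by exchanging the
  free vertices belong to one class. The tables list the class numbers by the seven remaining pairs, in
  lexicographic order: 2 to 20 for the empty type, 21 to 57 for one edge, 58 to 88 for the cherry, and 0 for the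
  classes on which the form of the certificate vanishes. The remaining pairs are those of the first free vertex
  with the roots, those of the second, and the pair of free vertices.
\<close>

definition flag_table_empty :: "nat list" where
  "flag_table_empty =
    [2, 11, 3, 12, 3, 12, 4, 13, 3, 12, 4, 13, 4, 13, 5, 14, 3, 12, 6, 16, 7, 0, 15, 17, 7, 0, 15,
     17, 8, 0, 0, 0, 3, 12, 7, 0, 6, 16, 15, 17, 7, 0, 8, 0, 15, 17, 0, 0, 4, 13, 15, 17, 15, 17,
     9, 18, 8, 0, 0, 19, 0, 19, 0, 20, 3, 12, 7, 0, 7, 0, 8, 0, 6, 16, 15, 17, 15, 17, 0, 0, 4, 13,
     15, 17, 8, 0, 0, 19, 15, 17, 9, 18, 0, 19, 0, 20, 4, 13, 8, 0, 15, 17, 0, 19, 15, 17, 0, 19,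
     9, 18, 0, 20, 5, 14, 0, 0, 0, 0, 0, 20, 0, 0, 0, 20, 0, 20, 10, 0]"

definition flag_table_edge :: "nat list" where
  "flag_table_edge =
    [21, 27, 23, 28, 22, 44, 31, 46, 22, 44, 31, 46, 30, 45, 32, 47, 23, 28, 26, 55, 25, 50, 40,
     56, 25, 50, 40, 56, 38, 0, 0, 0, 22, 44, 25, 50, 24, 48, 35, 51, 33, 29, 36, 52, 34, 49, 37,
     53, 31, 46, 40, 56, 35, 51, 0, 0, 36, 52, 41, 57, 39, 0, 42, 0, 22, 44, 25, 50, 33, 29, 36,
     52, 24, 48, 35, 51, 34, 49, 37, 53, 31, 46, 40, 56, 36, 52, 41, 57, 35, 51, 0, 0, 39, 0, 42,
     0, 30, 45, 38, 0, 34, 49, 39, 0, 34, 49, 39, 0, 0, 54, 0, 0, 32, 47, 0, 0, 37, 53, 42, 0, 37,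
     53, 42, 0, 0, 0, 43, 0]"

definition flag_table_cherry :: "nat list" where
  "flag_table_cherry =
    [58, 63, 65, 78, 65, 78, 60, 0, 59, 77, 66, 79, 66, 79, 67, 80, 65, 78, 0, 0, 71, 84, 73, 85,
     68, 81, 0, 0, 72, 0, 0, 0, 65, 78, 71, 84, 0, 0, 73, 85, 68, 81, 72, 0, 0, 0, 0, 0, 60, 0, 73,
     85, 73, 85, 62, 87, 70, 64, 0, 86, 0, 86, 76, 88, 59, 77, 68, 81, 68, 81, 70, 64, 61, 0, 69,
     82, 69, 82, 0, 83, 66, 79, 0, 0, 72, 0, 0, 86, 69, 82, 74, 0, 75, 0, 0, 0, 66, 79, 72, 0, 0,
     0, 0, 86, 69, 82, 75, 0, 74, 0, 0, 0, 67, 80, 0, 0, 0, 0, 76, 88, 0, 83, 0, 0, 0, 0, 0, 0]"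

text \<open>
  Each type carries a positive semidefinite matrix, found by semidefinite programming and rounded. It is a sum of
  four squares with integer coefficients over all classes, of up to seven squares over a few classes (those with a
  nonempty entry in the second list), of a multiple of the identity on these few, and of a small correction with
  entries in the field. The correction is what makes the final inequality an exact equality where it has to be
  one.
\<close>

definition main_columns :: "(int \<times> int \<times> int \<times> int) list" where
  "main_columns =
    [(0,0,0,0), (0,0,0,0), (0,0,0,0), (0,0,0,0), (0,0,0,0), (0,0,0,0), (0,0,0,0), (0,0,0,0),
     (-30,10,0,0), (569,-50,0,0), (-40,335,0,0), (1041,156,0,0), (589,-33,0,0), (69,286,0,0),
     (53,-164,0,0), (328,-237,0,0), (-12,-474,0,0), (169,79,0,0), (334,0,0,0), (334,0,0,0),
     (251,0,0,0), (0,0,0,0), (0,0,0,0), (-371,53,387,32), (-361,-573,856,-34), (1372,333,-148,174),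
     (-1212,-931,-432,911), (588,-737,157,27), (-1351,-516,-228,-878), (59,33,376,184),
     (72,145,0,0), (-644,556,-93,-76), (-492,241,93,76), (1174,-227,-425,-152),
     (-62,-388,299,-532), (663,0,0,0), (917,2,-476,0), (177,-302,-14,-76), (1227,456,569,76),
     (233,217,0,0), (-421,-398,-173,-76), (512,-374,-79,0), (295,-35,-238,0), (272,-290,65,-76),
     (-669,155,490,76), (-760,446,210,-152), (-395,96,159,0), (271,-133,79,0), (-610,-339,224,-76),
     (-532,-410,-38,228), (444,-1052,173,76), (21,-437,345,152), (331,0,0,0), (642,-641,145,-76),
     (-98,-325,-238,0), (-1207,-129,-807,-76), (-35,122,-159,0), (409,72,0,0), (0,0,0,0),
     (-187,866,211,-301), (928,-858,-44,384), (-29,-388,38,-161), (-126,366,-360,-287),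
     (1735,481,356,340), (-528,-36,28,146), (16,-46,341,0), (-141,203,-281,135), (170,608,60,135),
     (-247,-90,-454,0), (9,-361,0,0), (-32,-202,-173,-135), (460,135,114,0), (-304,-90,0,0),
     (17,-496,114,0), (733,384,167,-135), (-261,-114,287,135), (-90,-338,167,-135), (306,0,0,0),
     (702,112,-281,135), (402,225,568,0), (172,-361,227,0), (-105,68,54,-135), (678,0,-227,0),
     (-410,-157,-60,-135), (382,0,0,0), (-66,-226,114,0), (-11,-428,167,-135), (-313,496,114,0),
     (209,-653,-173,-135)]"

definition minor_columns :: "int list list" where
  "minor_columns =
    [[], [], [], [], [], [], [], [], [288, 0, 0, 0, 0, 0, 0], [730, 1415, 0, 0, 0, 0, 0],
     [-2616, -892, 2017, 0, 0, 0, 0], [-475, -168, 361, 188, 0, 0, 0],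
     [-374, -345, 181, 3, 189, 0, 0], [-629, -854, 174, 3, 20, 212, 0],
     [1299, 478, -977, -16, -9, -8, 205], [], [], [], [], [], [], [], [], [600, 0, 0, 0, 0, 0, 0],
     [-1365, 4117, 0, 0, 0, 0, 0], [-1173, 180, 440, 0, 0, 0, 0],
     [-7378, 9749, 206, 2859, 0, 0, 0], [-929, 1620, 423, -697, 339, 0, 0],
     [4853, -4532, -645, -1118, -171, 282, 0], [1160, -3297, 165, -478, 24, -58, 215], [], [], [],
     [], [], [], [], [], [], [], [], [], [], [], [], [], [], [], [], [], [], [], [], [], [], [],
     [], [], [], [1707, 0, 0, 0, 0, 0, 0], [-818, 1382, 0, 0, 0, 0, 0],
     [-1875, -762, 332, 0, 0, 0, 0], [-223, -25, 21, 186, 0, 0, 0], [200, -51, -12, -1, 186, 0, 0],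
     [729, -68, -55, -4, 4, 193, 0], [], [], [], [], [], [], [], [], [], [], [], [], [], [], [],
     [], [], [], [], [], [], [], [], []]"

definition corrections :: "(nat \<times> cubic) list list" where
  "corrections =
    [[], [], [], [], [], [], [], [],
     [(8, (-88631064417734583128256000,40769240493368772001056000,-4489366606389949056628800)),
      (9, (-472603750227003218522870400,127499130620783650123224000,995635615174484974130640)),
      (11, (1822999316039788538511360000,-410526461331866250842112000,-26386320561250802949734400)),
      (12, (-1180841399223960326466308760,266292299882435269017497700,16987566627557797274213211)),
      (13, (872511437245086663023227200,-170843693800882422196332000,-19740650842625210888454120))],
     [(8, (-472603750227003218522870400,127499130620783650123224000,995635615174484974130640)),
      (13, (-87791737170037329371136000,39846618710939861594112000,-4298030945230321228800000))],
     [],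
     [(8, (1822999316039788538511360000,-410526461331866250842112000,-26386320561250802949734400)),
      (11, (-365214495640157945856000,1976379750871990272000000,-520099934439997440000000)),
      (12, (-2476872431808939606992870400,555429586129993501422144000,36500851323678433470906240))],
     [(8, (-1180841399223960326466308760,266292299882435269017497700,16987566627557797274213211)),
      (11, (-2476872431808939606992870400,555429586129993501422144000,36500851323678433470906240))],
     [(8, (872511437245086663023227200,-170843693800882422196332000,-19740650842625210888454120)),
      (9, (-87791737170037329371136000,39846618710939861594112000,-4298030945230321228800000)),
      (13, (-132535101223117181779968000,59982144444688192585728000,-6440703056874103502438400))],
     [], [], [], [], [], [], [], [], [],
     [(24, (-2713582940607318952160385600,621555300445289189634012000,36371023268188702509309960)),
      (25, (1024630656487761016822032000,-236233838534786116556952000,-13306645403123839441362000)),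
      (29, (-183856394021074705464446400,39607658703702662163876000,3159186203598997613550840))],
     [(23, (-2713582940607318952160385600,621555300445289189634012000,36371023268188702509309960)),
      (25, (-536489721790078548984340800,121975717009407276551532000,7442895009411120133154280))],
     [(23, (1024630656487761016822032000,-236233838534786116556952000,-13306645403123839441362000)),
      (24, (-536489721790078548984340800,121975717009407276551532000,7442895009411120133154280)),
      (25, (485827921479122956529088000,-130950628419011255632032000,-1055705339357269845854400)),
      (27, (-25817653072041770641920000,-703414627540311025920000,2181444268065261717926400)),
      (29, (-4225799952303901846507200,-6370293048893844062316000,2092082863223698272976920))],
     [], [(25, (-25817653072041770641920000,-703414627540311025920000,2181444268065261717926400))],
     [],
     [(23, (-183856394021074705464446400,39607658703702662163876000,3159186203598997613550840)),
      (25, (-4225799952303901846507200,-6370293048893844062316000,2092082863223698272976920))],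
     [], [], [], [], [], [], [], [], [], [], [], [], [], [], [], [], [], [], [], [], [], [], [],
     [], [], [], [], [], [],
     [(61, (-49981284383325059112960000,22630412157773161697280000,-2431704926196847988121600))],
     [],
     [(59, (-49981284383325059112960000,22630412157773161697280000,-2431704926196847988121600)),
      (61, (-35216179953714030182400000,15963528056188564930560000,-1718458592441727791923200)),
      (64, (-26343646643789243547648000,11955502076926718607360000,-1289358263287736996659200))],
     [], [],
     [(61, (-26343646643789243547648000,11955502076926718607360000,-1289358263287736996659200)),
      (64, (-43893613561125067161600000,19922716933132124160000000,-2149024034665267200000000))],
     [], [], [], [], [], [], [], [], [], [], [], [], [], [], [], [], [], [], [], [], [], [], [],
     []]"

text \<open>
  At the optimal blowup every form of the certificate has to vanish, which prescribes a kernel. The classes with a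
  nonempty row are expressed by the other ones modulo this kernel, with denominator 12800; a matrix on the other
  classes then defines a form with the prescribed kernel.
\<close>

definition pivot_rows :: "(nat \<times> cubic) list list" where
  "pivot_rows =
    [[], [], [(11, (4480,-1600,-48))],
     [(8, (12800,0,0)), (9, (-1600,800,40)), (11, (1160,-1100,-41)), (13, (-3200,1600,80))],
     [(9, (1600,-800,-40)), (11, (3320,-500,-7)), (13, (3200,-1600,-80))],
     [(10, (1600,-800,-40)), (11, (3320,-500,-7)), (14, (3200,-1600,-80))],
     [(8, (-153600,12800,1280)), (9, (-12800,0,0)), (11, (49920,-3200,-352)), (12, (-25600,0,0)), (13, (-25600,0,0))],
     [(8, (25600,0,0)), (9, (-3200,1600,80)), (11, (-2160,-600,-34)), (13, (-6400,3200,160))], [],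
     [], [], [], [], [], [], [], [], [], [], [], [],
     [(23, (-20480,12800,768)), (24, (148480,-32000,-2048)), (25, (501760,-102400,-6656)), (26, (125440,-25600,-1664)),
      (27, (-102400,19200,1280)), (28, (250880,-51200,-3328)), (29, (148480,-32000,-2048))],
     [(23, (-56320,6400,512)), (24, (-14080,1600,128)), (25, (-92160,12800,896)), (26, (-23040,3200,224)),
      (27, (32000,-4800,-320)), (28, (-46080,6400,448)), (29, (-14080,1600,128))],
     [], [], [], [], [], [], [], [], [], [], [], [], [], [], [], [], [], [], [], [], [], [], [],
     [], [], [], [], [], [], [], [], [], [], [], [],
     [(59, (217600,-51200,-3200)), (60, (217600,-51200,-3200)), (61, (76800,-17600,-1120)), (62, (76800,-17600,-1120)),
      (63, (153600,-35200,-2240)), (64, (153600,-35200,-2240))],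
     [], [], [], [], [], [], [], [], [], [], [], [], [], [], [], [], [], [], [], [], [], [], [],
     [], [], [], [], [], [], []]"

text \<open>
  Integers that bound 102400 times the entries of the form from above. They suffice for all graphs at which the
  inequality of the certificate is strict. Between two classes without a row the form is the first of the four
  parts alone, which the scaling makes an integer.
\<close>

definition bound_rows :: "int list list" where
  "bound_rows =
    [[], [],
     [74268, 91414, -3695, -50986, -495968, 108561, 13451, -261320, -7135, -497121, -272831, -52755, -12081, -136460, 38740,
      -84371, -155830, -155830, -117105],
     [91414, 129149, -17162, -62672, -676159, 166885, 20573, -349116, 60003, -611895, -361975, -6456, -49567, -229138, -53712,
      -92189, -202282, -202282, -152014],
     [-3695, -17162, 10356, 2466, 72666, -30629, -3111, 36659, -59138, 24738, 34331, -45286, 30603, 56048, 79312, -5022,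
      16393, 16393, 12319],
     [-50986, -62672, 2466, 35070, 340143, -74358, -9220, 179115, 5270, 341292, 187183, 36618, 7877, 93339, -27158, 57986,
      106918, 106918, 80349],
     [-495968, -676159, 72666, 340143, 3585400, -856350, -107525, 1850674, -205029, 3319867, 1918413, 129313, 208290, 1141867,
      124621, 519008, 1079557, 1079557, 811284],
     [108561, 166885, -30629, -74358, -856350, 225209, 27695, -436913, 127141, -726669, -451119, 39843, -87054, -321816,
      -146163, -100006, -248734, -248734, -186923],
     [13451, 20573, -3111, -9220, -107525, 27695, 4011, -51137, 8000, -90036, -54813, 1013, -6884, -36630, -13140, -12840,
      -30060, -30060, -22590],
     [-261320, -349116, 36659, 179115, 1850674, -436913, -51137, 998184, -142318, 1749204, 1004665, 62368, 127256, 595446,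
      50616, 276633, 570138, 570138, 428457],
     [-7135, 60003, -59138, 5270, -205029, 127141, 8000, -142318, 429668, 47765, -91460, 299837, -214643, -277545, -474930,
      59115, -40080, -40080, -30120],
     [-497121, -611895, 24738, 341292, 3319867, -726669, -90036, 1749204, 47765, 3327589, 1826256, 353128, 80870, 913428,
      -259308, 564759, 1043082, 1043082, 783873],
     [-272831, -361975, 34331, 187183, 1918413, -451119, -54813, 1004665, -91460, 1826256, 1046873, 97848, 103668, 603039,
      25722, 290802, 590178, 590178, 443517],
     [-52755, -6456, -45286, 36618, 129313, 39843, 1013, 62368, 299837, 353128, 97848, 269071, -140220, -135450, -409176,
      102765, 69138, 69138, 51957],
     [-12081, -49567, 30603, 7877, 208290, -87054, -6884, 127256, -214643, 80870, 103668, -140220, 111349, 168756, 231300,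
      -11997, 53106, 53106, 39909],
     [], [], [], [], [], [],
     [386607, -252155, 276607, 180976, -668148, 312833, -481685, 557415, 43677, -702, 469625, 338387, -751786, -15104,
      -351407, -565554, -173903, -437149, -67435, 91517, -381277, -205418, -207872, 476737, 553923, 260897, -164713, 273688,
      168808, -478306, -66587, -175438, -481209, -72037, 471010, 23335, -198180],
     [-252155, 234498, -258156, -394410, 526943, -300405, 169342, -382134, -104191, 23720, -204173, -209307, 559597, -101332,
      235402, 478449, 72867, 245408, 79968, -87164, 211921, 181631, 81070, -398572, -339599, -192537, 72538, -282535, -176517,
      113778, -101163, 117524, 191210, 45784, -166021, 37092, 144302],
     [276607, -258156, 292273, 431689, -544828, 251210, -196979, 364821, 133005, -19027, 229969, 233728, -616924, 101127,
      -245973, -524313, -89523, -208414, -74942, 65714, -240347, -203406, -93559, 448476, 382004, 213166, -77017, 292599,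
      168232, -151097, 107427, -122801, -218472, -72973, 126219, -42082, -147923],
     [180976, -394410, 431689, 1239704, -812846, 695749, 363352, 554857, 237500, -109077, -163128, 116543, -652375, 518738,
      -239343, -739639, 99749, -219755, -208454, 234531, -38154, -290168, 126202, 569550, 203730, 223691, 46002, 608785,
      386702, 588016, 532972, -119491, 262235, 17875, -178564, -193375, -188905],
     [-668148, 526943, -544828, -812846, 2049584, -1724187, 546694, -2161408, 63602, 147069, -697880, -595311, 1571589,
      -351088, 909636, 1329238, 131126, 1764304, 391937, -697766, 589614, 428309, 253770, -925549, -951730, -533504, 315831,
      -996183, -821138, 246472, -141321, 454132, 632687, -207457, -1592749, 16138, 585124],
     [312833, -300405, 251210, 695749, -1724187, 3746615, -17881, 1208154, -202122, -222259, 233832, 400993, -1166423,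
      -177448, -803556, -907634, 3450, -2088232, -484423, 886290, -238222, -222139, -156990, 524079, 276702, 320676, -238757,
      888925, 1250618, 435784, 370827, -401172, -313209, 524167, 1862371, -2474, -562740],
     [-481685, 169342, -196979, 363352, 546694, -17881, 925088, -502102, 59352, -64529, -805097, -450260, 786782, 282079,
      389844, 462990, 322400, 476789, -22925, 16565, 564291, 161889, 381819, -428625, -746716, -278049, 269772, -75721, -10456,
      1065609, 392686, 194628, 870626, 144535, -743394, -135457, 187428],
     [557415, -382134, 364821, 554857, -2161408, 1208154, -502102, 3029118, -291569, -172092, 671080, 452404, -1238586,
      682894, -895713, -1131371, -13375, -2089433, -426755, 880311, -480716, -326221, -165924, 645391, 882200, 447857, -315505,
      1014690, 738772, -163184, -14995, -447181, -502918, 354362, 1947945, 20585, -589711],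
     [43677, -104191, 133005, 237500, 63602, -202122, 59352, -291569, 211236, 9033, -68600, 27877, -125993, -1926, 39117,
      -124807, -18771, 315369, 20908, -117005, -11838, -73238, 16934, 163868, 20870, 39647, 41304, 23063, -17254, 70512,
      144506, 19529, 57261, -105995, -392886, -57823, 26507],
     [], [], [], [], [], [], [], [], [], [], [], [], [], [], [], [], [], [], [], [], [], [], [],
     [], [], [], [], [],
     [549365, 53737, -619398, 69805, 143492, -1364889, 357478, -59882, 111492, -197276, 253212, 25149, 81221, -356011, 223738,
      13698, -565598, 136886, 81904, -217294, -479182, -392638, -125575, 74495, -446481, 328302, -271263, 49048, 33668, 161367,
      -50513],
     [53737, 927461, -1044922, -282112, 349994, 65731, 32634, 29123, 102239, 466763, -127545, -314309, -164816, 54944, -21092,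
      -408661, 271345, -29995, -200006, -57222, -134208, 239524, -296893, 130552, -174683, -31317, -71434, -159320, -292719,
      512121, -600449],
     [-619398, -1044922, 1753317, 243698, -524954, 1311693, -405989, 39312, -240818, -314704, -132020, 318090, 99392, 306034,
      -204892, 436328, 291564, -105184, 147296, 283968, 619564, 155014, 459366, -210000, 639172, -294974, 354496, 127644,
      297828, -721048, 709998],
     [69805, -282112, 243698, 189399, -104716, -279005, 3505, 30342, -107088, -260289, 24831, 139807, 94465, -61388, 43736,
      196287, -142168, 40972, 161835, -8874, -96227, -77374, 143706, 448, -28288, 92261, -11078, 93934, 194464, -179039,
      262464],
     [143492, 349994, -524954, -104716, 362144, -268413, 964, -141612, 154479, 140763, 161622, -133260, 31125, -49590, 5364,
      -224718, 26811, -150903, -133743, -38556, 14955, -172782, -235518, 57423, -3708, 54543, -48132, -115440, -176637, 179934,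
      -164307],
     [-1364889, 65731, 1311693, -279005, -268413, 3484245, -873411, 127030, -201128, 654658, -633459, -158026, -260170,
      903619, -570730, -168497, 1470011, -359597, -305176, 530910, 1217706, 1007903, 205591, -176143, 1095518, -854127, 662770,
      -182632, -211401, -263895, -58966],
     [357478, 32634, -405989, 3505, 964, -873411, 303750, 2756, 78982, -90258, 120944, 8244, -386, -244548, 163752, 12072,
      -415882, 169658, 44654, -161568, -362846, -204452, -71464, 34794, -364340, 200742, -201696, 46176, 6182, 150600,
      -111398],
     [], [], [], [], [], [], [], [], [], [], [], [], [], [], [], [], [], [], [], [], [], [], [],
     []]"

definition block_weight :: "nat \<Rightarrow> int" where
  "block_weight i = (if i < 21 then 3 else 1)"

definition block_start :: "nat \<Rightarrow> nat" where
  "block_start i = (if i < 21 then 2 else if i < 58 then 21 else 58)"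

definition main_column :: "nat \<Rightarrow> int \<times> int \<times> int \<times> int" where
  "main_column i = main_columns ! i"

definition main_entry :: "nat \<Rightarrow> nat \<Rightarrow> int" where
  "main_entry i j = block_weight i *
     (case main_column i of (a0, a1, a2, a3) \<Rightarrow> case main_column j of (b0, b1, b2, b3) \<Rightarrow>
        a0 * b0 + a1 * b1 + a2 * b2 + a3 * b3)"

fun dot :: "int list \<Rightarrow> int list \<Rightarrow> int" where
  "dot (a # as) (b # bs) = a * b + dot as bs"
| "dot _ _ = 0"

definition minor_column :: "nat \<Rightarrow> int list" where
  "minor_column i = minor_columns ! i"

primrec kassoc :: "nat \<Rightarrow> (nat \<times> cubic) list \<Rightarrow> cubic" where
  "kassoc i [] = (0, 0, 0)"
| "kassoc i (x # xs) = (if i = fst x then snd x else kassoc i xs)"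

definition correction_row :: "nat \<Rightarrow> (nat \<times> cubic) list" where
  "correction_row i = corrections ! i"

text \<open>
  The integers are the weights of the four parts over the common denominator \<open>102400 * 1881148489728000000\<close>: the
  squares have denominators \<open>320 ^ 2\<close> and \<open>6400 ^ 2\<close>.
\<close>

definition gram :: "nat \<Rightarrow> nat \<Rightarrow> cubic" where
  "gram i j =
    (if minor_column i = [] \<or> minor_column j = [] then (1881148489728000000 * main_entry i j, 0, 0)
     else kadd (kassoc j (correction_row i))
       (1881148489728000000 * main_entry i j
        + block_weight i * (4702871224320000 * dot (minor_column i) (minor_column j)
            + (if i = j then 242713302738665472000 else 0)), 0, 0))"

definition pivot_row :: "nat \<Rightarrow> (nat \<times> cubic) list" where
  "pivot_row i = pivot_rows ! i"

definition coords :: "nat \<Rightarrow> (nat \<times> cubic) list" where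
  "coords i = (if i = 0 then [] else if pivot_row i = [] then [(i, (12800, 0, 0))] else pivot_row i)"

definition bound_row :: "nat \<Rightarrow> int list" where
  "bound_row i = bound_rows ! i"

definition gram_coords :: "nat \<Rightarrow> nat \<Rightarrow> cubic" where
  "gram_coords i j = ksum (map (\<lambda>(k, c). kmul c (gram i k)) (coords j))"

text \<open>
  The entry of the form between two classes, times \<open>12800 ^ 2\<close> and the denominator of \<open>gram\<close>.
\<close>

definition form_exact :: "nat \<Rightarrow> nat \<Rightarrow> cubic" where
  "form_exact i j = ksum (map (\<lambda>(k, c). kmul c (gram_coords k j)) (coords i))"

text \<open>
  As the form is symmetric, a row of either class serves; the index in a row is relative to the first class of the
  type.
\<close>

definition form_bound :: "nat \<Rightarrow> nat \<Rightarrow> int" where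
  "form_bound i j = (if i = 0 \<or> j = 0 then 0
     else if bound_row i \<noteq> [] then bound_row i ! (j - block_start j)
     else if bound_row j \<noteq> [] then bound_row j ! (i - block_start i)
     else main_entry i j)"

section \<open>Evaluation of the data\<close>

lemma upt_zero_numeral: "[0..<numeral n] = 0 # [1..<numeral n]"
  by (simp add: upt_rec)

lemma upt_one_numeral: "[1..<numeral n] = (if n = num.One then [] else 1 # [2..<numeral n])"
  by (cases n) (simp_all add: upt_rec numeral_2_eq_2)

lemma map_nth_upt: "length xs = n \<Longrightarrow> map ((!) xs) [0..<n] = xs"
  by (metis map_nth)

text \<open>
  Mapping a lookup over all indices and comparing with the table yields one rewrite rule for each entry.
\<close>

lemma tabulations:
  "map main_column [0..<89] = main_columns" "map minor_column [0..<89] = minor_columns"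
  "map pivot_row [0..<89] = pivot_rows" "map bound_row [0..<89] = bound_rows"
  "map correction_row [0..<89] = corrections"
  unfolding main_column_def[abs_def] minor_column_def[abs_def] pivot_row_def[abs_def] bound_row_def[abs_def] correction_row_def[abs_def]
  by (rule map_nth_upt; simp add: main_columns_def minor_columns_def pivot_rows_def bound_rows_def corrections_def)+

lemmas main_column_simps = tabulations(1)[unfolded main_columns_def, simplified upt_zero_numeral upt_one_numeral, simplified]

lemmas minor_column_simps = tabulations(2)[unfolded minor_columns_def, simplified upt_zero_numeral upt_one_numeral, simplified]

lemmas pivot_row_simps = tabulations(3)[unfolded pivot_rows_def, simplified upt_zero_numeral upt_one_numeral, simplified]

lemmas correction_row_simps = tabulations(5)[unfolded corrections_def, simplified upt_zero_numeral upt_one_numeral, simplified]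

lemmas bound_row_simps = tabulations(4)[unfolded bound_rows_def, simplified upt_zero_numeral upt_one_numeral, simplified]

lemmas form_bound_eval = main_entry_def block_weight_def block_start_def main_column_simps form_bound_def bound_row_simps

definition form_bound_row :: "nat \<Rightarrow> nat \<Rightarrow> nat \<Rightarrow> int list" where
  "form_bound_row i a b = map (form_bound i) [a..<b]"

text \<open>
  The rules are produced row by row: the effort for preparing a conjunction of rewrite rules grows quadratically.
\<close>

lemmas form_bound_row_defs =
  form_bound_row_def[of 2 2 21] form_bound_row_def[of 3 2 21] form_bound_row_def[of 4 2 21] form_bound_row_def[of 5 2 21]
  form_bound_row_def[of 6 2 21] form_bound_row_def[of 7 2 21] form_bound_row_def[of 8 2 21] form_bound_row_def[of 9 2 21]
  form_bound_row_def[of 10 2 21] form_bound_row_def[of 11 2 21] form_bound_row_def[of 12 2 21] form_bound_row_def[of 13 2 21]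
  form_bound_row_def[of 14 2 21] form_bound_row_def[of 15 2 21] form_bound_row_def[of 16 2 21] form_bound_row_def[of 17 2 21]
  form_bound_row_def[of 18 2 21] form_bound_row_def[of 19 2 21] form_bound_row_def[of 20 2 21] form_bound_row_def[of 21 21 58]
  form_bound_row_def[of 22 21 58] form_bound_row_def[of 23 21 58] form_bound_row_def[of 24 21 58] form_bound_row_def[of 25 21 58]
  form_bound_row_def[of 26 21 58] form_bound_row_def[of 27 21 58] form_bound_row_def[of 28 21 58] form_bound_row_def[of 29 21 58]
  form_bound_row_def[of 30 21 58] form_bound_row_def[of 31 21 58] form_bound_row_def[of 32 21 58] form_bound_row_def[of 33 21 58]
  form_bound_row_def[of 34 21 58] form_bound_row_def[of 35 21 58] form_bound_row_def[of 36 21 58] form_bound_row_def[of 37 21 58]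
  form_bound_row_def[of 38 21 58] form_bound_row_def[of 39 21 58] form_bound_row_def[of 40 21 58] form_bound_row_def[of 41 21 58]
  form_bound_row_def[of 42 21 58] form_bound_row_def[of 43 21 58] form_bound_row_def[of 44 21 58] form_bound_row_def[of 45 21 58]
  form_bound_row_def[of 46 21 58] form_bound_row_def[of 47 21 58] form_bound_row_def[of 48 21 58] form_bound_row_def[of 49 21 58]
  form_bound_row_def[of 50 21 58] form_bound_row_def[of 51 21 58] form_bound_row_def[of 52 21 58] form_bound_row_def[of 53 21 58]
  form_bound_row_def[of 54 21 58] form_bound_row_def[of 55 21 58] form_bound_row_def[of 56 21 58] form_bound_row_def[of 57 21 58]
  form_bound_row_def[of 58 58 89] form_bound_row_def[of 59 58 89] form_bound_row_def[of 60 58 89] form_bound_row_def[of 61 58 89]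
  form_bound_row_def[of 62 58 89] form_bound_row_def[of 63 58 89] form_bound_row_def[of 64 58 89] form_bound_row_def[of 65 58 89]
  form_bound_row_def[of 66 58 89] form_bound_row_def[of 67 58 89] form_bound_row_def[of 68 58 89] form_bound_row_def[of 69 58 89]
  form_bound_row_def[of 70 58 89] form_bound_row_def[of 71 58 89] form_bound_row_def[of 72 58 89] form_bound_row_def[of 73 58 89]
  form_bound_row_def[of 74 58 89] form_bound_row_def[of 75 58 89] form_bound_row_def[of 76 58 89] form_bound_row_def[of 77 58 89]
  form_bound_row_def[of 78 58 89] form_bound_row_def[of 79 58 89] form_bound_row_def[of 80 58 89] form_bound_row_def[of 81 58 89]
  form_bound_row_def[of 82 58 89] form_bound_row_def[of 83 58 89] form_bound_row_def[of 84 58 89] form_bound_row_def[of 85 58 89]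
  form_bound_row_def[of 86 58 89] form_bound_row_def[of 87 58 89] form_bound_row_def[of 88 58 89]
lemmas form_bound_row_defs' = form_bound_row_defs[simplified]
context notes [simp] = form_bound_eval begin
lemmas form_bound_row_values = form_bound_row_defs'[simplified]
end
lemmas form_bound_simps = form_bound_row_defs'[symmetric, unfolded form_bound_row_values, simplified list.inject simp_thms]

lemma form_bound_zero: "form_bound 0 j = 0" "form_bound i 0 = 0" by (simp_all add: form_bound_def)

text \<open>
  The list is the table of a Boolean function, with \<open>False\<close> before \<open>True\<close> in each argument.
\<close>

primrec bool_lookup :: "bool list \<Rightarrow> 'a list \<Rightarrow> 'a" where
  "bool_lookup [] xs = hd xs"
| "bool_lookup (b # bs) xs = bool_lookup bs ((if b then drop else take) (2 ^ length bs) xs)"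

lemma map_bool_lookup:
  "length xs = 2 ^ n \<Longrightarrow> map (\<lambda>bs. bool_lookup bs xs) (product_lists (replicate n [False, True])) = xs"
proof (induction n arbitrary: xs)
  case 0
  then show ?case by (cases xs) auto
next
  case (Suc n)
  let ?P = "product_lists (replicate n [False, True])"
  have len: "length bs = n" if "bs \<in> set ?P" for bs
    using in_set_product_lists_length[OF that] by simp
  have "map (\<lambda>bs. bool_lookup bs (take (2 ^ n) xs)) ?P = take (2 ^ n) xs"
       "map (\<lambda>bs. bool_lookup bs (drop (2 ^ n) xs)) ?P = drop (2 ^ n) xs"
    using Suc by simp_all
  moreover have "map (\<lambda>bs. bool_lookup bs xs) (product_lists (replicate (Suc n) [False, True]))
     = map (\<lambda>bs. bool_lookup bs (take (2 ^ n) xs)) ?P @ map (\<lambda>bs. bool_lookup bs (drop (2 ^ n) xs)) ?P"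
    using len by simp
  ultimately show ?case by simp
qed

lemma replicate_7: "replicate 7 x = [x, x, x, x, x, x, x]"
  by (simp add: numeral_eq_Suc)

definition flag_empty :: "bool \<Rightarrow> bool \<Rightarrow> bool \<Rightarrow> bool \<Rightarrow> bool \<Rightarrow> bool \<Rightarrow> bool \<Rightarrow> nat" where
  "flag_empty u1 u2 u3 v1 v2 v3 e = bool_lookup [u1, u2, u3, v1, v2, v3, e] flag_table_empty"

lemma flag_empty_table: "map (\<lambda>bs. bool_lookup bs flag_table_empty) (product_lists (replicate 7 [False, True])) = flag_table_empty"
  by (rule map_bool_lookup) (simp add: flag_table_empty_def)
lemmas flag_empty_simps = trans[OF flag_empty_table[simplified replicate_7 product_lists.simps list.map concat.simps append.simps,
    folded flag_empty_def] flag_table_empty_def, simplified list.inject]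

definition flag_edge :: "bool \<Rightarrow> bool \<Rightarrow> bool \<Rightarrow> bool \<Rightarrow> bool \<Rightarrow> bool \<Rightarrow> bool \<Rightarrow> nat" where
  "flag_edge u1 u2 u3 v1 v2 v3 e = bool_lookup [u1, u2, u3, v1, v2, v3, e] flag_table_edge"

lemma flag_edge_table: "map (\<lambda>bs. bool_lookup bs flag_table_edge) (product_lists (replicate 7 [False, True])) = flag_table_edge"
  by (rule map_bool_lookup) (simp add: flag_table_edge_def)
lemmas flag_edge_simps = trans[OF flag_edge_table[simplified replicate_7 product_lists.simps list.map concat.simps append.simps,
    folded flag_edge_def] flag_table_edge_def, simplified list.inject]

definition flag_cherry :: "bool \<Rightarrow> bool \<Rightarrow> bool \<Rightarrow> bool \<Rightarrow> bool \<Rightarrow> bool \<Rightarrow> bool \<Rightarrow> nat" where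
  "flag_cherry u1 u2 u3 v1 v2 v3 e = bool_lookup [u1, u2, u3, v1, v2, v3, e] flag_table_cherry"

lemma flag_cherry_table: "map (\<lambda>bs. bool_lookup bs flag_table_cherry) (product_lists (replicate 7 [False, True])) = flag_table_cherry"
  by (rule map_bool_lookup) (simp add: flag_table_cherry_def)
lemmas flag_cherry_simps = trans[OF flag_cherry_table[simplified replicate_7 product_lists.simps list.map concat.simps append.simps,
    folded flag_cherry_def] flag_table_cherry_def, simplified list.inject]

text \<open>
  The pairs \<open>12\<close>, \<open>13\<close>, \<open>23\<close> of roots determine the type; the roots are permuted into the position to which the
  tables refer: the edge joins the first two roots, and the centre of the cherry comes first. Triangles belong to
  class 0.
\<close>

definition flag_class :: "bool \<Rightarrow> bool \<Rightarrow> bool \<Rightarrow> bool \<Rightarrow> bool \<Rightarrow> bool \<Rightarrow> bool \<Rightarrow> bool \<Rightarrow> bool \<Rightarrow> bool \<Rightarrow> nat" where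
  "flag_class t12 t13 t23 u1 u2 u3 v1 v2 v3 e =
    (if t12 then if t13 then if t23 then 0 else flag_cherry u1 u2 u3 v1 v2 v3 e
       else if t23 then flag_cherry u2 u1 u3 v2 v1 v3 e else flag_edge u1 u2 u3 v1 v2 v3 e
     else if t13 then if t23 then flag_cherry u3 u1 u2 v3 v1 v2 e else flag_edge u1 u3 u2 v1 v3 v2 e
       else if t23 then flag_edge u2 u3 u1 v2 v3 v1 e else flag_empty u1 u2 u3 v1 v2 v3 e)"

lemma flag_class_simps:
  "flag_class False False False u1 u2 u3 v1 v2 v3 e = flag_empty u1 u2 u3 v1 v2 v3 e"
  "flag_class True False False u1 u2 u3 v1 v2 v3 e = flag_edge u1 u2 u3 v1 v2 v3 e"
  "flag_class False True False u1 u2 u3 v1 v2 v3 e = flag_edge u1 u3 u2 v1 v3 v2 e"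
  "flag_class False False True u1 u2 u3 v1 v2 v3 e = flag_edge u2 u3 u1 v2 v3 v1 e"
  "flag_class True True False u1 u2 u3 v1 v2 v3 e = flag_cherry u1 u2 u3 v1 v2 v3 e"
  "flag_class True False True u1 u2 u3 v1 v2 v3 e = flag_cherry u2 u1 u3 v2 v1 v3 e"
  "flag_class False True True u1 u2 u3 v1 v2 v3 e = flag_cherry u3 u1 u2 v3 v1 v2 e"
  "flag_class True True True u1 u2 u3 v1 v2 v3 e = 0"
  by (simp_all add: flag_class_def)

lemmas gram_eval = gram_def main_entry_def block_weight_def main_column_simps minor_column_simps correction_row_simps

definition gram_row where
  "gram_row i a b = map (gram i) [a..<b]" for i a b :: nat

lemmas gram_row_defs =
  gram_row_def[of 8 8 15] gram_row_def[of 9 8 15] gram_row_def[of 10 8 15] gram_row_def[of 11 8 15]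
  gram_row_def[of 12 8 15] gram_row_def[of 13 8 15] gram_row_def[of 14 8 15] gram_row_def[of 23 23 30]
  gram_row_def[of 24 23 30] gram_row_def[of 25 23 30] gram_row_def[of 26 23 30] gram_row_def[of 27 23 30]
  gram_row_def[of 28 23 30] gram_row_def[of 29 23 30] gram_row_def[of 59 59 65] gram_row_def[of 60 59 65]
  gram_row_def[of 61 59 65] gram_row_def[of 62 59 65] gram_row_def[of 63 59 65] gram_row_def[of 64 59 65]
lemmas gram_row_defs' = gram_row_defs[simplified]
context notes [simp] = gram_eval begin
lemmas gram_row_values = gram_row_defs'[simplified]
end
lemmas gram_simps = gram_row_defs'[symmetric, unfolded gram_row_values, simplified list.inject simp_thms]

lemmas coords_eval = coords_def pivot_row_simps

definition gram_coords_row where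
  "gram_coords_row i a b = map (gram_coords i) [a..<b]" for i a b :: nat

lemmas gram_coords_row_defs =
  gram_coords_row_def[of 8 2 15] gram_coords_row_def[of 9 2 15] gram_coords_row_def[of 10 2 15] gram_coords_row_def[of 11 2 15]
  gram_coords_row_def[of 12 2 15] gram_coords_row_def[of 13 2 15] gram_coords_row_def[of 14 2 15] gram_coords_row_def[of 23 21 30]
  gram_coords_row_def[of 24 21 30] gram_coords_row_def[of 25 21 30] gram_coords_row_def[of 26 21 30] gram_coords_row_def[of 27 21 30]
  gram_coords_row_def[of 28 21 30] gram_coords_row_def[of 29 21 30] gram_coords_row_def[of 59 58 65] gram_coords_row_def[of 60 58 65]
  gram_coords_row_def[of 61 58 65] gram_coords_row_def[of 62 58 65] gram_coords_row_def[of 63 58 65] gram_coords_row_def[of 64 58 65]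
lemmas gram_coords_row_defs' = gram_coords_row_defs[simplified]
context notes [simp] = gram_coords_def coords_eval gram_simps begin
lemmas gram_coords_row_values = gram_coords_row_defs'[simplified]
end
lemmas gram_coords_simps = gram_coords_row_defs'[symmetric, unfolded gram_coords_row_values, simplified list.inject simp_thms]

definition form_exact_row where
  "form_exact_row i a b = map (form_exact i) [a..<b]" for i a b :: nat

lemmas form_exact_row_defs =
  form_exact_row_def[of 2 2 15] form_exact_row_def[of 3 2 15] form_exact_row_def[of 4 2 15] form_exact_row_def[of 5 2 15]
  form_exact_row_def[of 6 2 15] form_exact_row_def[of 7 2 15] form_exact_row_def[of 8 2 15] form_exact_row_def[of 9 2 15]
  form_exact_row_def[of 10 2 15] form_exact_row_def[of 11 2 15] form_exact_row_def[of 12 2 15] form_exact_row_def[of 13 2 15]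
  form_exact_row_def[of 14 2 15] form_exact_row_def[of 21 21 30] form_exact_row_def[of 22 21 30] form_exact_row_def[of 23 21 30]
  form_exact_row_def[of 24 21 30] form_exact_row_def[of 25 21 30] form_exact_row_def[of 26 21 30] form_exact_row_def[of 27 21 30]
  form_exact_row_def[of 28 21 30] form_exact_row_def[of 29 21 30] form_exact_row_def[of 58 58 65] form_exact_row_def[of 59 58 65]
  form_exact_row_def[of 60 58 65] form_exact_row_def[of 61 58 65] form_exact_row_def[of 62 58 65] form_exact_row_def[of 63 58 65]
  form_exact_row_def[of 64 58 65]
lemmas form_exact_row_defs' = form_exact_row_defs[simplified]
context notes [simp] = form_exact_def coords_eval gram_coords_simps begin
lemmas form_exact_row_values = form_exact_row_defs'[simplified]
end
lemmas form_exact_simps = form_exact_row_defs'[symmetric, unfolded form_exact_row_values, simplified list.inject simp_thms]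

text \<open>
  The integer is \<open>10 ^ 12 / 102400\<close> times the denominator of \<open>form_exact\<close>.
\<close>

definition "bound_holds i j \<longleftrightarrow> kub (form_exact i j) \<le> form_bound i j * 308207368557035520000000000000000000000"

lemma bound_holds_minor_0: "list_all (\<lambda>i. list_all (bound_holds i) [2..<15]) [2..<15]"
  by (simp add: bound_holds_def form_exact_simps form_bound_simps)

lemma bound_holds_mixed_0: "list_all (\<lambda>i. list_all (bound_holds i) [15..<21]) [2..<15]"
  by (simp add: bound_holds_def form_bound_simps form_exact_def gram_coords_def coords_eval gram_def main_entry_def block_weight_def main_column_simps minor_column_simps)

lemma bound_holds_minor_1: "list_all (\<lambda>i. list_all (bound_holds i) [21..<30]) [21..<30]"
  by (simp add: bound_holds_def form_exact_simps form_bound_simps)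

lemma bound_holds_mixed_1: "list_all (\<lambda>i. list_all (bound_holds i) [30..<58]) [21..<30]"
  by (simp add: bound_holds_def form_bound_simps form_exact_def gram_coords_def coords_eval gram_def main_entry_def block_weight_def main_column_simps minor_column_simps)

lemma bound_holds_minor_2: "list_all (\<lambda>i. list_all (bound_holds i) [58..<65]) [58..<65]"
  by (simp add: bound_holds_def form_exact_simps form_bound_simps)

lemma bound_holds_mixed_2: "list_all (\<lambda>i. list_all (bound_holds i) [65..<89]) [58..<65]"
  by (simp add: bound_holds_def form_bound_simps form_exact_def gram_coords_def coords_eval gram_def main_entry_def block_weight_def main_column_simps minor_column_simps)

section \<open>All graphs with seven vertices\<close>

text \<open>
  A graph is a list of rows, the newest vertex first; a row records the adjacency of a vertex to the older ones,
  again the newest first. Graphs are generated by adding vertices. Two restrictions keep the lists short without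
  losing an isomorphism type: the new vertex has maximal degree, and within a class of twins of the old graph
  (vertices with the same other neighbours) its neighbours come first.
\<close>

primrec counted_bits :: "'a list \<Rightarrow> (nat \<times> bool list) list" where
  "counted_bits [] = [(0, [])]"
| "counted_bits (x # xs) = map (\<lambda>cN. (Suc (fst cN), True # snd cN)) (counted_bits xs)
     @ map (\<lambda>cN. (fst cN, False # snd cN)) (counted_bits xs)"

primrec matrix :: "bool \<Rightarrow> bool list list \<Rightarrow> bool list list" where
  "matrix b [] = []"
| "matrix b (N # R) = (b # N) # map2 Cons N (matrix b R)"

text \<open>
  Twins have equal rows in the adjacency matrix either with \<open>False\<close> on the diagonal (if they are not adjacent) or
  with \<open>True\<close> (if they are).
\<close>

primrec twin_table :: "(bool list \<times> bool list) list \<Rightarrow> bool list list" where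
  "twin_table [] = []"
| "twin_table (x # xs) = map (\<lambda>y. fst x = fst y \<or> snd x = snd y) xs # twin_table xs"

primrec twins_sorted :: "bool list list \<Rightarrow> bool list \<Rightarrow> bool" where
  "twins_sorted [] N = True"
| "twins_sorted (t # ts) N =
     ((if hd N then True else list_all (\<lambda>tb. \<not> (fst tb \<and> snd tb)) (zip t (tl N))) \<and> twins_sorted ts (tl N))"

primrec count_true :: "bool list \<Rightarrow> nat" where
  "count_true [] = 0"
| "count_true (b # bs) = (if b then Suc (count_true bs) else count_true bs)"

primrec degrees :: "bool list list \<Rightarrow> nat list" where
  "degrees [] = []"
| "degrees (N # R) = count_true N # map2 (\<lambda>b d. if b then Suc d else d) N (degrees R)"

text \<open>
  \<open>D\<close> and \<open>m\<close> are the degrees of the old graph and their maximum, and \<open>c\<close> is the degree of the new vertex. If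
  \<open>c = m\<close>, no neighbour of the new vertex may have had degree \<open>m\<close> before.
\<close>

definition admissible :: "bool list list \<Rightarrow> nat list \<Rightarrow> nat \<Rightarrow> nat \<Rightarrow> bool list \<Rightarrow> bool" where
  "admissible T D m c N =
    (if c < m then False
     else if m < c then twins_sorted T N
     else if list_all (\<lambda>bd. fst bd \<longrightarrow> snd bd < m) (zip N D) then twins_sorted T N else False)"

definition extension_data :: "bool list list \<Rightarrow> bool list list \<times> nat list \<times> nat" where
  "extension_data R = (twin_table (zip (matrix False R) (matrix True R)), degrees R, fold max (degrees R) 0)"

definition extensions :: "bool list list \<Rightarrow> bool list list list" where
  "extensions R = (case extension_data R of (T, D, m) \<Rightarrow>
     map (\<lambda>cN. snd cN # R) (filter (\<lambda>cN. admissible T D m (fst cN) (snd cN)) (counted_bits R)))"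

primrec graphs :: "nat \<Rightarrow> bool list list list" where
  "graphs 0 = [[]]"
| "graphs (Suc n) = concat (map extensions (graphs n))"

text \<open>
  The simplifier does not evaluate these names, so it can rewrite the list of graphs of one order by the list of
  the previous order.
\<close>

definition "order_2 = Suc (Suc 0)"

definition "order_3 = Suc order_2"

definition "order_4 = Suc order_3"

definition "order_5 = Suc order_4"

definition "order_6 = Suc order_5"

context
  notes [simp] = extensions_def extension_data_def admissible_def
begin
lemmas graphs_2 = arg_cong[OF order_2_def, of graphs, simplified]
lemmas graphs_3 = arg_cong[OF order_3_def, of graphs, simplified graphs.simps graphs_2, simplified]
lemmas graphs_4 = arg_cong[OF order_4_def, of graphs, simplified graphs.simps graphs_3, simplified]
lemmas graphs_5 = arg_cong[OF order_5_def, of graphs, simplified graphs.simps graphs_4, simplified]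
lemmas graphs_6 = arg_cong[OF order_6_def, of graphs, simplified graphs.simps graphs_5, simplified]
end

definition relabel :: "(nat \<Rightarrow> nat) \<Rightarrow> (nat \<Rightarrow> nat \<Rightarrow> bool) \<Rightarrow> nat \<Rightarrow> nat \<Rightarrow> bool" where
  "relabel \<pi> h = (\<lambda>i j. h (\<pi> i) (\<pi> j))"

definition simple_rel :: "('a \<Rightarrow> 'a \<Rightarrow> bool) \<Rightarrow> bool" where
  "simple_rel h \<longleftrightarrow> (\<forall>i j. h i j = h j i) \<and> (\<forall>i. \<not> h i i)"

primrec rows :: "nat \<Rightarrow> (nat \<Rightarrow> nat \<Rightarrow> bool) \<Rightarrow> bool list list" where
  "rows 0 h = []"
| "rows (Suc n) h = map (h n) (rev [0..<n]) # rows n h"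

lemma simple_rel_relabel: "simple_rel h \<Longrightarrow> simple_rel (relabel \<pi> h)"
  by (simp add: simple_rel_def relabel_def)

lemma length_rows [simp]: "length (rows n h) = n"
  by (induction n) auto

lemma rows_cong: "(\<And>i j. i < n \<Longrightarrow> j < n \<Longrightarrow> h i j = h' i j) \<Longrightarrow> rows n h = rows n h'"
  by (induction n) auto

lemma map2_map_map: "map2 f (map g xs) (map k xs) = map (\<lambda>x. f (g x) (k x)) xs"
  by (induction xs) auto

lemma matrix_rows:
  assumes "simple_rel h"
  shows "matrix b (rows n h) = map (\<lambda>i. map (\<lambda>j. if i = j then b else h i j) (rev [0..<n])) (rev [0..<n])"
proof (induction n)
  case (Suc n)
  have *: "(if i = n then b else h i n) = h n i" if "i < n" for i
    using assms that by (auto simp: simple_rel_def)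
  have "map (\<lambda>i. h n i # map (\<lambda>j. if i = j then b else h i j) (rev [0..<n])) (rev [0..<n])
    = map (\<lambda>i. map (\<lambda>j. if i = j then b else h i j) (rev [0..<Suc n])) (rev [0..<n])"
    using assms by (auto simp: simple_rel_def)
  then show ?case by (simp add: Suc map2_map_map)
qed simp

lemma count_true_filter: "count_true (map P xs) = length (filter P xs)"
  by (induction xs) auto

lemma count_true_rev_upt: "count_true (map P (rev [0..<n])) = card {j. j < n \<and> P j}"
proof -
  have "length (filter P (rev [0..<n])) = card (set (filter P (rev [0..<n])))"
    by (rule distinct_card[symmetric]) simp
  also have "set (filter P (rev [0..<n])) = {j. j < n \<and> P j}"
    by auto
  finally show ?thesis by (simp add: count_true_filter)
qed

lemma card_less_Suc_Collect:
  "card {j. j < Suc n \<and> P j} = card {j. j < n \<and> P j} + (if P n then 1 else 0)"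
proof -
  have "{j. j < Suc n \<and> P j} = (if P n then insert n {j. j < n \<and> P j} else {j. j < n \<and> P j})"
    by (auto simp: less_Suc_eq)
  then show ?thesis by auto
qed

lemma degrees_rows:
  assumes "simple_rel h"
  shows "degrees (rows n h) = map (\<lambda>i. card {j. j < n \<and> h i j}) (rev [0..<n])"
proof (induction n)
  case (Suc n)
  have "{j. j < Suc n \<and> h n j} = {j. j < n \<and> h n j}"
    using assms by (auto simp: simple_rel_def less_Suc_eq)
  moreover have "map2 (\<lambda>b d. if b then Suc d else d) (map (h n) (rev [0..<n])) (map (\<lambda>i. card {j. j < n \<and> h i j}) (rev [0..<n]))
      = map (\<lambda>i. card {j. j < Suc n \<and> h i j}) (rev [0..<n])"
    using assms by (simp add: map2_map_map card_less_Suc_Collect simple_rel_def)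
  ultimately show ?case
    by (simp add: Suc count_true_rev_upt)
qed simp

lemma counted_bits_mem: "length N = length xs \<Longrightarrow> (count_true N, N) \<in> set (counted_bits xs)"
proof (induction xs arbitrary: N)
  case (Cons x xs)
  then obtain b N' where N: "N = b # N'" "length N' = length xs"
    by (cases N) auto
  from Cons.IH[OF N(2)] show ?case
    by (cases b) (auto simp: N(1) image_iff intro: bexI[where x = "(count_true N', N')"])
qed simp

text \<open>
  If the neighbours do not come first, two twins can be exchanged to improve the row.
\<close>

lemma not_twins_sorted:
  assumes "length N = length X" "\<not> twins_sorted (twin_table X) N"
  shows "\<exists>p q. p < q \<and> q < length X \<and> (fst (X ! p) = fst (X ! q) \<or> snd (X ! p) = snd (X ! q)) \<and> N ! q \<and> \<not> N ! p"
  using assms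
proof (induction X arbitrary: N)
  case (Cons x X)
  then obtain b N' where N: "N = b # N'" "length N' = length X"
    by (cases N) auto
  consider "\<not> twins_sorted (twin_table X) N'"
    | "\<not> b" "\<not> list_all (\<lambda>tb. \<not> (fst tb \<and> snd tb)) (zip (map (\<lambda>y. fst x = fst y \<or> snd x = snd y) X) N')"
    using Cons.prems(2) N by (auto split: if_splits)
  then show ?case
  proof cases
    case 1
    from Cons.IH[OF N(2) 1] obtain p q where
      "p < q" "q < length X" "fst (X ! p) = fst (X ! q) \<or> snd (X ! p) = snd (X ! q)" "N' ! q" "\<not> N' ! p"
      by blast
    then show ?thesis
      by (intro exI[of _ "Suc p"] exI[of _ "Suc q"]) (simp add: N(1))
  next
    case 2
    from 2(2) obtain k where "k < length X" "fst x = fst (X ! k) \<or> snd x = snd (X ! k)" "N' ! k"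
      using N(2) by (auto simp: list_all_iff in_set_conv_nth)
    then show ?thesis
      using 2(1) by (intro exI[of _ 0] exI[of _ "Suc k"]) (simp add: N(1))
  qed
qed simp

lemma card_relabel:
  assumes "\<pi> permutes {..<n}"
  shows "card {j. j < n \<and> relabel \<pi> h i j} = card {j. j < n \<and> h (\<pi> i) j}"
proof -
  have "bij_betw \<pi> {j. j < n \<and> relabel \<pi> h i j} {j. j < n \<and> h (\<pi> i) j}"
    unfolding bij_betw_def relabel_def
  proof
    show "inj_on \<pi> {j. j < n \<and> h (\<pi> i) (\<pi> j)}"
      using permutes_inj[OF assms] by (rule inj_on_subset) simp
    show "\<pi> ` {j. j < n \<and> h (\<pi> i) (\<pi> j)} = {j. j < n \<and> h (\<pi> i) j}"
    proof (intro equalityI subsetI)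
      fix k assume k: "k \<in> {j. j < n \<and> h (\<pi> i) j}"
      then have "k \<in> \<pi> ` {..<n}" using permutes_image[OF assms] by simp
      then show "k \<in> \<pi> ` {j. j < n \<and> h (\<pi> i) (\<pi> j)}" using k by auto
    qed (use permutes_in_image[OF assms] in auto)
  qed
  then show ?thesis by (rule bij_betw_same_card)
qed

lemma fold_max_le: "fold max xs (a::nat) \<le> b \<longleftrightarrow> a \<le> b \<and> (\<forall>x\<in>set xs. x \<le> b)"
  by (induction xs arbitrary: a) auto

lemma relabel_relabel: "relabel \<pi> (relabel \<tau> h) = relabel (\<tau> \<circ> \<pi>) h"
  by (simp add: relabel_def)

text \<open>
  By induction, the graph without a vertex of maximal degree can be relabelled to a generated one. Among all
  relabellings with these two properties, one that maximises the sum of the labels of the neighbours of the new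
  vertex respects the order of twins: exchanging two twins in the wrong order would keep the two properties and
  increase the sum.
\<close>

lemma graphs_complete:
  assumes "simple_rel h"
  shows "\<exists>\<pi>. \<pi> permutes {..<n} \<and> rows n (relabel \<pi> h) \<in> set (graphs n)"
  using assms
proof (induction n arbitrary: h)
  case 0
  show ?case using permutes_id by auto
next
  case (Suc n)
  define deg where "deg g i = card {j. j < Suc n \<and> g i j}" for g :: "nat \<Rightarrow> nat \<Rightarrow> bool" and i
  \<comment> \<open>the relabellings with a generated old graph and a new vertex of maximal degree\<close>
  define S where "S = {\<pi>. \<pi> permutes {..<Suc n} \<and> rows n (relabel \<pi> h) \<in> set (graphs n)
      \<and> (\<forall>i\<le>n. deg (relabel \<pi> h) i \<le> deg (relabel \<pi> h) n)}"
  have deg_relabel: "deg (relabel \<pi> g) i = deg g (\<pi> i)" if "\<pi> permutes {..<Suc n}" for \<pi> g i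
    unfolding deg_def by (rule card_relabel[OF that])
  have finS: "finite S"
    unfolding S_def by (rule finite_subset[OF _ finite_permutations[of "{..<Suc n}"]]) auto
  have "S \<noteq> {}"
  proof -
    have "finite (deg h ` {..n})" "deg h ` {..n} \<noteq> {}" by auto
    from Max_in[OF this] obtain v where "v \<le> n" and v': "deg h v = Max (deg h ` {..n})"
      by (metis (no_types, lifting) atMost_iff imageE)
    with \<open>finite (deg h ` {..n})\<close> have v: "v \<le> n" "\<forall>i\<le>n. deg h i \<le> deg h v"
      by simp_all
    let ?\<tau> = "Transposition.transpose v n"
    have \<tau>: "?\<tau> permutes {..<Suc n}" using v(1) by (intro permutes_swap_id) auto
    obtain \<pi> where \<pi>: "\<pi> permutes {..<n}" "rows n (relabel \<pi> (relabel ?\<tau> h)) \<in> set (graphs n)"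
      using Suc.IH[OF simple_rel_relabel[OF Suc.prems]] by blast
    have \<pi>': "\<pi> permutes {..<Suc n}" using \<pi>(1) by (rule permutes_subset) auto
    have comp: "?\<tau> \<circ> \<pi> permutes {..<Suc n}" by (rule permutes_compose[OF \<pi>' \<tau>])
    have "\<pi> n = n" using \<pi>(1) by (simp add: permutes_not_in)
    have "?\<tau> \<circ> \<pi> \<in> S"
      unfolding S_def
    proof (intro CollectI conjI comp allI impI)
      show "rows n (relabel (?\<tau> \<circ> \<pi>) h) \<in> set (graphs n)"
        using \<pi>(2) by (simp add: relabel_relabel)
      fix i assume "i \<le> n"
      then have "(?\<tau> \<circ> \<pi>) i \<le> n"
        using permutes_in_image[OF comp, of i] by auto
      then show "deg (relabel (?\<tau> \<circ> \<pi>) h) i \<le> deg (relabel (?\<tau> \<circ> \<pi>) h) n"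
        unfolding deg_relabel[OF comp] using v(2) \<open>\<pi> n = n\<close> by simp
    qed
    then show ?thesis by blast
  qed
  \<comment> \<open>larger labels come first in a row, so moving neighbours forward increases this sum\<close>
  define w where "w \<pi> = (\<Sum>i<n. if relabel \<pi> h n i then i else 0)" for \<pi>
  have "Max (w ` S) \<in> w ` S"
    using finS \<open>S \<noteq> {}\<close> by (intro Max_in) auto
  then obtain \<pi> where \<pi>S: "\<pi> \<in> S" and w\<pi>: "w \<pi> = Max (w ` S)"
    by (metis imageE)
  have wmax: "w \<pi>' \<le> w \<pi>" if "\<pi>' \<in> S" for \<pi>'
    unfolding w\<pi> using finS that by (intro Max_ge) auto
  define g where "g = relabel \<pi> h"
  have g: "simple_rel g" unfolding g_def by (rule simple_rel_relabel[OF Suc.prems])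
  have gsym: "g i j = g j i" and girr: "\<not> g i i" for i j
    using g by (auto simp: simple_rel_def)
  from \<pi>S have \<pi>: "\<pi> permutes {..<Suc n}" and R: "rows n g \<in> set (graphs n)"
    and dmax: "\<And>i. i \<le> n \<Longrightarrow> deg g i \<le> deg g n"
    by (auto simp: S_def g_def)
  let ?N = "map (g n) (rev [0..<n])"
  let ?R = "rows n g"
  let ?T = "twin_table (zip (matrix False ?R) (matrix True ?R))"
  let ?m = "fold max (degrees ?R) 0"
  have cN: "count_true ?N = deg g n"
    using girr[of n] by (simp add: count_true_rev_upt deg_def card_less_Suc_Collect)
  have deg_Suc: "deg g i = card {j. j < n \<and> g i j} + (if g i n then 1 else 0)" for i
    by (simp add: deg_def card_less_Suc_Collect)
  have twins: "twins_sorted ?T ?N"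
  proof (rule ccontr)
    assume "\<not> ?thesis"
    moreover have "length ?N = length (zip (matrix False ?R) (matrix True ?R))"
      by (simp add: matrix_rows[OF g])
    ultimately obtain p q where pq: "p < q" "q < n"
      "matrix False ?R ! p = matrix False ?R ! q \<or> matrix True ?R ! p = matrix True ?R ! q"
      "?N ! q" "\<not> ?N ! p"
      using not_twins_sorted[of ?N "zip (matrix False ?R) (matrix True ?R)"]
      by (auto simp: matrix_rows[OF g])
    \<comment> \<open>positions in a row count from the newest vertex, labels from the oldest one\<close>
    define i where "i = n - 1 - p"
    define j where "j = n - 1 - q"
    have ij: "j < i" "i < n" "j < n" using pq(1,2) unfolding i_def j_def by linarith+
    have nth_rev: "rev [0..<n] ! k = n - 1 - k" if "k < n" for k
      using that by (simp add: rev_nth)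
    have gj: "g n j" and gi: "\<not> g n i"
      using pq nth_rev[of p] nth_rev[of q] by (auto simp: i_def j_def)
    have twin: "g i k = g j k" if "k < n" "k \<noteq> i" "k \<noteq> j" for k
    proof -
      have row: "matrix b ?R ! p = map (\<lambda>l. if i = l then b else g i l) (rev [0..<n])"
                "matrix b ?R ! q = map (\<lambda>l. if j = l then b else g j l) (rev [0..<n])" for b
        using pq(1,2) nth_rev[of p] nth_rev[of q] by (auto simp: matrix_rows[OF g] i_def j_def)
      have "\<exists>b. map (\<lambda>l. if i = l then b else g i l) (rev [0..<n]) = map (\<lambda>l. if j = l then b else g j l) (rev [0..<n])"
        using pq(3) unfolding row by blast
      then obtain b where "\<forall>l\<in>{0..<n}. (if i = l then b else g i l) = (if j = l then b else g j l)"
        unfolding map_eq_conv set_rev set_upt by blast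
      then show ?thesis using that by (auto dest!: bspec[where x = k])
    qed
    define \<tau> where "\<tau> = Transposition.transpose i j"
    have \<tau>: "\<tau> permutes {..<Suc n}" unfolding \<tau>_def using ij by (intro permutes_swap_id) auto
    have comp: "\<pi> \<circ> \<tau> permutes {..<Suc n}" by (rule permutes_compose[OF \<tau> \<pi>])
    have gt: "relabel (\<pi> \<circ> \<tau>) h = relabel \<tau> g"
      by (simp add: g_def relabel_relabel)
    have \<tau>n: "\<tau> n = n" using ij by (simp add: \<tau>_def Transposition.transpose_def)
    have same: "relabel \<tau> g a b = g a b" if "a < n" "b < n" for a b
      using twin[of a] twin[of b] gsym girr that
      unfolding relabel_def \<tau>_def Transposition.transpose_def by (smt (verit))
    have "\<pi> \<circ> \<tau> \<in> S"
      unfolding S_def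
    proof (intro CollectI conjI comp allI impI)
      show "rows n (relabel (\<pi> \<circ> \<tau>) h) \<in> set (graphs n)"
        unfolding gt using R rows_cong[of n "relabel \<tau> g" g] same by simp
      fix k assume "k \<le> n"
      then have "\<tau> k \<le> n" using permutes_in_image[OF \<tau>, of k] by auto
      then show "deg (relabel (\<pi> \<circ> \<tau>) h) k \<le> deg (relabel (\<pi> \<circ> \<tau>) h) n"
        unfolding gt deg_relabel[OF \<tau>] \<tau>n by (rule dmax)
    qed
    then have "w (\<pi> \<circ> \<tau>) \<le> w \<pi>" by (rule wmax)
    moreover have "w (\<pi> \<circ> \<tau>) = (\<Sum>k<n. if g n (\<tau> k) then k else 0)"
      unfolding w_def gt by (simp add: relabel_def \<tau>n)
    moreover have "w \<pi> = (\<Sum>k<n. if g n k then k else 0)"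
      unfolding w_def g_def ..
    ultimately have le: "(\<Sum>k<n. if g n (\<tau> k) then k else 0) \<le> (\<Sum>k<n. if g n k then k else 0)"
      by simp
    have split: "(\<Sum>k<n. f k) = f i + f j + (\<Sum>k\<in>{..<n} - {i, j}. f k)" for f :: "nat \<Rightarrow> nat"
    proof -
      have "(\<Sum>k<n. f k) = f i + (\<Sum>k\<in>{..<n} - {i}. f k)"
        using ij by (intro sum.remove) auto
      also have "(\<Sum>k\<in>{..<n} - {i}. f k) = f j + (\<Sum>k\<in>{..<n} - {i} - {j}. f k)"
        using ij by (intro sum.remove) auto
      also have "{..<n} - {i} - {j} = {..<n} - {i, j}" by auto
      finally show ?thesis by simp
    qed
    have rest: "(\<Sum>k\<in>{..<n} - {i, j}. if g n (\<tau> k) then k else 0) = (\<Sum>k\<in>{..<n} - {i, j}. if g n k then k else 0)"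
      by (rule sum.cong) (auto simp: \<tau>_def Transposition.transpose_def)
    have "\<tau> i = j" "\<tau> j = i" by (simp_all add: \<tau>_def)
    then show False
      using le gi gj ij unfolding split[of "\<lambda>k. if g n (\<tau> k) then k else 0"] split[of "\<lambda>k. if g n k then k else 0"] rest
      by simp
  qed
  have dR: "d \<in> set (degrees ?R) \<longleftrightarrow> (\<exists>i<n. d = card {j. j < n \<and> g i j})" for d
    by (auto simp: degrees_rows[OF g])
  have mle: "?m \<le> count_true ?N"
    unfolding fold_max_le cN
  proof (intro conjI ballI)
    fix d assume "d \<in> set (degrees ?R)"
    then obtain i where i: "i < n" "d = card {j. j < n \<and> g i j}" using dR by blast
    have "d \<le> deg g i" using i(2) deg_Suc[of i] by simp
    also have "\<dots> \<le> deg g n" using dmax[of i] i(1) by simp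
    finally show "d \<le> deg g n" .
  qed simp
  have low: "list_all (\<lambda>bd. fst bd \<longrightarrow> snd bd < ?m) (zip ?N (degrees ?R))" if "count_true ?N = ?m"
  proof -
    have "card {j. j < n \<and> g i j} < ?m" if "i < n" "g n i" for i
      using dmax[of i] deg_Suc[of i] that gsym[of n i] cN \<open>count_true ?N = ?m\<close> by simp
    then show ?thesis
      by (auto simp: degrees_rows[OF g] list_all_iff zip_map_map zip_same_conv_map)
  qed
  have adm: "admissible ?T (degrees ?R) ?m (count_true ?N) ?N"
    unfolding admissible_def using twins mle low by auto
  have "(count_true ?N, ?N) \<in> set (counted_bits ?R)"
    by (rule counted_bits_mem) simp
  then have "?N # ?R \<in> set (extensions ?R)"
    unfolding extensions_def extension_data_def using adm by (force simp: image_iff)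
  then have "rows (Suc n) g \<in> set (graphs (Suc n))"
    using R by auto
  then show ?case using \<pi> unfolding g_def by blast
qed

section \<open>The local inequality, evaluated\<close>

text \<open>
  The local expression for a choice of three roots among seven vertices. The arguments are the classes of the six
  pairs of the other four vertices \<open>u\<close>, \<open>v\<close>, \<open>w\<close>, \<open>z\<close>, complementary pairs being adjacent: \<open>uv\<close>, \<open>wz\<close>, \<open>uw\<close>, \<open>vz\<close>,
  \<open>uz\<close>, \<open>vw\<close>. The first three terms are entries of the form. Class 58 is the cherry with two isolated vertices, so
  the last four terms count the triples of free vertices that together with the roots induce the target graph,
  each with weight 45. Everything is scaled by 102400.
\<close>

definition splits :: "nat \<Rightarrow> nat \<Rightarrow> nat \<Rightarrow> nat \<Rightarrow> nat \<Rightarrow> nat \<Rightarrow> int" where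
  "splits c1 c2 c3 c4 c5 c6 = form_bound c1 c2 + form_bound c3 c4 + form_bound c5 c6
     + (if c1 = 58 \<and> c3 = 58 \<and> c6 = 58 then 4608000 else 0) + (if c1 = 58 \<and> c4 = 58 \<and> c5 = 58 then 4608000 else 0)
     + (if c2 = 58 \<and> c3 = 58 \<and> c5 = 58 then 4608000 else 0) + (if c2 = 58 \<and> c4 = 58 \<and> c6 = 58 then 4608000 else 0)"

text \<open>
  Off the diagonal, the adjacency that the rows describe.
\<close>

definition entry :: "bool list list \<Rightarrow> nat \<Rightarrow> nat \<Rightarrow> bool" where
  "entry R i j = (if j < i then R ! (6 - i) ! (i - 1 - j) else R ! (6 - j) ! (j - 1 - i))"

definition pair_class :: "(nat \<Rightarrow> nat \<Rightarrow> bool) \<Rightarrow> nat \<Rightarrow> nat \<Rightarrow> nat \<Rightarrow> nat \<Rightarrow> nat \<Rightarrow> nat" where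
  "pair_class h a b c u v = flag_class (h a b) (h a c) (h b c) (h a u) (h b u) (h c u) (h a v) (h b v) (h c v) (h u v)"

text \<open>
  The 35 choices of three roots, followed by the four other vertices.
\<close>

definition arrangements :: "(nat \<times> nat \<times> nat \<times> nat \<times> nat \<times> nat \<times> nat) list" where
  "arrangements = [(0, 1, 2, 3, 4, 5, 6), (0, 1, 3, 2, 4, 5, 6), (0, 1, 4, 2, 3, 5, 6), (0, 1, 5, 2, 3, 4, 6), (0, 1, 6, 2, 3, 4, 5),
     (0, 2, 3, 1, 4, 5, 6), (0, 2, 4, 1, 3, 5, 6), (0, 2, 5, 1, 3, 4, 6), (0, 2, 6, 1, 3, 4, 5), (0, 3, 4, 1, 2, 5, 6),
     (0, 3, 5, 1, 2, 4, 6), (0, 3, 6, 1, 2, 4, 5), (0, 4, 5, 1, 2, 3, 6), (0, 4, 6, 1, 2, 3, 5), (0, 5, 6, 1, 2, 3, 4),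
     (1, 2, 3, 0, 4, 5, 6), (1, 2, 4, 0, 3, 5, 6), (1, 2, 5, 0, 3, 4, 6), (1, 2, 6, 0, 3, 4, 5), (1, 3, 4, 0, 2, 5, 6),
     (1, 3, 5, 0, 2, 4, 6), (1, 3, 6, 0, 2, 4, 5), (1, 4, 5, 0, 2, 3, 6), (1, 4, 6, 0, 2, 3, 5), (1, 5, 6, 0, 2, 3, 4),
     (2, 3, 4, 0, 1, 5, 6), (2, 3, 5, 0, 1, 4, 6), (2, 3, 6, 0, 1, 4, 5), (2, 4, 5, 0, 1, 3, 6), (2, 4, 6, 0, 1, 3, 5),
     (2, 5, 6, 0, 1, 3, 4), (3, 4, 5, 0, 1, 2, 6), (3, 4, 6, 0, 1, 2, 5), (3, 5, 6, 0, 1, 2, 4), (4, 5, 6, 0, 1, 2, 3)]"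

definition local_values :: "(nat \<Rightarrow> nat \<Rightarrow> nat \<Rightarrow> nat \<Rightarrow> nat \<Rightarrow> nat \<Rightarrow> 'a) \<Rightarrow> (nat \<Rightarrow> nat \<Rightarrow> bool) \<Rightarrow> 'a list" where
  "local_values f h = map (\<lambda>(a, b, c, u, v, w, z). f (pair_class h a b c u v) (pair_class h a b c w z)
     (pair_class h a b c u w) (pair_class h a b c v z) (pair_class h a b c u z) (pair_class h a b c v w)) arrangements"
lemmas local_values_eval = local_values_def[of _ "entry [[b65, b64, b63, b62, b61, b60], [b54, b53, b52, b51, b50], [b43, b42, b41, b40], [b32, b31, b30], [b21, b20], [b10], []]" for b65 b64 b63 b62 b61 b60 b54 b53 b52 b51 b50 b43 b42 b41 b40 b32 b31 b30 b21 b20 b10,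
    unfolded arrangements_def list.map prod.case pair_class_def, simplified entry_def, simplified]

definition base_adj :: "nat \<Rightarrow> nat \<Rightarrow> bool" where
  "base_adj i j \<longleftrightarrow> (i = 0 \<and> j = 1) \<or> (i = 1 \<and> j = 0) \<or> (i = 2 \<and> j = 3) \<or> (i = 3 \<and> j = 2)"

primrec colouring_rows :: "nat list \<Rightarrow> bool list list" where
  "colouring_rows [] = []"
| "colouring_rows (c # cs) = map (base_adj c) cs # colouring_rows cs"

text \<open>
  The graphs with equality are induced subgraphs of blowups of the optimal pattern. Each is given by the parts of
  its vertices.
\<close>

definition tight_colourings :: "nat list list" where
  "tight_colourings =
    [[0, 0, 0, 0, 0, 0, 0], [3, 2, 0, 0, 0, 0, 0], [3, 2, 2, 0, 0, 0, 0], [3, 2, 2, 2, 0, 0, 0],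
     [3, 2, 2, 2, 2, 0, 0], [3, 2, 2, 2, 2, 2, 0], [1, 0, 0, 0, 0, 0, 0], [1, 3, 2, 0, 4, 4, 4],
     [1, 3, 2, 0, 0, 4, 4], [1, 3, 2, 0, 0, 0, 4], [1, 3, 2, 0, 0, 0, 0], [3, 3, 2, 2, 0, 0, 0],
     [1, 3, 2, 2, 0, 0, 4], [1, 3, 2, 2, 0, 0, 0], [3, 3, 2, 2, 2, 0, 0], [3, 3, 2, 2, 2, 2, 0],
     [1, 1, 0, 0, 0, 0, 0], [1, 1, 3, 2, 0, 0, 4], [1, 1, 3, 2, 0, 0, 0], [1, 3, 3, 2, 2, 0, 0],
     [3, 1, 3, 2, 2, 0, 0], [1, 1, 3, 2, 2, 0, 0], [3, 3, 3, 2, 2, 2, 0], [1, 1, 1, 0, 0, 0, 0]]"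

definition tight_graphs :: "bool list list list" where
  "tight_graphs = map colouring_rows tight_colourings"

context notes [simp] = base_adj_def begin
lemmas tight_graphs_eval = tight_graphs_def[unfolded tight_colourings_def, simplified]
end

text \<open>
  The bound leaves a distance of 30000 to the scaled target, which every graph outside the list pays.
\<close>

definition good :: "bool list list \<Rightarrow> bool" where
  "good R = (if sum_list (local_values splits (entry R)) \<le> 7768038 then True else R \<in> set tight_graphs)"

text \<open>
  Extensions of the graphs with six vertices are checked as they are generated, so the list of all graphs with
  seven vertices is never written out.
\<close>

definition check_all :: "(bool list list \<Rightarrow> bool) \<Rightarrow> bool list list \<Rightarrow> bool list list \<Rightarrow> nat list \<Rightarrow> nat \<Rightarrow> (nat \<times> bool list) list \<Rightarrow> bool" where
  "check_all P R T D m L = list_all (\<lambda>cN. if admissible T D m (fst cN) (snd cN) then P (snd cN # R) else True) L"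

lemma check_all_simps:
  "check_all P R T D m [] = True"
  "check_all P R T D m ((c, N) # L) = ((if admissible T D m c N then P (N # R) else True) \<and> check_all P R T D m L)"
  by (simp_all add: check_all_def)

definition check_extensions :: "(bool list list \<Rightarrow> bool) \<Rightarrow> bool list list \<Rightarrow> bool" where
  "check_extensions P R = list_all P (extensions R)"

lemma check_extensions_eq:
  "check_extensions P R = (case extension_data R of (T, D, m) \<Rightarrow> check_all P R T D m (counted_bits R))"
  by (auto simp: check_extensions_def extensions_def check_all_def list_all_iff split: prod.splits)

definition "six_bits = counted_bits [True, True, True, True, True, True]"

lemma counted_bits_cong: "length xs = length ys \<Longrightarrow> counted_bits xs = counted_bits ys"
  by (induction xs ys rule: list_induct2) auto

lemma counted_bits_6: "counted_bits [a, b, c, d, e, f] = six_bits"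
  unfolding six_bits_def by (rule counted_bits_cong) simp
lemmas six_bits_eval = six_bits_def[simplified]

lemmas table_simps = flag_class_simps flag_empty_simps flag_edge_simps flag_cherry_simps form_bound_simps form_bound_zero

lemmas num_simps = arith_simps rel_simps add_numeral_special mult_1 mult_1_right numeral_One simp_thms if_True if_False

lemmas gen_simps = check_extensions_eq extension_data_def check_all_simps counted_bits_6 six_bits_eval admissible_def
  twin_table.simps matrix.simps twins_sorted.simps count_true.simps degrees.simps list.map zip_Cons_Cons zip.simps(1)
  prod.case fst_conv snd_conv list.sel(1,3) list.pred_inject fold_simps max_Suc_Suc max_0L max_0R
  Suc_less_eq zero_less_Suc not_less_zero nat.inject nat.distinct list.inject list.distinct bool_simps if_True if_False

lemmas val_simps = good_def local_values_eval sum_list.Cons sum_list.Nil add_0_right splits_def table_simps num_simps tight_graphs_eval list.set insert_iff empty_iff list.inject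

lemma good_part_0: "list_all (check_extensions good) (take 47 (graphs order_6))"
  by (simp add: graphs_6, simp only: gen_simps cong: if_weak_cong, simp only: val_simps cong: if_weak_cong)

lemma good_part_1: "list_all (check_extensions good) (take 47 (drop 47 (graphs order_6)))"
  by (simp add: graphs_6, simp only: gen_simps cong: if_weak_cong, simp only: val_simps cong: if_weak_cong)

lemma good_part_2: "list_all (check_extensions good) (take 47 (drop 94 (graphs order_6)))"
  by (simp add: graphs_6, simp only: gen_simps cong: if_weak_cong, simp only: val_simps cong: if_weak_cong)

lemma good_part_3: "list_all (check_extensions good) (take 47 (drop 141 (graphs order_6)))"
  by (simp add: graphs_6, simp only: gen_simps cong: if_weak_cong, simp only: val_simps cong: if_weak_cong)

lemma good_part_4: "list_all (check_extensions good) (take 47 (drop 188 (graphs order_6)))"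
  by (simp add: graphs_6, simp only: gen_simps cong: if_weak_cong, simp only: val_simps cong: if_weak_cong)

lemma good_part_5: "list_all (check_extensions good) (drop 235 (graphs order_6))"
  by (simp add: graphs_6, simp only: gen_simps cong: if_weak_cong, simp only: val_simps cong: if_weak_cong)

lemma list_all_chunk:
  "list_all P (take n (drop m xs)) \<Longrightarrow> list_all P (drop (m + n) xs) \<Longrightarrow> list_all P (drop m xs)"
  by (metis add.commute append_take_drop_id drop_drop list_all_append)

lemma all_good: "list_all good (graphs (Suc order_6))"
proof -
  have "list_all (check_extensions good) (drop 0 (graphs order_6))"
    apply (rule list_all_chunk[where n = 47], use good_part_0 in simp)
    apply (rule list_all_chunk[where n = 47], use good_part_1 in simp)
    apply (rule list_all_chunk[where n = 47], use good_part_2 in simp)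
    apply (rule list_all_chunk[where n = 47], use good_part_3 in simp)
    apply (rule list_all_chunk[where n = 47], use good_part_4 in simp)
    using good_part_5 by simp
  then show ?thesis
    by (auto simp: list_all_iff check_extensions_def)
qed

text \<open>
  The same expression in the field; the integer is 45 times the denominator of \<open>form_exact\<close>.
\<close>

definition splits_exact :: "nat \<Rightarrow> nat \<Rightarrow> nat \<Rightarrow> nat \<Rightarrow> nat \<Rightarrow> nat \<Rightarrow> cubic" where
  "splits_exact c1 c2 c3 c4 c5 c6 = kadd (form_exact c1 c2) (kadd (form_exact c3 c4) (kadd (form_exact c5 c6)
     ((if c1 = 58 \<and> c3 = 58 \<and> c6 = 58 then 1420219554310819676160000000000000 else 0)
     + (if c1 = 58 \<and> c4 = 58 \<and> c5 = 58 then 1420219554310819676160000000000000 else 0)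
     + (if c2 = 58 \<and> c3 = 58 \<and> c5 = 58 then 1420219554310819676160000000000000 else 0)
     + (if c2 = 58 \<and> c4 = 58 \<and> c6 = 58 then 1420219554310819676160000000000000 else 0), 0, 0)))"

definition exact :: "bool list list \<Rightarrow> bool" where
  "exact R = (ksum (local_values splits_exact (entry R)) = (-256491651508534033514496000000000000, 117508965923677220005478400000000000, -12675459522224065609728000000000000))"

lemma form_exact_zero: "form_exact 0 j = (0, 0, 0)"
  by (simp add: form_exact_def coords_def)

lemma tight_exact: "list_all exact tight_graphs"
  by (simp only: tight_graphs_eval list.pred_inject exact_def local_values_eval ksum.simps splits_exact_def flag_class_simps
      flag_empty_simps flag_edge_simps flag_cherry_simps form_exact_simps form_exact_zero kadd.simps num_simps prod.inject add_0_left add_0_right cong: if_weak_cong)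

section \<open>The form is positive semidefinite\<close>

lemma beta_exists: "\<exists>x::real. 36052232822106638 / 10 ^ 16 \<le> x \<and> x \<le> 36052232822106639 / 10 ^ 16 \<and> x ^ 3 + 10 * x ^ 2 - 160 * x + 400 = 0"
  by (rule IVT2') (auto intro!: continuous_intros simp: power2_eq_square power3_eq_cube)

text \<open>
  The interval isolates one root of the cubic; its width is small enough for all numerical comparisons below.
\<close>

definition beta :: real where
  "beta = (SOME x. 36052232822106638 / 10 ^ 16 \<le> x \<and> x \<le> 36052232822106639 / 10 ^ 16 \<and> x ^ 3 + 10 * x ^ 2 - 160 * x + 400 = 0)"

lemma beta_lower: "36052232822106638 / 10 ^ 16 \<le> beta"
  and beta_upper: "beta \<le> 36052232822106639 / 10 ^ 16"
  and beta_root: "beta ^ 3 + 10 * beta ^ 2 - 160 * beta + 400 = 0"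
  using someI_ex[OF beta_exists] unfolding beta_def[symmetric] by auto

definition ev :: "cubic \<Rightarrow> real" where
  "ev x = (case x of (a, b, c) \<Rightarrow> of_int a + of_int b * beta + of_int c * beta ^ 2)"

lemma ev_simp: "ev (a, b, c) = of_int a + of_int b * beta + of_int c * beta ^ 2"
  by (simp add: ev_def)

lemma ev_kadd [simp]: "ev (kadd x y) = ev x + ev y"
  by (cases x; cases y) (simp add: ev_def algebra_simps)

lemma beta_cube: "beta ^ 3 = 160 * beta - 10 * beta ^ 2 - 400"
  using beta_root by simp

lemma beta_fourth: "beta ^ 4 = 260 * beta ^ 2 - 2000 * beta + 4000"
proof -
  have "beta ^ 4 = beta * beta ^ 3" by (simp add: power_numeral_reduce)
  also have "\<dots> = 160 * beta ^ 2 - 10 * beta ^ 3 - 400 * beta"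
    by (subst beta_cube) (simp add: algebra_simps power_numeral_reduce)
  finally show ?thesis by (simp add: beta_cube algebra_simps)
qed

lemma ev_kred: "ev (kred p0 p1 p2 p3 p4) = p0 + p1 * beta + p2 * beta ^ 2 + p3 * beta ^ 3 + p4 * beta ^ 4"
  by (simp add: ev_def kred_def beta_cube beta_fourth algebra_simps)

lemma ev_kmul [simp]: "ev (kmul x y) = ev x * ev y"
proof (cases x; cases y)
  fix a0 a1 a2 b0 b1 b2 :: int
  assume xy: "x = (a0, a1, a2)" "y = (b0, b1, b2)"
  show ?thesis
    unfolding xy kmul.simps ev_kred ev_simp
    by (simp add: algebra_simps power_numeral_reduce)
qed

lemma ev_zero [simp]: "ev (0, 0, 0) = 0"
  by (simp add: ev_def)

lemma ev_ksum: "ev (ksum xs) = sum_list (map ev xs)"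
  by (induction xs) auto

lemma beta_pos: "beta > 0"
  using beta_lower by simp

lemma beta_sq_lower: "12997634914593 / 10 ^ 12 \<le> beta ^ 2"
proof -
  have "(36052232822106638 / 10 ^ 16 :: real) ^ 2 \<le> beta ^ 2"
    by (rule power_mono[OF beta_lower]) simp
  moreover have "12997634914593 / 10 ^ 12 \<le> (36052232822106638 / 10 ^ 16 :: real) ^ 2"
    by (simp add: power2_eq_square)
  ultimately show ?thesis by linarith
qed

lemma beta_sq_upper: "beta ^ 2 \<le> 12997634914594 / 10 ^ 12"
proof -
  have "beta ^ 2 \<le> (36052232822106639 / 10 ^ 16 :: real) ^ 2"
    by (rule power_mono[OF beta_upper]) (use beta_pos in simp)
  moreover have "(36052232822106639 / 10 ^ 16 :: real) ^ 2 \<le> 12997634914594 / 10 ^ 12"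
    by (simp add: power2_eq_square)
  ultimately show ?thesis by linarith
qed

lemma int_mult_bound:
  fixes y :: real
  assumes "of_int l \<le> y" "y \<le> of_int u"
  shows "of_int b * y \<le> of_int (b * (if 0 \<le> b then u else l))"
  using assms by (auto intro: mult_left_mono mult_left_mono_neg)

lemma ev_kub: "ev x * 10 ^ 12 \<le> of_int (kub x)"
proof (cases x)
  case (fields a b c)
  have 1: "of_int b * (beta * 10 ^ 12) \<le> of_int (b * (if 0 \<le> b then 3605223282211 else 3605223282210))"
    by (rule int_mult_bound) (use beta_lower beta_upper in simp_all)
  have 2: "of_int c * (beta ^ 2 * 10 ^ 12) \<le> of_int (c * (if 0 \<le> c then 12997634914594 else 12997634914593))"
    by (rule int_mult_bound) (use beta_sq_lower beta_sq_upper in simp_all)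
  have "ev x * 10 ^ 12 = of_int (a * 1000000000000) + of_int b * (beta * 10 ^ 12) + of_int c * (beta ^ 2 * 10 ^ 12)"
    by (simp add: fields ev_def algebra_simps)
  also have "\<dots> \<le> of_int (kub x)"
    using 1 2 unfolding fields kub.simps of_int_add by linarith
  finally show ?thesis .
qed

definition quad :: "nat \<Rightarrow> nat \<Rightarrow> real" where
  "quad i j = ev (form_exact i j) / 31560434540240437248000000000000"

text \<open>
  The coefficient, times 12800, of class \<open>k\<close> in the representation of class \<open>i\<close> by the non-pivot classes.
\<close>

definition coord :: "nat \<Rightarrow> nat \<Rightarrow> real" where
  "coord i k = (\<Sum>(l, c)\<leftarrow>coords i. if l = k then ev c else 0)"

definition block :: "nat \<Rightarrow> nat set" where
  "block s = {i. 2 \<le> i \<and> i < 89 \<and> block_start i = s}"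

lemma sum_list_coords:
  assumes "\<And>l c. (l, c) \<in> set xs \<Longrightarrow> l \<in> A" "finite A"
  shows "(\<Sum>(l, c)\<leftarrow>xs. ev c * f l) = (\<Sum>k\<in>A. (\<Sum>(l, c)\<leftarrow>xs. if l = k then ev c else 0) * f k)"
  using assms(1)
proof (induction xs)
  case (Cons x xs)
  obtain l c where x: "x = (l, c)" by (cases x)
  have "(\<Sum>k\<in>A. (if l = k then ev c else 0) * f k) = (\<Sum>k\<in>A. if k = l then ev c * f k else 0)"
    by (rule sum.cong) auto
  also have "\<dots> = ev c * f l"
    using assms(2) Cons.prems[of l c] x by (simp add: sum.delta)
  finally have "(\<Sum>k\<in>A. (if l = k then ev c else 0) * f k) = ev c * f l" .
  then show ?case
    using Cons by (auto simp: x algebra_simps sum.distrib)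
qed simp

lemma pivot_rows_in_block:
  "list_all (\<lambda>i. list_all (\<lambda>x. 2 \<le> fst x \<and> fst x < 89 \<and> block_start (fst x) = block_start i) (pivot_row i)) [2..<89]"
  by (simp add: pivot_row_simps block_start_def)

lemma coords_in_block:
  assumes "i \<in> block s" "(l, c) \<in> set (coords i)"
  shows "l \<in> block s"
proof (cases "pivot_row i = []")
  case True
  then show ?thesis using assms by (auto simp: coords_def split: if_splits)
next
  case False
  then have "(l, c) \<in> set (pivot_row i)" using assms(2) by (auto simp: coords_def split: if_splits)
  moreover have "\<forall>x\<in>set (pivot_row i). 2 \<le> fst x \<and> fst x < 89 \<and> block_start (fst x) = block_start i"
  proof -
    have "i \<in> set [2..<89]" using assms(1) unfolding block_def set_upt by simp
    then show ?thesis using pivot_rows_in_block unfolding list_all_iff by blast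
  qed
  ultimately show ?thesis using assms(1) unfolding block_def by force
qed

lemma finite_block [simp]: "finite (block s)"
  by (simp add: block_def)

lemma coord_zero [simp]: "coord 0 k = 0"
  by (simp add: coord_def coords_def)

lemma ev_gram_coords: "ev (gram_coords k j) = (\<Sum>(l, d)\<leftarrow>coords j. ev d * ev (gram k l))"
  by (simp add: gram_coords_def ev_ksum o_def case_prod_unfold)

lemma ev_form_exact_list: "ev (form_exact i j) = (\<Sum>(k, c)\<leftarrow>coords i. ev c * ev (gram_coords k j))"
  by (simp add: form_exact_def ev_ksum o_def case_prod_unfold)

text \<open>
  The form arises from the Gram matrix by a change of coordinates, so positivity carries over.
\<close>

lemma ev_form_exact:
  assumes "i \<in> block s" "j \<in> block s"
  shows "ev (form_exact i j) = (\<Sum>k\<in>block s. \<Sum>l\<in>block s. coord i k * coord j l * ev (gram k l))"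
proof -
  have "ev (gram_coords k j) = (\<Sum>l\<in>block s. coord j l * ev (gram k l))" for k
    unfolding ev_gram_coords coord_def
    by (rule sum_list_coords) (use coords_in_block[OF assms(2)] in auto)
  moreover have "ev (form_exact i j) = (\<Sum>k\<in>block s. coord i k * ev (gram_coords k j))"
    unfolding ev_form_exact_list coord_def
    by (rule sum_list_coords) (use coords_in_block[OF assms(1)] in auto)
  ultimately show ?thesis by (simp add: sum_distrib_left mult.assoc)
qed

lemma form_exact_zero_right: "ev (form_exact i 0) = 0"
  by (simp add: ev_form_exact_list ev_gram_coords coords_def case_prod_unfold)

text \<open>
  The classes that carry the additional squares and the corrections.
\<close>

definition minor :: "nat set" where
  "minor = {8..<15} \<union> {23..<30} \<union> {59..<65}"

lemma minor_column_eval: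
  "list_all (\<lambda>i. length (minor_column i) = 7) ([8..<15] @ [23..<30] @ [59..<65])"
  "list_all (\<lambda>i. minor_column i = []) ([2..<8] @ [15..<23] @ [30..<59] @ [65..<89])"
  by (simp_all add: minor_column_simps)

lemma length_minor_column: "i \<in> minor \<Longrightarrow> length (minor_column i) = 7"
  using minor_column_eval(1) unfolding list_all_iff minor_def set_append set_upt by blast

lemma minor_column_iff:
  assumes "i \<in> block s"
  shows "minor_column i = [] \<longleftrightarrow> i \<notin> minor"
proof (cases "i \<in> minor")
  case True
  then show ?thesis using length_minor_column[OF True] by auto
next
  case False
  have "i \<in> set ([2..<8] @ [15..<23] @ [30..<59] @ [65..<89])"
    using assms False unfolding block_def minor_def set_append set_upt by auto
  then have "minor_column i = []"
    using minor_column_eval(2) unfolding list_all_iff by blast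
  then show ?thesis using False by simp
qed

lemma gram_sym_eval:
  "list_all (\<lambda>i. list_all (\<lambda>j. gram i j = gram j i) [8..<15]) [8..<15]"
  "list_all (\<lambda>i. list_all (\<lambda>j. gram i j = gram j i) [23..<30]) [23..<30]"
  "list_all (\<lambda>i. list_all (\<lambda>j. gram i j = gram j i) [59..<65]) [59..<65]"
  by (simp_all add: gram_simps)

lemma block_minor:
  assumes "i \<in> block s" "j \<in> block s" "i \<in> minor" "j \<in> minor"
  shows "(i \<in> {8..<15} \<and> j \<in> {8..<15}) \<or> (i \<in> {23..<30} \<and> j \<in> {23..<30}) \<or> (i \<in> {59..<65} \<and> j \<in> {59..<65})"
  using assms unfolding block_def minor_def block_start_def by (auto split: if_splits)

lemma block_weight_eq: "i \<in> block s \<Longrightarrow> j \<in> block s \<Longrightarrow> block_weight i = block_weight j"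
  unfolding block_def block_weight_def block_start_def by (auto split: if_splits)

lemma main_entry_sym: "i \<in> block s \<Longrightarrow> j \<in> block s \<Longrightarrow> main_entry i j = main_entry j i"
  using block_weight_eq[of i s j] by (cases "main_column i"; cases "main_column j") (simp add: main_entry_def mult.commute)

lemma gram_sym:
  assumes "i \<in> block s" "j \<in> block s"
  shows "gram i j = gram j i"
proof (cases "i \<in> minor \<and> j \<in> minor")
  case True
  then show ?thesis
    using block_minor[OF assms] gram_sym_eval unfolding list_all_iff set_upt by blast
next
  case False
  then show ?thesis
    using minor_column_iff[OF assms(1)] minor_column_iff[OF assms(2)] main_entry_sym[OF assms]
    by (auto simp: gram_def)
qed

lemma quad_sym:
  assumes "i \<in> insert 0 (block s)" "j \<in> insert 0 (block s)"
  shows "quad i j = quad j i"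
proof -
  consider "i = 0" | "j = 0" | "i \<in> block s" "j \<in> block s" using assms by blast
  then show ?thesis
  proof cases
    case 3
    have "ev (form_exact i j) = (\<Sum>l\<in>block s. \<Sum>k\<in>block s. coord i k * coord j l * ev (gram k l))"
      unfolding ev_form_exact[OF 3] by (rule sum.swap)
    also have "\<dots> = ev (form_exact j i)"
      unfolding ev_form_exact[OF 3(2,1)] using gram_sym by (intro sum.cong refl) (simp add: mult.commute)
    finally show ?thesis by (simp add: quad_def)
  qed (auto simp: quad_def form_exact_zero form_exact_zero_right)
qed

definition main_coeff :: "nat \<Rightarrow> nat \<Rightarrow> real" where
  "main_coeff i k = (case main_column i of (a0, a1, a2, a3) \<Rightarrow> of_int ([a0, a1, a2, a3] ! k))"

definition minor_coeff :: "nat \<Rightarrow> nat \<Rightarrow> real" where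
  "minor_coeff i k = (if i \<in> minor then of_int (minor_column i ! k) else 0)"

lemma main_entry_sum: "of_int (main_entry i j) = of_int (block_weight i) * (\<Sum>k<4. main_coeff i k * main_coeff j k)"
  by (cases "main_column i"; cases "main_column j")
     (simp add: main_entry_def main_coeff_def numeral_eq_Suc algebra_simps)

lemma dot_sum: "length xs = length ys \<Longrightarrow> of_int (dot xs ys) = (\<Sum>k<length xs. (of_int (xs ! k) * of_int (ys ! k) :: real))"
proof (induction xs ys rule: list_induct2)
  case (Cons x xs y ys)
  then show ?case by (simp add: sum.lessThan_Suc_shift del: sum.lessThan_Suc)
qed simp

lemma corrections_small_eval:
  "list_all (list_all (\<lambda>(i, x). kub x \<le> 30000000000000000000000000000000 \<and> kub (kmul (-1, 0, 0) x) \<le> 30000000000000000000000000000000)) corrections"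
  by (simp add: corrections_def)

lemma kassoc_mem: "kassoc j xs = (0, 0, 0) \<or> (\<exists>i. (i, kassoc j xs) \<in> set xs)"
  by (induction xs) auto

lemma correction_small: "i < 89 \<Longrightarrow> \<bar>ev (kassoc j (correction_row i))\<bar> \<le> 3 * 10 ^ 19"
proof -
  assume i: "i < 89"
  have "length corrections = 89" by (simp add: corrections_def)
  then have mem: "correction_row i \<in> set corrections" using i by (simp add: correction_row_def)
  consider "kassoc j (correction_row i) = (0, 0, 0)" | k where "(k, kassoc j (correction_row i)) \<in> set (correction_row i)"
    using kassoc_mem by blast
  then show ?thesis
  proof cases
    case 2
    let ?x = "kassoc j (correction_row i)"
    have "kub ?x \<le> 30000000000000000000000000000000" "kub (kmul (-1, 0, 0) ?x) \<le> 30000000000000000000000000000000"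
      using corrections_small_eval mem 2 unfolding list_all_iff by fastforce+
    then have "ev ?x * 10 ^ 12 \<le> 3 * 10 ^ 31" "ev (kmul (-1, 0, 0) ?x) * 10 ^ 12 \<le> 3 * 10 ^ 31"
      using order_trans[OF ev_kub[of ?x], of "3 * 10 ^ 31"] order_trans[OF ev_kub[of "kmul (-1, 0, 0) ?x"], of "3 * 10 ^ 31"]
      by (auto simp del: ev_kmul)
    then show ?thesis by (simp add: ev_simp)
  qed simp
qed

lemma block_weight_ge: "1 \<le> block_weight i"
  by (simp add: block_weight_def)

lemma ev_gram:
  assumes "i \<in> block s" "j \<in> block s"
  shows "ev (gram i j) = 1881148489728000000 * block_weight i * (\<Sum>k<4. main_coeff i k * main_coeff j k)
     + 4702871224320000 * block_weight i * (\<Sum>k<7. minor_coeff i k * minor_coeff j k)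
     + (if i \<in> minor \<and> i = j then 242713302738665472000 * block_weight i else 0)
     + (if i \<in> minor \<and> j \<in> minor then ev (kassoc j (correction_row i)) else 0)"
proof (cases "i \<in> minor \<and> j \<in> minor")
  case True
  then have len: "length (minor_column i) = 7" "length (minor_column j) = 7"
    using length_minor_column by blast+
  then have "minor_column i \<noteq> []" "minor_column j \<noteq> []" by auto
  moreover have "of_int (dot (minor_column i) (minor_column j)) = (\<Sum>k<7. minor_coeff i k * minor_coeff j k)"
    using dot_sum[of "minor_column i" "minor_column j"] len True by (simp add: minor_coeff_def)
  ultimately show ?thesis
    using True by (auto simp: gram_def ev_simp main_entry_sum algebra_simps)
next
  case False
  then have "minor_column i = [] \<or> minor_column j = []"
    using minor_column_iff[OF assms(1)] minor_column_iff[OF assms(2)] by auto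
  moreover have "(\<Sum>k<7. minor_coeff i k * minor_coeff j k) = 0"
    using False by (auto simp: minor_coeff_def)
  ultimately show ?thesis
    using False by (auto simp: gram_def ev_simp main_entry_sum)
qed

lemma subset_of_common_part:
  assumes "\<And>i j. i \<in> X \<Longrightarrow> j \<in> X \<Longrightarrow> (i \<in> A \<and> j \<in> A) \<or> (i \<in> B \<and> j \<in> B) \<or> (i \<in> C \<and> j \<in> C)"
    and "A \<inter> B = {}" "A \<inter> C = {}" "B \<inter> C = {}"
  shows "X \<subseteq> A \<or> X \<subseteq> B \<or> X \<subseteq> C"
  using assms by blast

lemma card_block_minor: "card (block s \<inter> minor) \<le> 7"
proof -
  have "block s \<inter> minor \<subseteq> {8..<15} \<or> block s \<inter> minor \<subseteq> {23..<30} \<or> block s \<inter> minor \<subseteq> {59..<65}"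
    by (rule subset_of_common_part) (use block_minor in blast, auto)
  then have "card (block s \<inter> minor) \<le> card {8..<15::nat} \<or> card (block s \<inter> minor) \<le> card {23..<30::nat}
      \<or> card (block s \<inter> minor) \<le> card {59..<65::nat}"
    using card_mono[OF finite_atLeastLessThan, of "block s \<inter> minor"] by blast
  then show ?thesis by auto
qed

lemma sum_gram_form:
  fixes Y :: "nat \<Rightarrow> real"
  shows "(\<Sum>i\<in>A. \<Sum>j\<in>A. (\<Sum>k\<in>K. a i k * a j k) * (Y i * Y j)) = (\<Sum>k\<in>K. (\<Sum>i\<in>A. a i k * Y i) ^ 2)"
proof -
  have "(\<Sum>k\<in>K. (\<Sum>i\<in>A. a i k * Y i) ^ 2) = (\<Sum>k\<in>K. \<Sum>i\<in>A. \<Sum>j\<in>A. (a i k * Y i) * (a j k * Y j))"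
    by (simp add: power2_eq_square sum_product)
  also have "\<dots> = (\<Sum>i\<in>A. \<Sum>j\<in>A. \<Sum>k\<in>K. (a i k * Y i) * (a j k * Y j))"
    by (subst sum.swap) (intro sum.cong refl sum.swap)
  also have "\<dots> = (\<Sum>i\<in>A. \<Sum>j\<in>A. (\<Sum>k\<in>K. a i k * a j k) * (Y i * Y j))"
    by (intro sum.cong refl) (simp add: sum_distrib_left sum_distrib_right mult_ac)
  finally show ?thesis by simp
qed

text \<open>
  At most seven classes of a type carry corrections, each below \<open>3 * 10 ^ 19\<close>; by Cauchy-Schwarz the multiple of
  the identity outweighs them, since \<open>7 * 3 * 10 ^ 19 < 242713302738665472000\<close>.
\<close>

lemma small_form:
  fixes Y :: "nat \<Rightarrow> real"
  assumes "finite M" "card M \<le> 7" "\<And>i j. i \<in> M \<Longrightarrow> j \<in> M \<Longrightarrow> \<bar>e i j\<bar> \<le> 3 * 10 ^ 19"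
  shows "(\<Sum>i\<in>M. \<Sum>j\<in>M. e i j * (Y i * Y j)) + 242713302738665472000 * (\<Sum>i\<in>M. Y i ^ 2) \<ge> 0"
proof -
  have "- (\<Sum>i\<in>M. \<Sum>j\<in>M. e i j * (Y i * Y j)) \<le> (\<Sum>i\<in>M. \<Sum>j\<in>M. 3 * 10 ^ 19 * (\<bar>Y i\<bar> * \<bar>Y j\<bar>))"
    unfolding sum_negf[symmetric]
  proof (intro sum_mono)
    fix i j assume "i \<in> M" "j \<in> M"
    then have "\<bar>e i j\<bar> * (\<bar>Y i\<bar> * \<bar>Y j\<bar>) \<le> 3 * 10 ^ 19 * (\<bar>Y i\<bar> * \<bar>Y j\<bar>)"
      using assms(3) by (intro mult_right_mono) auto
    then show "- (e i j * (Y i * Y j)) \<le> 3 * 10 ^ 19 * (\<bar>Y i\<bar> * \<bar>Y j\<bar>)"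
      using abs_ge_minus_self[of "e i j * (Y i * Y j)"] by (simp add: abs_mult)
  qed
  also have "\<dots> = 3 * 10 ^ 19 * (\<Sum>i\<in>M. \<bar>Y i\<bar>) ^ 2"
    unfolding power2_eq_square sum_product by (simp only: sum_distrib_left)
  also have "\<dots> \<le> 3 * 10 ^ 19 * ((\<Sum>i\<in>M. \<bar>Y i\<bar> ^ 2) * card M)"
    by (intro mult_left_mono sum_squared_le_sum_of_squares) (use assms(1) in auto)
  also have "\<dots> \<le> 3 * 10 ^ 19 * ((\<Sum>i\<in>M. Y i ^ 2) * 7)"
    using assms(2) by (intro mult_left_mono) (auto intro!: mult_left_mono sum_nonneg)
  also have "\<dots> \<le> 242713302738665472000 * (\<Sum>i\<in>M. Y i ^ 2)"
    using sum_nonneg[of M "\<lambda>i. Y i ^ 2"] by simp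
  finally show ?thesis by linarith
qed

text \<open>
  Squares with positive weights, plus the part controlled by the multiple of the identity.
\<close>

lemma gram_psd: "(\<Sum>i\<in>block s. \<Sum>j\<in>block s. ev (gram i j) * (Y i * Y j)) \<ge> (0::real)"
proof -
  let ?B = "block s" and ?M = "block s \<inter> minor"
  obtain w where w: "\<And>i. i \<in> ?B \<Longrightarrow> block_weight i = w" "1 \<le> w"
  proof (cases "?B = {}")
    case False
    then obtain i where "i \<in> ?B" by blast
    then show ?thesis using that[of "block_weight i"] block_weight_eq block_weight_ge by blast
  qed (use that[of 1] in auto)
  let ?e = "\<lambda>i j. ev (kassoc j (correction_row i))"
  have "(\<Sum>i\<in>?B. \<Sum>j\<in>?B. ev (gram i j) * (Y i * Y j)) =
     (\<Sum>i\<in>?B. \<Sum>j\<in>?B. 1881148489728000000 * w * ((\<Sum>k<4. main_coeff i k * main_coeff j k) * (Y i * Y j))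
       + 4702871224320000 * w * ((\<Sum>k<7. minor_coeff i k * minor_coeff j k) * (Y i * Y j))
       + (if i = j then (if i \<in> minor then 242713302738665472000 * w * Y i ^ 2 else 0) else 0)
       + (if i \<in> minor \<and> j \<in> minor then ?e i j * (Y i * Y j) else 0))"
    by (intro sum.cong refl) (simp add: ev_gram w algebra_simps power2_eq_square)
  also have "\<dots> = 1881148489728000000 * w * (\<Sum>i\<in>?B. \<Sum>j\<in>?B. (\<Sum>k<4. main_coeff i k * main_coeff j k) * (Y i * Y j))
     + 4702871224320000 * w * (\<Sum>i\<in>?B. \<Sum>j\<in>?B. (\<Sum>k<7. minor_coeff i k * minor_coeff j k) * (Y i * Y j))
     + (\<Sum>i\<in>?B. if i \<in> minor then 242713302738665472000 * w * Y i ^ 2 else 0)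
     + (\<Sum>i\<in>?B. \<Sum>j\<in>?B. if i \<in> minor \<and> j \<in> minor then ?e i j * (Y i * Y j) else 0)"
    by (simp add: sum.distrib sum_distrib_left)
  also have "(\<Sum>i\<in>?B. if i \<in> minor then 242713302738665472000 * w * Y i ^ 2 else 0) = w * (242713302738665472000 * (\<Sum>i\<in>?M. Y i ^ 2))"
    unfolding sum_distrib_left by (simp add: sum.inter_restrict[symmetric] mult_ac)
  also have "(\<Sum>i\<in>?B. \<Sum>j\<in>?B. if i \<in> minor \<and> j \<in> minor then ?e i j * (Y i * Y j) else 0) = (\<Sum>i\<in>?M. \<Sum>j\<in>?M. ?e i j * (Y i * Y j))"
  proof -
    have "(\<Sum>i\<in>?B. \<Sum>j\<in>?B. if i \<in> minor \<and> j \<in> minor then ?e i j * (Y i * Y j) else 0)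
      = (\<Sum>i\<in>?B. if i \<in> minor then \<Sum>j\<in>?B. if j \<in> minor then ?e i j * (Y i * Y j) else 0 else 0)"
      by (intro sum.cong refl) auto
    then show ?thesis by (simp add: sum.inter_restrict[symmetric])
  qed
  finally have eq: "(\<Sum>i\<in>?B. \<Sum>j\<in>?B. ev (gram i j) * (Y i * Y j)) =
     1881148489728000000 * w * (\<Sum>k<4. (\<Sum>i\<in>?B. main_coeff i k * Y i) ^ 2)
     + 4702871224320000 * w * (\<Sum>k<7. (\<Sum>i\<in>?B. minor_coeff i k * Y i) ^ 2)
     + w * (242713302738665472000 * (\<Sum>i\<in>?M. Y i ^ 2)) + (\<Sum>i\<in>?M. \<Sum>j\<in>?M. ?e i j * (Y i * Y j))"
    by (simp add: sum_gram_form)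
  have "(\<Sum>i\<in>?M. \<Sum>j\<in>?M. ?e i j * (Y i * Y j)) + 242713302738665472000 * (\<Sum>i\<in>?M. Y i ^ 2) \<ge> 0"
  proof (rule small_form[OF _ card_block_minor])
    show "\<bar>?e i j\<bar> \<le> 3 * 10 ^ 19" if "i \<in> ?M" for i j
      using correction_small[of i j] that unfolding block_def by simp
  qed simp
  moreover have "242713302738665472000 * (\<Sum>i\<in>?M. Y i ^ 2) \<le> w * (242713302738665472000 * (\<Sum>i\<in>?M. Y i ^ 2))"
    using w(2) sum_nonneg[of ?M "\<lambda>i. Y i ^ 2"]
    by (metis (no_types, lifting) mult_1 mult_right_mono of_int_1_le_iff zero_le_numeral mult_nonneg_nonneg zero_le_power2)
  moreover have "0 \<le> 1881148489728000000 * w * (\<Sum>k<4. (\<Sum>i\<in>?B. main_coeff i k * Y i) ^ 2)"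
    "0 \<le> 4702871224320000 * w * (\<Sum>k<7. (\<Sum>i\<in>?B. minor_coeff i k * Y i) ^ 2)"
    using w(2) by (auto intro!: mult_nonneg_nonneg sum_nonneg)
  ultimately show ?thesis unfolding eq by linarith
qed

section \<open>The local inequality for all graphs\<close>

lemma bool_lookup_mem: "length xs = 2 ^ length bs \<Longrightarrow> bool_lookup bs xs \<in> set xs"
proof (induction bs arbitrary: xs)
  case Nil
  then show ?case by (cases xs) auto
next
  case (Cons b bs)
  then have "bool_lookup bs (take (2 ^ length bs) xs) \<in> set (take (2 ^ length bs) xs)"
    "bool_lookup bs (drop (2 ^ length bs) xs) \<in> set (drop (2 ^ length bs) xs)"
    by simp_all
  then show ?case using set_take_subset set_drop_subset by (fastforce split: if_splits)
qed

lemma flag_tables_length: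
  "length flag_table_empty = 2 ^ 7" "length flag_table_edge = 2 ^ 7" "length flag_table_cherry = 2 ^ 7"
  by (simp_all add: flag_table_empty_def flag_table_edge_def flag_table_cherry_def)

lemma flag_tables_in_block:
  "list_all (\<lambda>i. i = 0 \<or> 2 \<le> i \<and> i < 21) flag_table_empty"
  "list_all (\<lambda>i. i = 0 \<or> 21 \<le> i \<and> i < 58) flag_table_edge"
  "list_all (\<lambda>i. i = 0 \<or> 58 \<le> i \<and> i < 89) flag_table_cherry"
  by (simp_all add: flag_table_empty_def flag_table_edge_def flag_table_cherry_def)

lemma flag_empty_block: "flag_empty u1 u2 u3 v1 v2 v3 e \<in> insert 0 (block 2)"
proof -
  have "flag_empty u1 u2 u3 v1 v2 v3 e \<in> set flag_table_empty"
    unfolding flag_empty_def by (rule bool_lookup_mem) (simp add: flag_tables_length)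
  then have "flag_empty u1 u2 u3 v1 v2 v3 e = 0 \<or> 2 \<le> flag_empty u1 u2 u3 v1 v2 v3 e \<and> flag_empty u1 u2 u3 v1 v2 v3 e < 21"
    using flag_tables_in_block(1) unfolding list_all_iff by blast
  then show ?thesis by (elim disjE) (simp_all add: block_def block_start_def)
qed

lemma flag_edge_block: "flag_edge u1 u2 u3 v1 v2 v3 e \<in> insert 0 (block 21)"
proof -
  have "flag_edge u1 u2 u3 v1 v2 v3 e \<in> set flag_table_edge"
    unfolding flag_edge_def by (rule bool_lookup_mem) (simp add: flag_tables_length)
  then have "flag_edge u1 u2 u3 v1 v2 v3 e = 0 \<or> 21 \<le> flag_edge u1 u2 u3 v1 v2 v3 e \<and> flag_edge u1 u2 u3 v1 v2 v3 e < 58"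
    using flag_tables_in_block(2) unfolding list_all_iff by blast
  then show ?thesis by (elim disjE) (simp_all add: block_def block_start_def)
qed

lemma flag_cherry_block: "flag_cherry u1 u2 u3 v1 v2 v3 e \<in> insert 0 (block 58)"
proof -
  have "flag_cherry u1 u2 u3 v1 v2 v3 e \<in> set flag_table_cherry"
    unfolding flag_cherry_def by (rule bool_lookup_mem) (simp add: flag_tables_length)
  then have "flag_cherry u1 u2 u3 v1 v2 v3 e = 0 \<or> 58 \<le> flag_cherry u1 u2 u3 v1 v2 v3 e \<and> flag_cherry u1 u2 u3 v1 v2 v3 e < 89"
    using flag_tables_in_block(3) unfolding list_all_iff by blast
  then show ?thesis by (elim disjE) (simp_all add: block_def block_start_def)
qed

definition type_start :: "bool \<Rightarrow> bool \<Rightarrow> bool \<Rightarrow> nat" where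
  "type_start t12 t13 t23 = (if t12 then (if t13 \<or> t23 then 58 else 21) else if t13 then (if t23 then 58 else 21) else if t23 then 21 else 2)"

lemma flag_class_block: "flag_class t12 t13 t23 u1 u2 u3 v1 v2 v3 e \<in> insert 0 (block (type_start t12 t13 t23))"
  using flag_empty_block flag_edge_block flag_cherry_block
  unfolding flag_class_def type_start_def by auto

lemma flag_empty_sym_all:
  "\<forall>u1 u2 u3 v1 v2 v3 e. flag_empty u2 u1 u3 v2 v1 v3 e = flag_empty u1 u2 u3 v1 v2 v3 e \<and>
     flag_empty u1 u3 u2 v1 v3 v2 e = flag_empty u1 u2 u3 v1 v2 v3 e \<and>
     flag_empty v1 v2 v3 u1 u2 u3 e = flag_empty u1 u2 u3 v1 v2 v3 e"
  by (simp only: all_bool_eq flag_empty_simps simp_thms)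

lemma flag_edge_sym_all:
  "\<forall>u1 u2 u3 v1 v2 v3 e. flag_edge u2 u1 u3 v2 v1 v3 e = flag_edge u1 u2 u3 v1 v2 v3 e \<and>
     flag_edge v1 v2 v3 u1 u2 u3 e = flag_edge u1 u2 u3 v1 v2 v3 e"
  by (simp only: all_bool_eq flag_edge_simps simp_thms)

lemma flag_cherry_sym_all:
  "\<forall>u1 u2 u3 v1 v2 v3 e. flag_cherry u1 u3 u2 v1 v3 v2 e = flag_cherry u1 u2 u3 v1 v2 v3 e \<and>
     flag_cherry v1 v2 v3 u1 u2 u3 e = flag_cherry u1 u2 u3 v1 v2 v3 e"
  by (simp only: all_bool_eq flag_cherry_simps simp_thms)

lemma flag_cherry_58_all:
  "\<forall>u1 u2 u3 v1 v2 v3 e. flag_cherry u1 u2 u3 v1 v2 v3 e = 58 \<longleftrightarrow> \<not> (u1 \<or> u2 \<or> u3 \<or> v1 \<or> v2 \<or> v3 \<or> e)"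
  by (simp add: all_bool_eq flag_cherry_simps)

lemma flag_class_swap_12: "flag_class t12 t23 t13 u2 u1 u3 v2 v1 v3 e = flag_class t12 t13 t23 u1 u2 u3 v1 v2 v3 e"
  using flag_empty_sym_all flag_edge_sym_all flag_cherry_sym_all by (simp add: flag_class_def)

lemma flag_class_swap_23: "flag_class t13 t12 t23 u1 u3 u2 v1 v3 v2 e = flag_class t12 t13 t23 u1 u2 u3 v1 v2 v3 e"
  using flag_empty_sym_all flag_edge_sym_all flag_cherry_sym_all by (simp add: flag_class_def)

lemma flag_class_swap_ends: "flag_class t12 t13 t23 v1 v2 v3 u1 u2 u3 e = flag_class t12 t13 t23 u1 u2 u3 v1 v2 v3 e"
  using flag_empty_sym_all flag_edge_sym_all flag_cherry_sym_all by (simp add: flag_class_def)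

lemma flag_class_58:
  "flag_class t12 t13 t23 u1 u2 u3 v1 v2 v3 e = 58 \<longleftrightarrow>
    (t12 \<and> t13 \<and> \<not> t23 \<or> t12 \<and> \<not> t13 \<and> t23 \<or> \<not> t12 \<and> t13 \<and> t23) \<and> \<not> (u1 \<or> u2 \<or> u3 \<or> v1 \<or> v2 \<or> v3 \<or> e)"
proof -
  have "flag_empty u1 u2 u3 v1 v2 v3 e \<noteq> 58" "flag_edge u1 u2 u3 v1 v2 v3 e \<noteq> 58" for u1 u2 u3 v1 v2 v3 e
    using flag_empty_block[of u1 u2 u3 v1 v2 v3 e] flag_edge_block[of u1 u2 u3 v1 v2 v3 e]
    by (auto simp: block_def block_start_def)
  then show ?thesis
    using flag_cherry_58_all unfolding flag_class_def by auto
qed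

text \<open>
  The classes with a row of bounds.
\<close>

definition bounded :: "nat set" where
  "bounded = {2..<15} \<union> {21..<30} \<union> {58..<65}"

lemma bound_row_eval:
  "list_all (\<lambda>i. bound_row i \<noteq> []) ([2..<15] @ [21..<30] @ [58..<65])"
  "list_all (\<lambda>i. bound_row i = [] \<and> pivot_row i = [] \<and> minor_column i = []) ([15..<21] @ [30..<58] @ [65..<89])"
  by (simp_all add: bound_row_simps pivot_row_simps minor_column_simps)

lemma bound_row_bounded: "i \<in> bounded \<Longrightarrow> bound_row i \<noteq> []"
  using bound_row_eval(1) unfolding list_all_iff bounded_def set_append set_upt by blast

lemma unbounded_rows:
  assumes "i \<in> block s" "i \<notin> bounded"
  shows "bound_row i = [] \<and> pivot_row i = [] \<and> minor_column i = []"
proof -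
  have "i \<in> set ([15..<21] @ [30..<58] @ [65..<89])"
    using assms unfolding block_def bounded_def set_append set_upt by auto
  then show ?thesis using bound_row_eval(2) unfolding list_all_iff by blast
qed

lemma bound_holds_block:
  assumes "i \<in> block s" "j \<in> block s" "i \<in> bounded"
  shows "bound_holds i j"
proof -
  have "(i \<in> set [2..<15] \<and> (j \<in> set [2..<15] \<or> j \<in> set [15..<21])) \<or>
        (i \<in> set [21..<30] \<and> (j \<in> set [21..<30] \<or> j \<in> set [30..<58])) \<or>
        (i \<in> set [58..<65] \<and> (j \<in> set [58..<65] \<or> j \<in> set [65..<89]))"
    using assms unfolding block_def bounded_def block_start_def set_upt by (auto split: if_splits)
  then show ?thesis
    using bound_holds_minor_0 bound_holds_minor_1 bound_holds_minor_2 bound_holds_mixed_0 bound_holds_mixed_1 bound_holds_mixed_2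
    unfolding list_all_iff by blast
qed

lemma quad_le_of_bound_holds: "bound_holds i j \<Longrightarrow> 102400 * quad i j \<le> form_bound i j"
proof -
  assume "bound_holds i j"
  then have "(of_int (kub (form_exact i j)) :: real) \<le> of_int (form_bound i j * 308207368557035520000000000000000000000)"
    unfolding bound_holds_def of_int_le_iff .
  then have "ev (form_exact i j) * 10 ^ 12 \<le> of_int (form_bound i j) * 308207368557035520000000000000000000000"
    using ev_kub[of "form_exact i j"] by simp
  then show ?thesis by (simp add: quad_def)
qed

lemma quad_le_block:
  assumes "i \<in> block s" "j \<in> block s"
  shows "102400 * quad i j \<le> form_bound i j"
proof -
  consider "i \<in> bounded" | "i \<notin> bounded" "j \<in> bounded" | "i \<notin> bounded" "j \<notin> bounded" by blast
  then show ?thesis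
  proof cases
    case 1
    then show ?thesis by (intro quad_le_of_bound_holds bound_holds_block[OF assms])
  next
    case 2
    have "102400 * quad j i \<le> form_bound j i"
      using bound_holds_block[OF assms(2,1) 2(2)] by (rule quad_le_of_bound_holds)
    moreover have "quad j i = quad i j" using assms by (intro quad_sym) auto
    moreover have "form_bound j i = form_bound i j"
      using unbounded_rows[OF assms(1) 2(1)] bound_row_bounded[OF 2(2)] assms
      by (simp add: form_bound_def block_def)
    ultimately show ?thesis by simp
  next
    case 3
    note i = unbounded_rows[OF assms(1) 3(1)] and j = unbounded_rows[OF assms(2) 3(2)]
    have "i \<noteq> 0" "j \<noteq> 0" using assms by (auto simp: block_def)
    then have "ev (form_exact i j) = 12800 * 12800 * 1881148489728000000 * of_int (main_entry i j)"
      using i j by (simp add: form_exact_def gram_coords_def coords_def gram_def ev_simp)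
    moreover have "form_bound i j = main_entry i j"
      using i j \<open>i \<noteq> 0\<close> \<open>j \<noteq> 0\<close> by (simp add: form_bound_def)
    ultimately show ?thesis by (simp add: quad_def)
  qed
qed

lemma quad_le:
  assumes "i \<in> insert 0 (block s)" "j \<in> insert 0 (block s)"
  shows "102400 * quad i j \<le> form_bound i j"
proof -
  consider "i = 0" | "j = 0" | "i \<in> block s" "j \<in> block s" using assms by blast
  then show ?thesis
  proof cases
    case 3
    then show ?thesis by (rule quad_le_block)
  qed (simp_all add: quad_def form_exact_zero form_exact_zero_right form_bound_zero)
qed

definition splits_real :: "nat \<Rightarrow> nat \<Rightarrow> nat \<Rightarrow> nat \<Rightarrow> nat \<Rightarrow> nat \<Rightarrow> real" where
  "splits_real c1 c2 c3 c4 c5 c6 = quad c1 c2 + quad c3 c4 + quad c5 c6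
     + 45 * (of_bool (c1 = 58 \<and> c3 = 58 \<and> c6 = 58) + of_bool (c1 = 58 \<and> c4 = 58 \<and> c5 = 58)
     + of_bool (c2 = 58 \<and> c3 = 58 \<and> c5 = 58) + of_bool (c2 = 58 \<and> c4 = 58 \<and> c6 = 58))"

lemma splits_real_le:
  assumes "{c1, c2, c3, c4, c5, c6} \<subseteq> insert 0 (block s)"
  shows "102400 * splits_real c1 c2 c3 c4 c5 c6 \<le> of_int (splits c1 c2 c3 c4 c5 c6)"
proof -
  have q: "102400 * quad c1 c2 \<le> form_bound c1 c2" "102400 * quad c3 c4 \<le> form_bound c3 c4" "102400 * quad c5 c6 \<le> form_bound c5 c6"
    using assms by (auto intro: quad_le)
  have distrib: "102400 * (A + B + C + 45 * (x + y + z + w)) =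
      102400 * A + 102400 * B + 102400 * C + 4608000 * x + 4608000 * y + 4608000 * z + 4608000 * w" for A B C x y z w :: real
    by (simp add: algebra_simps)
  have e: "of_int (if P then 4608000 else 0) = (4608000 * of_bool P :: real)" for P
    by simp
  show ?thesis
    unfolding splits_real_def splits_def of_int_add e distrib
    by (intro add_mono q order_refl)
qed

lemma ev_splits_exact: "ev (splits_exact c1 c2 c3 c4 c5 c6) = 31560434540240437248000000000000 * splits_real c1 c2 c3 c4 c5 c6"
  by (simp add: splits_real_def splits_exact_def quad_def ev_simp algebra_simps)

definition local_value :: "(nat \<Rightarrow> nat \<Rightarrow> bool) \<Rightarrow> nat \<Rightarrow> nat \<Rightarrow> nat \<Rightarrow> nat \<Rightarrow> nat \<Rightarrow> nat \<Rightarrow> nat \<Rightarrow> real" where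
  "local_value h a b c u v w z = splits_real (pair_class h a b c u v) (pair_class h a b c w z)
     (pair_class h a b c u w) (pair_class h a b c v z) (pair_class h a b c u z) (pair_class h a b c v w)"

lemma pair_class_block: "pair_class h a b c u v \<in> insert 0 (block (type_start (h a b) (h a c) (h b c)))"
  unfolding pair_class_def by (rule flag_class_block)

lemma quad_pair_class_sym: "quad (pair_class h a b c u v) (pair_class h a b c w z) = quad (pair_class h a b c w z) (pair_class h a b c u v)"
  by (rule quad_sym[OF pair_class_block pair_class_block])

context
  fixes h :: "nat \<Rightarrow> nat \<Rightarrow> bool" assumes h: "simple_rel h"
begin

lemma h_sym: "h i j = h j i"
  using h by (simp add: simple_rel_def)

lemma pair_class_swaps:
  "pair_class h b a c u v = pair_class h a b c u v"
  "pair_class h a c b u v = pair_class h a b c u v"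
  "pair_class h a b c v u = pair_class h a b c u v"
  unfolding pair_class_def h_sym[of b a] h_sym[of c b] h_sym[of v u]
  by (rule flag_class_swap_12 flag_class_swap_23 flag_class_swap_ends)+

lemma local_value_swaps:
  "local_value h b a c u v w z = local_value h a b c u v w z"
  "local_value h a c b u v w z = local_value h a b c u v w z"
  unfolding local_value_def
  by (simp_all only: pair_class_swaps(1)[of b a] pair_class_swaps(2)[of a c b])

lemma local_value_swap_uv: "local_value h a b c v u w z = local_value h a b c u v w z"
  unfolding local_value_def splits_real_def
  using quad_pair_class_sym[of h a b c u w v z] quad_pair_class_sym[of h a b c u z v w]
  by (simp add: pair_class_swaps(3)[of a b c v u] conj_ac)

lemma local_value_swap_vw: "local_value h a b c u w v z = local_value h a b c u v w z"
  unfolding local_value_def splits_real_def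
  by (simp add: pair_class_swaps(3)[of a b c w v] conj_ac)

lemma local_value_swap_wz: "local_value h a b c u v z w = local_value h a b c u v w z"
  unfolding local_value_def splits_real_def
  by (simp add: pair_class_swaps(3)[of a b c z w] conj_ac)

end

text \<open>
  Summing over all choices of roots makes the expression independent of the labelling.
\<close>

definition total :: "(nat \<Rightarrow> nat \<Rightarrow> bool) \<Rightarrow> real" where
  "total h = (\<Sum>(a, b, c, u, v, w, z)\<leftarrow>arrangements. local_value h a b c u v w z)"

lemma total_local_values: "total h = sum_list (local_values splits_real h)"
  by (simp add: total_def local_values_def local_value_def)

lemma splits_real_pair_class_le:
  "102400 * splits_real (pair_class h a b c u v) (pair_class h a b c w z) (pair_class h a b c u w)
     (pair_class h a b c v z) (pair_class h a b c u z) (pair_class h a b c v w)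
    \<le> of_int (splits (pair_class h a b c u v) (pair_class h a b c w z) (pair_class h a b c u w)
     (pair_class h a b c v z) (pair_class h a b c u z) (pair_class h a b c v w))"
  by (rule splits_real_le[where s = "type_start (h a b) (h a c) (h b c)"]) (simp only: insert_subset empty_subsetI pair_class_block simp_thms)

lemma sum_list_scale_le:
  fixes C :: real
  assumes "\<And>x. x \<in> set xs \<Longrightarrow> C * f x \<le> of_int (g x)"
  shows "C * sum_list (map f xs) \<le> of_int (sum_list (map g xs))"
  using assms
proof (induction xs)
  case (Cons x xs)
  have "C * f x \<le> of_int (g x)" "C * sum_list (map f xs) \<le> of_int (sum_list (map g xs))"
    using Cons by simp_all
  then show ?case by (simp add: distrib_left)
qed simp

lemma local_values_le: "102400 * sum_list (local_values splits_real h) \<le> of_int (sum_list (local_values splits h))"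
  unfolding local_values_def by (rule sum_list_scale_le) (auto intro: splits_real_pair_class_le)

lemma ksum_local_values: "ev (ksum (local_values splits_exact h)) = 31560434540240437248000000000000 * sum_list (local_values splits_real h)"
proof -
  have "ev (ksum (map (\<lambda>(a, b, c, u, v, w, z). splits_exact (f a b c u v) (f a b c w z) (f a b c u w) (f a b c v z) (f a b c u z) (f a b c v w)) xs))
      = 31560434540240437248000000000000 * sum_list (map (\<lambda>(a, b, c, u, v, w, z). splits_real (f a b c u v) (f a b c w z) (f a b c u w) (f a b c v z) (f a b c u z) (f a b c v w)) xs)"
    for f and xs :: "(nat \<times> nat \<times> nat \<times> nat \<times> nat \<times> nat \<times> nat) list"
    by (induction xs) (auto simp: ev_splits_exact distrib_left)
  then show ?thesis unfolding local_values_def by this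
qed

text \<open>
  The asymptotic maximum density, in terms of \<open>\<beta>\<close>.
\<close>

definition limit_value :: real where
  "limit_value = (- 5160 + 2364 * beta - 255 * beta ^ 2) / 200"

lemma limit_value_lower: "7798038 / 102400 \<le> 315 * limit_value"
  using beta_lower beta_sq_upper by (simp add: limit_value_def)

lemma rows_7: "rows 7 h = [[h 6 5, h 6 4, h 6 3, h 6 2, h 6 1, h 6 0], [h 5 4, h 5 3, h 5 2, h 5 1, h 5 0], [h 4 3, h 4 2, h 4 1, h 4 0], [h 3 2, h 3 1, h 3 0], [h 2 1, h 2 0], [h 1 0], []]"
  by (simp add: numeral_eq_Suc)

text \<open>
  The rows of a graph contain each pair once, so symmetry is needed to read off all values.
\<close>

lemma local_values_rows:
  assumes "simple_rel h"
  shows "local_values f (entry (rows 7 h)) = local_values f h"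
proof -
  have flip: "h 0 1 = h 1 0" "h 0 2 = h 2 0" "h 1 2 = h 2 1" "h 0 3 = h 3 0" "h 1 3 = h 3 1" "h 2 3 = h 3 2" "h 0 4 = h 4 0" "h 1 4 = h 4 1" "h 2 4 = h 4 2" "h 3 4 = h 4 3" "h 0 5 = h 5 0" "h 1 5 = h 5 1" "h 2 5 = h 5 2" "h 3 5 = h 5 3" "h 4 5 = h 5 4" "h 0 6 = h 6 0" "h 1 6 = h 6 1" "h 2 6 = h 6 2" "h 3 6 = h 6 3" "h 4 6 = h 6 4" "h 5 6 = h 6 5"
    using assms by (simp_all only: simple_rel_def)
  show ?thesis
    unfolding rows_7 local_values_eval
    by (simp only: local_values_def arrangements_def pair_class_def list.map prod.case flip[unfolded One_nat_def] One_nat_def)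
qed

text \<open>
  For the graphs off the list, the rounded integers suffice. For the tight ones the value is computed exactly in
  the field.
\<close>

lemma total_of_graph:
  assumes "simple_rel h" "rows 7 h \<in> set (graphs 7)"
  shows "total h \<le> 315 * limit_value - 30000 / 102400 \<or> total h = 315 * limit_value \<and> rows 7 h \<in> set tight_graphs"
proof -
  have seven: "Suc order_6 = 7" by (simp add: order_6_def order_5_def order_4_def order_3_def order_2_def)
  have "good (rows 7 h)"
    using all_good assms(2) unfolding seven list_all_iff by blast
  then consider "sum_list (local_values splits h) \<le> 7768038" | "rows 7 h \<in> set tight_graphs"
    unfolding good_def local_values_rows[OF assms(1)] by presburger
  then show ?thesis
  proof cases
    case 1
    then have "(of_int (sum_list (local_values splits h)) :: real) \<le> 7768038"
      by (metis of_int_le_iff of_int_numeral)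
    then have "102400 * total h \<le> 7768038"
      unfolding total_local_values by (rule order_trans[OF local_values_le])
    then show ?thesis using limit_value_lower by linarith
  next
    case tight: 2
    then have "exact (rows 7 h)" using tight_exact unfolding list_all_iff by blast
    then have "ev (ksum (local_values splits_exact h)) = ev (-256491651508534033514496000000000000, 117508965923677220005478400000000000, -12675459522224065609728000000000000)"
      unfolding exact_def local_values_rows[OF assms(1)] by (simp only:)
    then have "total h = 315 * limit_value"
      unfolding ksum_local_values total_local_values[symmetric] by (simp add: ev_simp limit_value_def)
    then show ?thesis using tight by blast
  qed
qed

lemma local_value_relabel: "local_value (relabel \<pi> h) a b c u v w z = local_value h (\<pi> a) (\<pi> b) (\<pi> c) (\<pi> u) (\<pi> v) (\<pi> w) (\<pi> z)"
  by (simp add: local_value_def pair_class_def relabel_def)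

text \<open>
  A transposition of vertices permutes the 35 summands, up to the symmetries of the local expression; the
  resulting identities hold by commutativity of addition.
\<close>

lemma total_transpose_eval:
  assumes h: "simple_rel h"
  shows "\<forall>ab\<in>set [(0, 1), (0, 2), (0, 3), (0, 4), (0, 5), (0, 6), (1, 2), (1, 3), (1, 4), (1, 5), (1, 6), (2, 3), (2, 4), (2, 5), (2, 6), (3, 4), (3, 5), (3, 6), (4, 5), (4, 6), (5, 6)]. total (relabel (Transposition.transpose (fst ab) (snd ab)) h) = total h"
  unfolding total_def arrangements_def list.map prod.case sum_list.Cons sum_list.Nil local_value_relabel
  by (simp add: Transposition.transpose_def local_value_swaps[OF h] local_value_swap_uv[OF h] local_value_swap_vw[OF h] local_value_swap_wz[OF h] add_ac)

lemma less_7_pairs: "a < b \<Longrightarrow> b < 7 \<Longrightarrow> (a, b) \<in> set [(0, 1), (0, 2), (0, 3), (0, 4), (0, 5), (0, 6), (1, 2), (1, 3), (1, 4), (1, 5), (1, 6),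
    (2, 3), (2, 4), (2, 5), (2, 6), (3, 4), (3, 5), (3, 6), (4, 5), (4, 6), (5, 6)]" for a b :: nat
  by simp presburger

lemma total_transpose:
  assumes h: "simple_rel h" and ab: "a < 7" "b < 7" "a \<noteq> b"
  shows "total (relabel (Transposition.transpose a b) h) = total h"
proof -
  have *: "total (relabel (Transposition.transpose a b) h) = total h" if "a < b" "b < 7" for a b
    using bspec[OF total_transpose_eval[OF h] less_7_pairs[OF that]] by simp
  show ?thesis
    using *[of a b] *[of b a] ab by (cases "a < b") (auto simp: Transposition.transpose_commute)
qed

lemma total_relabel:
  assumes "\<pi> permutes {..<7}" "simple_rel h"
  shows "total (relabel \<pi> h) = total h"
  using assms(1) finite_lessThan assms(2)
proof (induction arbitrary: h rule: permutes_induct)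
  case id
  then show ?case by (simp add: relabel_def)
next
  case (swap a b p)
  have "total (relabel (Transposition.transpose a b \<circ> p) h) = total (relabel p (relabel (Transposition.transpose a b) h))"
    by (simp add: relabel_relabel)
  also have "\<dots> = total (relabel (Transposition.transpose a b) h)"
    by (intro swap.IH simple_rel_relabel swap.prems)
  also have "\<dots> = total h"
    using swap by (intro total_transpose) auto
  finally show ?case .
qed

text \<open>
  A map to the vertices of the optimal pattern that preserves adjacency and non-adjacency: the graph embeds into a
  blowup.
\<close>

definition colourable :: "nat \<Rightarrow> (nat \<Rightarrow> nat \<Rightarrow> bool) \<Rightarrow> bool" where
  "colourable n h \<longleftrightarrow> (\<exists>f. \<forall>i<n. \<forall>j<n. h i j = base_adj (f i) (f j))"

lemma rows_inject: "rows n h = rows n h' \<Longrightarrow> j < i \<Longrightarrow> i < n \<Longrightarrow> h i j = h' i j"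
proof (induction n)
  case (Suc n)
  then show ?case
    by (cases "i = n") (auto simp: map_eq_conv)
qed simp

lemma colouring_rows_eq: "colouring_rows cs = rows (length cs) (\<lambda>i j. base_adj (rev cs ! i) (rev cs ! j))"
proof (induction cs)
  case (Cons c cs)
  have "map (\<lambda>j. base_adj c (rev cs ! j)) (rev [0..<length cs]) = map (base_adj c) (map ((!) (rev cs)) (rev [0..<length cs]))"
    by simp
  also have "map ((!) (rev cs)) (rev [0..<length cs]) = cs"
    using map_nth[of "rev cs"] by (metis length_rev rev_map rev_rev_ident)
  finally have *: "map (\<lambda>j. base_adj c (rev cs ! j)) (rev [0..<length cs]) = map (base_adj c) cs" .
  have "rows (length cs) (\<lambda>i j. base_adj (rev (c # cs) ! i) (rev (c # cs) ! j)) = rows (length cs) (\<lambda>i j. base_adj (rev cs ! i) (rev cs ! j))"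
    by (rule rows_cong) (simp add: nth_append)
  moreover have "map (\<lambda>j. base_adj (rev (c # cs) ! length cs) (rev (c # cs) ! j)) (rev [0..<length cs]) = map (base_adj c) cs"
    unfolding *[symmetric] by (simp add: nth_append)
  ultimately show ?case by (simp add: Cons)
qed simp

lemma base_adj_simple: "simple_rel (\<lambda>i j. base_adj (f i) (f j))"
  by (auto simp: simple_rel_def base_adj_def)

lemma simple_rel_eqI:
  fixes h h' :: "nat \<Rightarrow> nat \<Rightarrow> bool"
  assumes "simple_rel h" "simple_rel h'" "\<And>i j. j < i \<Longrightarrow> i < n \<Longrightarrow> h i j = h' i j" "i < n" "j < n"
  shows "h i j = h' i j"
proof -
  consider "i < j" | "j < i" | "i = j" by linarith
  then show ?thesis
    using assms(1,2) assms(3)[of i j] assms(3)[of j i] assms(4,5) by cases (auto simp: simple_rel_def)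
qed

lemma tight_colourable:
  assumes "simple_rel h" "rows 7 h \<in> set tight_graphs"
  shows "colourable 7 h"
proof -
  have "list_all (\<lambda>cs. length cs = 7) tight_colourings"
    by (simp add: tight_colourings_def)
  then obtain cs where cs: "length cs = 7" "rows 7 h = colouring_rows cs"
    using assms(2) unfolding tight_graphs_def list_all_iff by auto
  let ?g = "\<lambda>i j. base_adj (rev cs ! i) (rev cs ! j)"
  have "rows 7 h = rows 7 ?g" using cs colouring_rows_eq[of cs] by simp
  then have "h i j = ?g i j" if "i < 7" "j < 7" for i j
    using simple_rel_eqI[OF assms(1) base_adj_simple[of "\<lambda>i. rev cs ! i"], of 7 i j] rows_inject[of 7 h ?g] that by blast
  then show ?thesis unfolding colourable_def by (intro exI[of _ "\<lambda>i. rev cs ! i"]) blast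
qed

lemma colourable_relabel:
  assumes "\<pi> permutes {..<n}" "colourable n (relabel \<pi> h)"
  shows "colourable n h"
proof -
  obtain f where f: "\<And>i j. i < n \<Longrightarrow> j < n \<Longrightarrow> h (\<pi> i) (\<pi> j) = base_adj (f i) (f j)"
    using assms(2) unfolding colourable_def relabel_def by blast
  let ?\<rho> = "inv \<pi>"
  have "h i j = base_adj (f (?\<rho> i)) (f (?\<rho> j))" if "i < n" "j < n" for i j
  proof -
    have "?\<rho> i < n" "?\<rho> j < n"
      using permutes_in_image[OF permutes_inv[OF assms(1)]] that by auto
    then show ?thesis using f[of "?\<rho> i" "?\<rho> j"] permutes_inverses(1)[OF assms(1)] by simp
  qed
  then show ?thesis unfolding colourable_def by (intro exI[of _ "\<lambda>i. f (?\<rho> i)"]) blast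
qed

text \<open>
  Relabelling reduces the inequality to the generated graphs, and tight graphs embed into a blowup.
\<close>

lemma total_le:
  assumes h: "simple_rel h"
  shows "total h + 30000 / 102400 * of_bool (\<not> colourable 7 h) \<le> 315 * limit_value"
proof -
  obtain \<pi> where \<pi>: "\<pi> permutes {..<7}" "rows 7 (relabel \<pi> h) \<in> set (graphs 7)"
    using graphs_complete[OF h] by blast
  have eq: "total (relabel \<pi> h) = total h" by (rule total_relabel[OF \<pi>(1) h])
  from total_of_graph[OF simple_rel_relabel[OF h] \<pi>(2)] show ?thesis
  proof
    assume "total (relabel \<pi> h) = 315 * limit_value \<and> rows 7 (relabel \<pi> h) \<in> set tight_graphs"
    then have "colourable 7 h" "total h = 315 * limit_value"
      using tight_colourable[OF simple_rel_relabel[OF h]] colourable_relabel[OF \<pi>(1)] eq by auto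
    then show ?thesis by simp
  qed (auto simp: eq of_bool_def)
qed

section \<open>Weighted sums over tuples\<close>

text \<open>
  Sums range over all tuples of vertices, including those with repetitions. Then squares of sums are again such
  sums, without error terms of lower order, and pushing forward along a partition is exact.
\<close>

locale weighted_graph =
  fixes V :: "'a set" and \<mu> :: "'a \<Rightarrow> real" and E :: "'a \<Rightarrow> 'a \<Rightarrow> bool"
  assumes finite_V: "finite V" and \<mu>_nonneg: "\<And>v. v \<in> V \<Longrightarrow> 0 \<le> \<mu> v" and simple_E: "simple_rel E"
begin

definition tuples :: "nat \<Rightarrow> (nat \<Rightarrow> 'a) set" where
  "tuples n = PiE {..<n} (\<lambda>_. V)"

definition wsum :: "nat \<Rightarrow> ((nat \<Rightarrow> 'a) \<Rightarrow> real) \<Rightarrow> real" where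
  "wsum n \<phi> = (\<Sum>x\<in>tuples n. (\<Prod>i<n. \<mu> (x i)) * \<phi> x)"

definition mass :: real where
  "mass = (\<Sum>v\<in>V. \<mu> v)"

lemma tuples_mem: "x \<in> tuples n \<Longrightarrow> i < n \<Longrightarrow> x i \<in> V"
  by (auto simp: tuples_def)

lemma finite_tuples: "finite (tuples n)"
  unfolding tuples_def by (rule finite_PiE) (auto simp: finite_V)

lemma weight_nonneg: "x \<in> tuples n \<Longrightarrow> 0 \<le> (\<Prod>i<n. \<mu> (x i))"
  by (intro prod_nonneg) (auto intro: \<mu>_nonneg tuples_mem)

lemma wsum_mono: "(\<And>x. x \<in> tuples n \<Longrightarrow> \<phi> x \<le> \<psi> x) \<Longrightarrow> wsum n \<phi> \<le> wsum n \<psi>"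
  unfolding wsum_def by (intro sum_mono mult_left_mono weight_nonneg)

lemma wsum_cong: "(\<And>x. x \<in> tuples n \<Longrightarrow> \<phi> x = \<psi> x) \<Longrightarrow> wsum n \<phi> = wsum n \<psi>"
  unfolding wsum_def by (intro sum.cong) auto

lemma wsum_nonneg: "(\<And>x. x \<in> tuples n \<Longrightarrow> 0 \<le> \<phi> x) \<Longrightarrow> 0 \<le> wsum n \<phi>"
  unfolding wsum_def by (intro sum_nonneg mult_nonneg_nonneg weight_nonneg)

lemma wsum_add: "wsum n (\<lambda>x. \<phi> x + \<psi> x) = wsum n \<phi> + wsum n \<psi>"
  by (simp add: wsum_def distrib_left sum.distrib)

lemma wsum_cmult: "wsum n (\<lambda>x. c * \<phi> x) = c * wsum n \<phi>"
  by (simp add: wsum_def sum_distrib_left mult_ac)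

lemma wsum_0: "wsum 0 \<phi> = \<phi> (\<lambda>_. undefined)"
  by (simp add: wsum_def tuples_def)

lemma wsum_Suc: "wsum (Suc n) \<phi> = (\<Sum>v\<in>V. \<mu> v * wsum n (\<lambda>x. \<phi> (x(n := v))))"
proof -
  have eq: "tuples (Suc n) = (\<lambda>(v, x). x(n := v)) ` (V \<times> tuples n)"
    unfolding tuples_def lessThan_Suc by (rule PiE_insert_eq)
  have inj: "inj_on (\<lambda>(v, x). x(n := v)) (V \<times> tuples n)"
    unfolding tuples_def by (rule inj_combinator) simp
  have "wsum (Suc n) \<phi> = (\<Sum>(v, x)\<in>V \<times> tuples n. (\<Prod>i<Suc n. \<mu> ((x(n := v)) i)) * \<phi> (x(n := v)))"
    unfolding wsum_def eq by (subst sum.reindex[OF inj]) (simp add: case_prod_unfold)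
  also have "\<dots> = (\<Sum>v\<in>V. \<Sum>x\<in>tuples n. \<mu> v * ((\<Prod>i<n. \<mu> (x i)) * \<phi> (x(n := v))))"
    by (subst sum.cartesian_product[symmetric]) (auto intro!: sum.cong prod.cong)
  finally show ?thesis by (simp add: wsum_def sum_distrib_left)
qed

lemma wsum_permute:
  assumes "\<pi> permutes {..<n}"
  shows "wsum n (\<lambda>x. \<phi> (x \<circ> \<pi>)) = wsum n \<phi>"
  unfolding wsum_def
proof (rule sum.reindex_bij_witness[where j = "\<lambda>x. x \<circ> \<pi>" and i = "\<lambda>x. x \<circ> inv \<pi>"])
  have closed: "x \<circ> \<rho> \<in> tuples n" if "x \<in> tuples n" "\<rho> permutes {..<n}" for x \<rho>
    using that permutes_in_image[OF that(2)] permutes_not_in[OF that(2)]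
    unfolding tuples_def by (fastforce simp: PiE_iff extensional_def)
  fix x assume x: "x \<in> tuples n"
  show "x \<circ> \<pi> \<circ> inv \<pi> = x" "x \<circ> inv \<pi> \<circ> \<pi> = x"
    using permutes_inv_o[OF assms] by (simp_all add: comp_assoc)
  show "x \<circ> \<pi> \<in> tuples n" "x \<circ> inv \<pi> \<in> tuples n"
    using closed x assms permutes_inv[OF assms] by auto
  show "(\<Prod>i<n. \<mu> ((x \<circ> \<pi>) i)) * \<phi> (x \<circ> \<pi>) = (\<Prod>i<n. \<mu> (x i)) * \<phi> (x \<circ> \<pi>)"
    using prod.permute[OF assms, of "\<lambda>i. \<mu> (x i)"] by (simp add: comp_def)
qed

lemma wsum_one: "wsum n (\<lambda>_. 1) = mass ^ n"
  by (induction n) (simp_all add: wsum_0 wsum_Suc mass_def sum_distrib_right)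

definition pull :: "(nat \<Rightarrow> 'a) \<Rightarrow> nat \<Rightarrow> nat \<Rightarrow> bool" where
  "pull x i j = E (x i) (x j)"

lemma simple_pull: "simple_rel (pull x)"
  using simple_E by (simp add: simple_rel_def pull_def)

lemma list_permutes:
  assumes "distinct xs" "set xs = {..<length xs}"
  shows "(\<lambda>i. if i < length xs then xs ! i else i) permutes {..<length xs}"
proof (rule bij_imp_permutes)
  have "bij_betw ((!) xs) {..<length xs} {..<length xs}"
    using bij_betw_nth[OF assms(1) refl, of "{..<length xs}"] assms(2) by simp
  then show "bij_betw (\<lambda>i. if i < length xs then xs ! i else i) {..<length xs} {..<length xs}"
    by (rule bij_betw_cong[THEN iffD1, rotated]) simp
qed simp

lemma wsum_rearrange:
  assumes "distinct xs" "set xs = {..<length xs}"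
  shows "wsum (length xs) (\<lambda>x. \<phi> (\<lambda>i. x (if i < length xs then xs ! i else i))) = wsum (length xs) \<phi>"
  using wsum_permute[OF list_permutes[OF assms], of \<phi>] by (simp add: comp_def)

definition pair_value :: "(nat \<Rightarrow> 'a) \<Rightarrow> real" where
  "pair_value x = quad (pair_class (pull x) 6 5 4 3 2) (pair_class (pull x) 6 5 4 1 0)"

lemma ev_form_exact_insert:
  assumes "i \<in> insert 0 (block s)" "j \<in> insert 0 (block s)"
  shows "ev (form_exact i j) = (\<Sum>k\<in>block s. \<Sum>l\<in>block s. coord i k * coord j l * ev (gram k l))"
proof -
  consider "i = 0" | "j = 0" | "i \<in> block s" "j \<in> block s" using assms by blast
  then show ?thesis
    by cases (auto simp: form_exact_zero form_exact_zero_right ev_form_exact)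
qed

text \<open>
  A weighted sum over pairs of flags of the same type is the value of the form at the vector of the weighted class
  frequencies.
\<close>

lemma quad_sum_nonneg:
  fixes c :: "'b \<Rightarrow> nat" and w :: "'b \<Rightarrow> real"
  assumes "\<And>p. p \<in> P \<Longrightarrow> c p \<in> insert 0 (block s)"
  shows "0 \<le> (\<Sum>p\<in>P. \<Sum>q\<in>P. w p * w q * quad (c p) (c q))"
proof -
  define Y where "Y k = (\<Sum>p\<in>P. w p * coord (c p) k)" for k
  have "(\<Sum>p\<in>P. \<Sum>q\<in>P. w p * w q * ev (form_exact (c p) (c q)))
      = (\<Sum>p\<in>P. \<Sum>q\<in>P. \<Sum>k\<in>block s. \<Sum>l\<in>block s. ev (gram k l) * ((w p * coord (c p) k) * (w q * coord (c q) l)))"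
    by (intro sum.cong refl) (simp add: ev_form_exact_insert[OF assms assms] sum_distrib_left mult_ac)
  also have "\<dots> = (\<Sum>p\<in>P. \<Sum>k\<in>block s. \<Sum>l\<in>block s. \<Sum>q\<in>P. ev (gram k l) * ((w p * coord (c p) k) * (w q * coord (c q) l)))"
    by (intro sum.cong refl) (subst sum.swap, intro sum.cong refl sum.swap)
  also have "\<dots> = (\<Sum>k\<in>block s. \<Sum>l\<in>block s. \<Sum>p\<in>P. \<Sum>q\<in>P. ev (gram k l) * ((w p * coord (c p) k) * (w q * coord (c q) l)))"
    by (subst sum.swap, intro sum.cong refl sum.swap)
  also have "\<dots> = (\<Sum>k\<in>block s. \<Sum>l\<in>block s. ev (gram k l) * (Y k * Y l))"
    unfolding Y_def sum_product by (simp only: sum_distrib_left)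
  finally have "0 \<le> (\<Sum>p\<in>P. \<Sum>q\<in>P. w p * w q * ev (form_exact (c p) (c q)))"
    using gram_psd[where s = s and Y = Y] by simp
  moreover have "(\<Sum>p\<in>P. \<Sum>q\<in>P. w p * w q * quad (c p) (c q))
     = (\<Sum>p\<in>P. \<Sum>q\<in>P. w p * w q * ev (form_exact (c p) (c q))) / 31560434540240437248000000000000"
    by (simp add: quad_def sum_divide_distrib)
  ultimately show ?thesis by simp
qed

text \<open>
  For fixed roots, the two pairs of free vertices run independently over all pairs, so the previous lemma applies;
  here repetitions matter.
\<close>

lemma wsum_pair_value_nonneg: "0 \<le> wsum 7 pair_value"
proof -
  define cl where "cl a b c d e = flag_class (E a b) (E a c) (E b c) (E a d) (E b d) (E c d) (E a e) (E b e) (E c e) (E d e)" for a b c d e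
  have eq: "wsum 7 pair_value = (\<Sum>a\<in>V. \<mu> a * (\<Sum>b\<in>V. \<mu> b * (\<Sum>c\<in>V. \<mu> c *
     (\<Sum>d\<in>V. \<mu> d * (\<Sum>e\<in>V. \<mu> e * (\<Sum>f\<in>V. \<mu> f * (\<Sum>g\<in>V. \<mu> g * quad (cl a b c d e) (cl a b c f g))))))))"
    by (simp add: numeral_eq_Suc wsum_Suc wsum_0 pair_value_def pair_class_def pull_def cl_def)
  define G where "G a b c = (\<Sum>d\<in>V. \<mu> d * (\<Sum>e\<in>V. \<mu> e * (\<Sum>f\<in>V. \<mu> f * (\<Sum>g\<in>V. \<mu> g * quad (cl a b c d e) (cl a b c f g)))))" for a b c
  have "0 \<le> G a b c" for a b c
  proof -
    let ?s = "type_start (E a b) (E a c) (E b c)"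
    have "0 \<le> (\<Sum>p\<in>V \<times> V. \<Sum>q\<in>V \<times> V. (\<mu> (fst p) * \<mu> (snd p)) * (\<mu> (fst q) * \<mu> (snd q)) * quad (cl a b c (fst p) (snd p)) (cl a b c (fst q) (snd q)))"
      by (rule quad_sum_nonneg[where s = ?s]) (simp only: cl_def flag_class_block)
    then show ?thesis
      by (simp add: G_def sum.cartesian_product' case_prod_unfold sum_distrib_left mult_ac)
  qed
  then show ?thesis
    unfolding eq G_def[symmetric] by (intro sum_nonneg mult_nonneg_nonneg \<mu>_nonneg)
qed

lemma wsum_sum_list: "wsum n (\<lambda>x. \<Sum>p\<leftarrow>ps. \<phi> p x) = (\<Sum>p\<leftarrow>ps. wsum n (\<phi> p))"
  by (induction ps) (simp_all add: wsum_add wsum_cmult[of n 0, simplified])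

lemma wsum_pull:
  assumes "distinct [z, w, v, u, c, b, a]" "\<forall>i\<in>set [z, w, v, u, c, b, a]. i < 7"
  shows "wsum 7 (\<lambda>x. \<phi> (x z) (x w) (x v) (x u) (x c) (x b) (x a)) = wsum 7 (\<lambda>x. \<phi> (x 0) (x 1) (x 2) (x 3) (x 4) (x 5) (x 6))"
proof -
  let ?xs = "[z, w, v, u, c, b, a]"
  have "set ?xs = {..<length ?xs}"
    using assms distinct_card[OF assms(1)] by (intro card_subset_eq) auto
  from wsum_rearrange[OF assms(1) this, of "\<lambda>x. \<phi> (x 0) (x 1) (x 2) (x 3) (x 4) (x 5) (x 6)"]
  show ?thesis by (simp add: numeral_eq_Suc)
qed

text \<open>
  The target graph with centre \<open>a\<close>, leaves \<open>b\<close>, \<open>c\<close> and isolated vertices \<open>u\<close>, \<open>v\<close>, \<open>w\<close>.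
\<close>

definition target_at :: "'a \<Rightarrow> 'a \<Rightarrow> 'a \<Rightarrow> 'a \<Rightarrow> 'a \<Rightarrow> 'a \<Rightarrow> bool" where
  "target_at a b c u v w \<longleftrightarrow> E a b \<and> E a c \<and> \<not> E b c \<and> \<not> E a u \<and> \<not> E a v \<and> \<not> E a w \<and> \<not> E b u \<and> \<not> E b v \<and> \<not> E b w \<and>
     \<not> E c u \<and> \<not> E c v \<and> \<not> E c w \<and> \<not> E u v \<and> \<not> E u w \<and> \<not> E v w"

definition target_sum :: real where
  "target_sum = wsum 6 (\<lambda>x. of_bool (target_at (x 0) (x 1) (x 2) (x 3) (x 4) (x 5)))"

lemma wsum_target_at:
  assumes "distinct [z, w, v, u, c, b, a]" "\<forall>i\<in>set [z, w, v, u, c, b, a]. i < 7"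
  shows "wsum 7 (\<lambda>x. of_bool (target_at (x a) (x b) (x c) (x u) (x v) (x w))) = mass * target_sum"
proof -
  have "wsum 7 (\<lambda>x. of_bool (target_at (x a) (x b) (x c) (x u) (x v) (x w)))
      = wsum 7 (\<lambda>x. of_bool (target_at (x 0) (x 1) (x 2) (x 3) (x 4) (x 5)))"
    using wsum_pull[of a b c u v w z "\<lambda>a b c u v w z. of_bool (target_at a b c u v w)"]
      wsum_pull[of 0 1 2 3 4 5 6 "\<lambda>a b c u v w z. of_bool (target_at a b c u v w)"] assms by auto
  also have "\<dots> = wsum (Suc 6) (\<lambda>x. of_bool (target_at (x 0) (x 1) (x 2) (x 3) (x 4) (x 5)))" by simp
  also have "\<dots> = mass * target_sum"
    unfolding wsum_Suc by (simp add: mass_def target_sum_def sum_distrib_right)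
  finally show ?thesis .
qed

text \<open>
  Three roots of class 58 form a cherry, and exactly one of them is its centre.
\<close>

lemma triple_indicator:
  "(of_bool (pair_class (pull x) a b c u v = 58 \<and> pair_class (pull x) a b c u w = 58 \<and> pair_class (pull x) a b c v w = 58) :: real)
     = of_bool (target_at (x a) (x b) (x c) (x u) (x v) (x w)) + of_bool (target_at (x b) (x a) (x c) (x u) (x v) (x w))
       + of_bool (target_at (x c) (x a) (x b) (x u) (x v) (x w))"
proof -
  have s: "E (x b) (x a) = E (x a) (x b)" "E (x c) (x a) = E (x a) (x c)" "E (x c) (x b) = E (x b) (x c)"
    using simple_E by (simp_all add: simple_rel_def)
  show ?thesis
    unfolding pair_class_def flag_class_58 pull_def target_at_def s
    by (cases "E (x a) (x b)"; cases "E (x a) (x c)"; cases "E (x b) (x c)") (auto simp: of_bool_def)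
qed

lemma wsum_triple_indicator:
  assumes "distinct [z, w, v, u, c, b, a]" "\<forall>i\<in>set [z, w, v, u, c, b, a]. i < 7"
  shows "wsum 7 (\<lambda>x. of_bool (pair_class (pull x) a b c u v = 58 \<and> pair_class (pull x) a b c u w = 58 \<and> pair_class (pull x) a b c v w = 58)) = 3 * (mass * target_sum)"
  unfolding triple_indicator wsum_add
  using wsum_target_at[of z w v u c b a] wsum_target_at[of z w v u c a b] wsum_target_at[of z w v u b a c] assms by auto

lemma wsum_quad_nonneg:
  assumes "distinct [z, w, v, u, c, b, a]" "\<forall>i\<in>set [z, w, v, u, c, b, a]. i < 7"
  shows "0 \<le> wsum 7 (\<lambda>x. quad (pair_class (pull x) a b c u v) (pair_class (pull x) a b c w z))"
  using wsum_pair_value_nonneg unfolding pair_value_def pair_class_def pull_def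
  by (subst wsum_pull[OF assms, of "\<lambda>z w v u c b a. quad
     (flag_class (E a b) (E a c) (E b c) (E a u) (E b u) (E c u) (E a v) (E b v) (E c v) (E u v))
     (flag_class (E a b) (E a c) (E b c) (E a w) (E b w) (E c w) (E a z) (E b z) (E c z) (E w z))"])

text \<open>
  Four triples of free vertices and three possible centres, with weight 45, give \<open>4 * 3 * 45 = 540\<close>.
\<close>

lemma wsum_local_value_ge:
  assumes "distinct [z, w, v, u, c, b, a]" "\<forall>i\<in>set [z, w, v, u, c, b, a]. i < 7"
  shows "540 * (mass * target_sum) \<le> wsum 7 (\<lambda>x. local_value (pull x) a b c u v w z)"
proof -
  have sw: "pair_class (pull x) a b c v u = pair_class (pull x) a b c u v" for x u v
    by (rule pair_class_swaps(3)[OF simple_pull])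
  have "wsum 7 (\<lambda>x. local_value (pull x) a b c u v w z) =
     wsum 7 (\<lambda>x. quad (pair_class (pull x) a b c u v) (pair_class (pull x) a b c w z))
     + wsum 7 (\<lambda>x. quad (pair_class (pull x) a b c u w) (pair_class (pull x) a b c v z))
     + wsum 7 (\<lambda>x. quad (pair_class (pull x) a b c u z) (pair_class (pull x) a b c v w))
     + 45 * (wsum 7 (\<lambda>x. of_bool (pair_class (pull x) a b c u v = 58 \<and> pair_class (pull x) a b c u w = 58 \<and> pair_class (pull x) a b c v w = 58))
     + wsum 7 (\<lambda>x. of_bool (pair_class (pull x) a b c v u = 58 \<and> pair_class (pull x) a b c v z = 58 \<and> pair_class (pull x) a b c u z = 58))
     + wsum 7 (\<lambda>x. of_bool (pair_class (pull x) a b c w z = 58 \<and> pair_class (pull x) a b c w u = 58 \<and> pair_class (pull x) a b c z u = 58))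
     + wsum 7 (\<lambda>x. of_bool (pair_class (pull x) a b c z w = 58 \<and> pair_class (pull x) a b c z v = 58 \<and> pair_class (pull x) a b c w v = 58)))"
    unfolding local_value_def splits_real_def wsum_add[symmetric] wsum_cmult[symmetric]
    by (intro wsum_cong) (simp only: sw[of _ u v] sw[of _ u w] sw[of _ u z] sw[of _ w z] sw[of _ v z] sw[of _ v w] conj_ac)
  moreover have "wsum 7 (\<lambda>x. of_bool (pair_class (pull x) a b c u v = 58 \<and> pair_class (pull x) a b c u w = 58 \<and> pair_class (pull x) a b c v w = 58)) = 3 * (mass * target_sum)"
    using assms by (intro wsum_triple_indicator[where z = z]) auto
  moreover have "wsum 7 (\<lambda>x. of_bool (pair_class (pull x) a b c v u = 58 \<and> pair_class (pull x) a b c v z = 58 \<and> pair_class (pull x) a b c u z = 58)) = 3 * (mass * target_sum)"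
    using assms by (intro wsum_triple_indicator[where z = w]) auto
  moreover have "wsum 7 (\<lambda>x. of_bool (pair_class (pull x) a b c w z = 58 \<and> pair_class (pull x) a b c w u = 58 \<and> pair_class (pull x) a b c z u = 58)) = 3 * (mass * target_sum)"
    using assms by (intro wsum_triple_indicator[where z = v]) auto
  moreover have "wsum 7 (\<lambda>x. of_bool (pair_class (pull x) a b c z w = 58 \<and> pair_class (pull x) a b c z v = 58 \<and> pair_class (pull x) a b c w v = 58)) = 3 * (mass * target_sum)"
    using assms by (intro wsum_triple_indicator[where z = u]) auto
  moreover have "0 \<le> wsum 7 (\<lambda>x. quad (pair_class (pull x) a b c u v) (pair_class (pull x) a b c w z))"
    "0 \<le> wsum 7 (\<lambda>x. quad (pair_class (pull x) a b c u w) (pair_class (pull x) a b c v z))"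
    "0 \<le> wsum 7 (\<lambda>x. quad (pair_class (pull x) a b c u z) (pair_class (pull x) a b c v w))"
    using assms by (intro wsum_quad_nonneg; auto)+
  moreover have "540 * t \<le> l" if "l = q1 + q2 + q3 + 45 * (i1 + i2 + i3 + i4)" "i1 = 3 * t" "i2 = 3 * t" "i3 = 3 * t" "i4 = 3 * t"
    "0 \<le> q1" "0 \<le> q2" "0 \<le> q3" for l t q1 q2 q3 i1 i2 i3 i4 :: real
    unfolding that(1-5) using that(6-8) by (simp add: algebra_simps)
  ultimately show ?thesis by blast
qed

lemma arrangements_distinct: "\<forall>(a, b, c, u, v, w, z)\<in>set arrangements. distinct [z, w, v, u, c, b, a] \<and> (\<forall>i\<in>set [z, w, v, u, c, b, a]. i < 7)"
  by (simp add: arrangements_def)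

lemma wsum_total_ge: "18900 * (mass * target_sum) \<le> wsum 7 (\<lambda>x. total (pull x))"
proof -
  have "18900 * (mass * target_sum) = (\<Sum>p\<leftarrow>arrangements. 540 * (mass * target_sum))"
    by (simp add: sum_list_triv arrangements_def)
  also have "\<dots> \<le> (\<Sum>p\<leftarrow>arrangements. wsum 7 (\<lambda>x. case p of (a, b, c, u, v, w, z) \<Rightarrow> local_value (pull x) a b c u v w z))"
    using arrangements_distinct by (intro sum_list_mono) (auto intro!: wsum_local_value_ge)
  also have "\<dots> = wsum 7 (\<lambda>x. total (pull x))"
    by (simp add: wsum_sum_list total_def)
  finally show ?thesis .
qed

text \<open>
  The local inequality summed over all tuples. The 35 arrangements contribute equally, whence \<open>35 * 540 = 18900\<close>.
  Tuples that do not embed into a blowup are counted with the deficit of the local inequality.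
\<close>

theorem certificate:
  "18900 * (mass * target_sum) + 30000 / 102400 * wsum 7 (\<lambda>x. of_bool (\<not> colourable 7 (pull x))) \<le> 315 * limit_value * mass ^ 7"
proof -
  have "18900 * (mass * target_sum) + 30000 / 102400 * wsum 7 (\<lambda>x. of_bool (\<not> colourable 7 (pull x)))
     \<le> wsum 7 (\<lambda>x. total (pull x) + 30000 / 102400 * of_bool (\<not> colourable 7 (pull x)))"
    unfolding wsum_add wsum_cmult using wsum_total_ge by linarith
  also have "\<dots> \<le> wsum 7 (\<lambda>x. 315 * limit_value * 1)"
    by (intro wsum_mono) (simp only: mult_1_right total_le[OF simple_pull])
  also have "\<dots> = 315 * limit_value * mass ^ 7"
    unfolding wsum_cmult wsum_one ..
  finally show ?thesis .
qed

end

section \<open>The optimal blowup\<close>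

definition alpha :: real where
  "alpha = beta / 5"

lemma alpha_bounds: "7210 / 10000 \<le> alpha" "alpha < 7211 / 10000"
  using beta_lower beta_upper by (simp_all add: alpha_def)

lemma alpha_root: "alpha ^ 3 + 2 * alpha ^ 2 - 32 / 5 * alpha + 16 / 5 = 0"
  using beta_root by (simp add: alpha_def field_simps)

lemma limit_value_alpha: "limit_value = - (255 / 8) * alpha ^ 2 + 591 / 10 * alpha - 129 / 5"
  by (simp add: limit_value_def alpha_def field_simps)

lemma limit_value_bounds: "2417 / 10000 < limit_value" "limit_value < 2418 / 10000"
  using beta_lower beta_upper beta_sq_lower beta_sq_upper by (simp_all add: limit_value_def)

text \<open>
  The value at the symmetric point with \<open>x\<^sub>0 = x\<^sub>1 = S / 2\<close> and \<open>x\<^sub>2 = x\<^sub>3 = T / 2\<close>, up to a constant, in terms of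
  \<open>s = S + T\<close> and \<open>e = S T\<close>.
\<close>

definition profile :: "real \<Rightarrow> real \<Rightarrow> real" where
  "profile s e = (s * (1 - s)) ^ 3 + 3 * s * (1 - s) ^ 2 * (2 * s - 1) * e + (1 - s) * (15 / 2 * s - 6) * e ^ 2 + e ^ 3 / 2"

text \<open>
  The value for \<open>S = T\<close>; its derivative is \<open>30 s ^ 2 / 128\<close> times the cubic of \<open>\<alpha>\<close>.
\<close>

definition diagonal :: "real \<Rightarrow> real" where
  "diagonal s = s ^ 3 * (32 - 48 * s + 12 * s ^ 2 + 5 * s ^ 3) / 128"

lemma profile_diagonal: "profile s (s ^ 2 / 4) = diagonal s"
  by (simp add: profile_def diagonal_def field_simps power_numeral_reduce)

lemma diagonal_alpha: "15 * diagonal alpha = limit_value"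
proof -
  have r: "alpha ^ 3 = 32 / 5 * alpha - 16 / 5 - 2 * alpha ^ 2" using alpha_root by simp
  have 4: "alpha ^ 4 = 52 / 5 * alpha ^ 2 - 16 * alpha + 32 / 5"
    using r by algebra
  have 5: "alpha ^ 5 = 52 / 5 * alpha ^ 3 - 16 * alpha ^ 2 + 32 / 5 * alpha"
    using 4 by algebra
  have 6: "alpha ^ 6 = 52 / 5 * alpha ^ 4 - 16 * alpha ^ 3 + 32 / 5 * alpha ^ 2"
    using 4 by algebra
  have "15 * diagonal alpha = 15 * (32 * alpha ^ 3 - 48 * alpha ^ 4 + 12 * alpha ^ 5 + 5 * alpha ^ 6) / 128"
    by (simp add: diagonal_def algebra_simps power_numeral_reduce)
  then show ?thesis
    unfolding 6 5 4 r limit_value_alpha by (simp add: field_simps)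
qed

text \<open>
  As \<open>\<alpha>\<close> is a critical point, \<open>(s - \<alpha>) ^ 2\<close> divides the difference; the quotient is a quartic, negative on the
  unit interval.
\<close>

lemma diagonal_less:
  assumes "0 \<le> s" "s \<le> 1" "s \<noteq> alpha"
  shows "diagonal s < diagonal alpha"
proof -
  \<comment> \<open>division of the difference by the square of \<open>s - alpha\<close>, reduced by the cubic\<close>
  define a2 where "a2 = - 48 + 24 * alpha + 15 * alpha ^ 2"
  define a1 where "a1 = - 32 + 32 * alpha - 4 * alpha ^ 2"
  define A where "A = 5 * s ^ 4 + (12 + 10 * alpha) * s ^ 3 + a2 * s ^ 2 + a1 * s + alpha * a1 / 2"
  have r: "alpha ^ 3 = 32 / 5 * alpha - 16 / 5 - 2 * alpha ^ 2" using alpha_root by simp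
  have "128 * (diagonal s - diagonal alpha) = (s - alpha) ^ 2 * A"
    unfolding diagonal_def A_def a1_def a2_def using r by simp algebra
  moreover have "A < 0"
  proof -
    have sq: "alpha ^ 2 < 0.52" "0.5198 \<le> alpha ^ 2"
      using power_strict_mono[OF alpha_bounds(2), of 2] power_mono[OF alpha_bounds(1), of 2] alpha_bounds
      by (simp_all add: power2_eq_square)
    have a1: "a1 \<le> - 10" and a2: "a2 \<le> - 22" using sq alpha_bounds by (simp_all add: a1_def a2_def)
    have "s ^ 4 \<le> s ^ 2" "s ^ 3 \<le> s ^ 2" "s ^ 2 \<le> 1"
      using assms by (auto intro!: power_decreasing power_le_one)
    moreover have "(12 + 10 * alpha) * s ^ 3 \<le> 20 * s ^ 2"
      using alpha_bounds calculation assms by (intro mult_mono) auto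
    moreover have "a2 * s ^ 2 \<le> - 22 * s ^ 2" by (rule mult_right_mono[OF a2]) simp
    moreover have "a1 * s \<le> 0" using a1 assms by (simp add: mult_nonpos_nonneg)
    moreover have "alpha * a1 \<le> alpha * - 10" using a1 alpha_bounds by (intro mult_left_mono) auto
    ultimately show ?thesis using alpha_bounds unfolding A_def by linarith
  qed
  ultimately have "128 * (diagonal s - diagonal alpha) < 0"
    using assms(3) by (simp add: mult_pos_neg)
  then show ?thesis by simp
qed

lemma quarter_bound: "s * (1 - s) \<le> 1 / 4" for s :: real
  using zero_le_power2[of "s - 1 / 2"] by (simp add: power2_eq_square algebra_simps)

text \<open>
  For \<open>s \<le> 1 / 2\<close> all terms with \<open>e\<close> are nonpositive together.
\<close>

lemma profile_low:
  assumes "0 \<le> s" "s \<le> 1 / 2" "0 \<le> e" "e \<le> s ^ 2 / 4"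
  shows "profile s e \<le> 1 / 64"
proof -
  have "(s * (1 - s)) ^ 3 \<le> (1 / 4) ^ 3"
    using assms quarter_bound by (intro power_mono) auto
  then have "(s * (1 - s)) ^ 3 \<le> 1 / 64" by (simp add: power_divide)
  moreover have "3 * s * (1 - s) ^ 2 * (2 * s - 1) * e \<le> 0"
    using assms by (intro mult_nonpos_nonneg mult_nonneg_nonpos) auto
  moreover have "(1 - s) * (15 / 2 * s - 6) * e ^ 2 + e ^ 3 / 2 \<le> 0"
  proof -
    have "s ^ 2 \<le> (1 / 2) ^ 2" using assms by (intro power_mono) auto
    then have "e \<le> 1 / 16" using assms by (simp add: power2_eq_square)
    moreover have "(1 / 2) * (9 / 4) \<le> (1 - s) * (6 - 15 / 2 * s)"
      using assms by (intro mult_mono) auto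
    ultimately have "(1 - s) * (15 / 2 * s - 6) + e / 2 \<le> 0" by (simp add: algebra_simps)
    then have "((1 - s) * (15 / 2 * s - 6) + e / 2) * e ^ 2 \<le> 0" by (rule mult_nonpos_nonneg) simp
    then show ?thesis by (simp add: algebra_simps power_numeral_reduce)
  qed
  ultimately show ?thesis unfolding profile_def by linarith
qed

text \<open>
  Here the profile may have an interior maximum in \<open>e\<close>. After bounding the cubic term by a quadratic one,
  completing the square leaves a polynomial in \<open>s\<close> of degree nine, which has positive coefficients in the
  Bernstein basis of the interval.
\<close>

lemma profile_middle:
  assumes "1 / 2 \<le> s" "s \<le> 2 / 3" "0 \<le> e" "e \<le> s ^ 2 / 4"
  shows "profile s e \<le> 2 / 125"
proof -
  define B where "B = 3 * s * (1 - s) ^ 2 * (2 * s - 1)"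
  define C where "C = (1 - s) * (6 - 15 / 2 * s) - s ^ 2 / 8"
  have C: "0 < C"
  proof -
    have "(1 / 3) * 1 \<le> (1 - s) * (6 - 15 / 2 * s)" using assms by (intro mult_mono) auto
    moreover have "s ^ 2 \<le> (2 / 3) ^ 2" using assms by (intro power_mono) auto
    ultimately show ?thesis by (simp add: C_def power_divide)
  qed
  have "e / 2 * e ^ 2 \<le> s ^ 2 / 8 * e ^ 2" using assms by (intro mult_right_mono) auto
  then have le: "profile s e \<le> (s * (1 - s)) ^ 3 + B * e - C * e ^ 2"
    unfolding profile_def B_def C_def by (simp add: algebra_simps power_numeral_reduce)
  \<comment> \<open>the affine map from the interval to the unit interval\<close>
  define t where "t = 6 * s - 3"
  have t: "0 \<le> t" "t \<le> 1" "s = 1 / 2 + t / 6" using assms by (auto simp: t_def field_simps)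
  have "419904000 * (4 * C * (2 / 125 - (s * (1 - s)) ^ 3) - B ^ 2) = 688905 * (1 - t) ^ 9 + 5557167 * t * (1 - t) ^ 8
     + 22792914 * t ^ 2 * (1 - t) ^ 7 + 57261492 * t ^ 3 * (1 - t) ^ 6 + 90775080 * t ^ 4 * (1 - t) ^ 5 + 90525600 * t ^ 5 * (1 - t) ^ 4
     + 55084032 * t ^ 6 * (1 - t) ^ 3 + 18795264 * t ^ 7 * (1 - t) ^ 2 + 2839552 * t ^ 8 * (1 - t) + 40960 * t ^ 9"
    unfolding C_def B_def t(3) by (simp add: field_simps power_numeral_reduce)
  also have "0 \<le> \<dots>" using t by (intro add_nonneg_nonneg mult_nonneg_nonneg zero_le_power) auto
  finally have "B ^ 2 \<le> 4 * C * (2 / 125 - (s * (1 - s)) ^ 3)" by simp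
  moreover have "4 * C * ((s * (1 - s)) ^ 3 + B * e - C * e ^ 2) = 4 * C * (s * (1 - s)) ^ 3 + B ^ 2 - (2 * C * e - B) ^ 2"
    by algebra
  moreover have "0 \<le> (2 * C * e - B) ^ 2" by simp
  ultimately have "4 * C * ((s * (1 - s)) ^ 3 + B * e - C * e ^ 2) \<le> 4 * C * (2 / 125)"
    unfolding right_diff_distrib by linarith
  then have "(s * (1 - s)) ^ 3 + B * e - C * e ^ 2 \<le> 2 / 125" using C by simp
  then show ?thesis using le by simp
qed

text \<open>
  The derivative in \<open>e\<close> is quadratic with negative discriminant for \<open>2 / 3 < s < 1\<close>, and it is \<open>3 / 2 * e ^ 2\<close> for
  \<open>s = 1\<close>; so the profile increases in \<open>e\<close> up to the diagonal.
\<close>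

lemma profile_high:
  assumes "2 / 3 < s" "s \<le> 1" "0 \<le> e" "e \<le> s ^ 2 / 4"
  shows "profile s e \<le> diagonal s" "e \<noteq> s ^ 2 / 4 \<Longrightarrow> profile s e < diagonal s"
proof -
  define E where "E = s ^ 2 / 4"
  define B where "B = 3 * s * (1 - s) ^ 2 * (2 * s - 1)"
  define D where "D = (1 - s) * (15 / 2 * s - 6)"
  have dif: "diagonal s - profile s e = (E - e) * (B + D * (E + e) + (E ^ 2 + E * e + e ^ 2) / 2)"
    unfolding profile_diagonal[symmetric] profile_def E_def[symmetric] B_def[symmetric] D_def[symmetric]
    by (simp add: field_simps power_numeral_reduce)
  have E: "e \<le> E" "0 < E" using assms by (auto simp: E_def)
  have pos: "0 < B + D * (E + e) + (E ^ 2 + E * e + e ^ 2) / 2"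
  proof (cases "s = 1")
    case True
    have "0 \<le> E * e" "0 < E ^ 2" using E assms by auto
    then show ?thesis by (simp add: True B_def D_def add_pos_nonneg)
  next
    case False
    have "B - 2 / 3 * D ^ 2 = (1 - s) ^ 2 * (63 / 2 * (s - 2 / 3) * (8 / 7 - s))"
      unfolding B_def D_def by (simp add: field_simps power_numeral_reduce)
    moreover have "0 < (1 - s) ^ 2 * (63 / 2 * (s - 2 / 3) * (8 / 7 - s))"
      using assms False by (intro mult_pos_pos) auto
    moreover have "B + D * (E + e) + (E ^ 2 + E * e + e ^ 2) / 2 = (B - 2 / 3 * D ^ 2) + 3 / 8 * (E + e + 4 / 3 * D) ^ 2 + (E - e) ^ 2 / 8"
      by (simp add: field_simps power_numeral_reduce)
    moreover have "0 \<le> 3 / 8 * (E + e + 4 / 3 * D) ^ 2" "0 \<le> (E - e) ^ 2 / 8" by simp_all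
    ultimately show ?thesis by linarith
  qed
  show "profile s e \<le> diagonal s"
    using mult_nonneg_nonneg[of "E - e", OF _ less_imp_le[OF pos]] dif E by simp
  show "profile s e < diagonal s" if "e \<noteq> s ^ 2 / 4"
    using mult_pos_pos[of "E - e", OF _ pos] dif E that by (simp add: E_def)
qed

lemma profile_le:
  assumes "0 \<le> s" "s \<le> 1" "0 \<le> e" "e \<le> s ^ 2 / 4"
  shows "15 * profile s e \<le> limit_value"
    and "15 * profile s e = limit_value \<Longrightarrow> s = alpha \<and> e = s ^ 2 / 4"
proof -
  have less: "15 * profile s e < limit_value" if "\<not> (s = alpha \<and> e = s ^ 2 / 4)"
  proof -
    consider "s \<le> 1 / 2" | "1 / 2 \<le> s" "s \<le> 2 / 3" | "2 / 3 < s" by linarith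
    then show ?thesis
    proof cases
      case 1
      then show ?thesis using profile_low[of s e] assms limit_value_bounds by simp
    next
      case 2
      then show ?thesis using profile_middle[of s e] assms limit_value_bounds by simp
    next
      case 3
      then show ?thesis
        using profile_high[of s e] diagonal_less[of s] assms that diagonal_alpha by (cases "s = alpha") auto
    qed
  qed
  show "s = alpha \<and> e = s ^ 2 / 4" if "15 * profile s e = limit_value"
    using less that by (auto simp del: limit_value_alpha)
  show "15 * profile s e \<le> limit_value"
  proof (cases "s = alpha \<and> e = s ^ 2 / 4")
    case True
    then have "e = alpha ^ 2 / 4" "s = alpha" by simp_all
    then have "profile s e = diagonal alpha" by (simp only: profile_diagonal)
    then show ?thesis using diagonal_alpha by simp
  qed (use less in auto)
qed

text \<open>
  The density of the target graph in a blowup: centre in part 0 or 1 (or 2 or 3), leaves in its partner, and three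
  isolated vertices that avoid one of the two parts of the other pair.
\<close>

definition blowup_poly :: "(nat \<Rightarrow> real) \<Rightarrow> real" where
  "blowup_poly x = 60 * (x 0 * x 1 * (x 0 + x 1) * ((x 2 + x 4) ^ 3 + (x 3 + x 4) ^ 3 - x 4 ^ 3)
     + x 2 * x 3 * (x 2 + x 3) * ((x 0 + x 4) ^ 3 + (x 1 + x 4) ^ 3 - x 4 ^ 3))"

text \<open>
  The same function of the sums \<open>S\<close>, \<open>T\<close> and the products \<open>p\<close>, \<open>q\<close> of the two pairs; it is bilinear in \<open>p\<close> and
  \<open>q\<close>.
\<close>

definition pair_form :: "real \<Rightarrow> real \<Rightarrow> real \<Rightarrow> real \<Rightarrow> real \<Rightarrow> real" where
  "pair_form S T z p q = p * S * ((T + z) ^ 3 - 3 * q * (T + 2 * z)) + q * T * ((S + z) ^ 3 - 3 * p * (S + 2 * z))"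

lemma blowup_poly_pair_form:
  "blowup_poly x = 60 * pair_form (x 0 + x 1) (x 2 + x 3) (x 4) (x 0 * x 1) (x 2 * x 3)"
  unfolding blowup_poly_def pair_form_def by algebra

lemma four_mult_le_square: "4 * (a * b) \<le> (a + b) ^ 2" for a b :: real
  using zero_le_power2[of "a - b"] by (simp add: power2_eq_square algebra_simps)

lemma one_pair_le:
  fixes S :: real
  assumes "0 \<le> S" "S \<le> 1" "p \<le> S ^ 2 / 4"
  shows "p * S * (1 - S) ^ 3 \<le> 1 / 256"
proof -
  have "p * (S * (1 - S) ^ 3) \<le> S ^ 2 / 4 * (S * (1 - S) ^ 3)"
    using assms by (intro mult_right_mono) auto
  also have "\<dots> = (S * (1 - S)) ^ 3 / 4" by algebra
  also have "\<dots> \<le> (1 / 4) ^ 3 / 4"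
    using assms quarter_bound by (intro divide_right_mono power_mono) auto
  finally show ?thesis by (simp add: power_divide mult_ac)
qed

lemma pair_form_corner:
  assumes "S + T + z = 1"
  shows "4 * pair_form S T z (S ^ 2 / 4) (T ^ 2 / 4) = profile (S + T) (S * T)"
proof -
  have z: "z = 1 - S - T" using assms by simp
  show ?thesis unfolding pair_form_def profile_def z by (simp add: field_simps power_numeral_reduce)
qed

text \<open>
  A function that is bilinear on a rectangle is a convex combination of its values at the corners. Three corners
  have value at most \<open>1 / 256\<close>, and the fourth is the symmetric point.
\<close>

lemma pair_form_le:
  assumes "0 \<le> S" "0 \<le> T" "0 \<le> z" "S + T + z = 1" "0 \<le> p" "p \<le> S ^ 2 / 4" "0 \<le> q" "q \<le> T ^ 2 / 4"
  shows "60 * pair_form S T z p q \<le> limit_value"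
    and "60 * pair_form S T z p q = limit_value \<Longrightarrow> p = S ^ 2 / 4 \<and> q = T ^ 2 / 4 \<and> S = alpha / 2 \<and> T = alpha / 2"
proof -
  define M where "M = limit_value / 60"
  have Tz: "T + z = 1 - S" "S + z = 1 - T" using assms by auto
  have M: "1 / 256 < M" using limit_value_bounds by (simp add: M_def)
  have p0: "pair_form S T z p' 0 \<le> 1 / 256" if "p' \<le> S ^ 2 / 4" for p'
    using one_pair_le[of S p'] that assms by (simp add: pair_form_def Tz)
  have q0: "pair_form S T z 0 q' \<le> 1 / 256" if "q' \<le> T ^ 2 / 4" for q'
    using one_pair_le[of T q'] that assms by (simp add: pair_form_def Tz)
  have *: "pair_form S T z p q \<le> M \<and> (pair_form S T z p q = M \<longrightarrow> p = S ^ 2 / 4 \<and> q = T ^ 2 / 4 \<and> S = alpha / 2 \<and> T = alpha / 2)"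
  proof (cases "S = 0 \<or> T = 0")
    case True
    then have "pair_form S T z p q \<le> 1 / 256"
    proof
      assume "S = 0"
      then have "p = 0" using assms by simp
      then show ?thesis using q0[OF assms(8)] by simp
    next
      assume "T = 0"
      then have "q = 0" using assms by simp
      then show ?thesis using p0[OF assms(6)] by simp
    qed
    then show ?thesis using M by auto
  next
    case False
    define P Q where "P = S ^ 2 / 4" and "Q = T ^ 2 / 4"
    have PQ: "0 < P" "0 < Q" "p \<le> P" "q \<le> Q" using False assms by (auto simp: P_def Q_def)
    have ST: "0 < S" "0 < T" using False assms by auto
    have e: "S * T \<le> (S + T) ^ 2 / 4" using four_mult_le_square[of S T] by simp
    have st: "0 \<le> S + T" "S + T \<le> 1" "0 \<le> S * T" using assms by auto
    note corner = pair_form_corner[OF assms(4), folded P_def Q_def]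
    have M1: "pair_form S T z P Q \<le> M" using profile_le(1)[OF st e] corner by (simp add: M_def)
    have M2: "S = alpha / 2 \<and> T = alpha / 2" if "pair_form S T z P Q = M"
    proof -
      have "15 * profile (S + T) (S * T) = limit_value" using that corner by (simp add: M_def)
      from profile_le(2)[OF st e this] have "S + T = alpha" "(S - T) ^ 2 = 0"
        by (auto simp: power2_eq_square algebra_simps)
      then show ?thesis by auto
    qed
    define w where "w = pair_form S T z"
    have w: "M - w P 0 > 0" "M - w 0 Q > 0" "M - w P Q \<ge> 0"
      using p0[of P] q0[of Q] M M1 by (auto simp: w_def P_def Q_def)
    \<comment> \<open>the convex combination of the corners, multiplied by the area \<open>P * Q\<close>; the corner \<open>(0, 0)\<close> has value 0\<close>
    have eq: "P * Q * (M - w p q) = (P - p) * (Q - q) * M + p * (Q - q) * (M - w P 0) + (P - p) * q * (M - w 0 Q) + p * q * (M - w P Q)"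
      unfolding w_def pair_form_def by algebra
    have nn: "0 \<le> (P - p) * (Q - q) * M" "0 \<le> p * (Q - q) * (M - w P 0)" "0 \<le> (P - p) * q * (M - w 0 Q)" "0 \<le> p * q * (M - w P Q)"
      using PQ w assms M by (auto intro!: mult_nonneg_nonneg)
    have "0 \<le> P * Q * (M - w p q)" using eq nn by linarith
    then have "0 \<le> M - w p q" using mult_le_cancel_left_pos[of "P * Q" 0] PQ by simp
    moreover have "p = P \<and> q = Q \<and> S = alpha / 2 \<and> T = alpha / 2" if "w p q = M"
    proof -
      have "P * Q * (M - w p q) = 0" using that by simp
      then have z: "(P - p) * (Q - q) * M = 0" "p * (Q - q) * (M - w P 0) = 0" "(P - p) * q * (M - w 0 Q) = 0" "p * q * (M - w P Q) = 0"
        using eq nn by linarith+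
      have "P = p \<or> Q = q" using z(1) M by simp
      moreover have "p = 0 \<or> Q = q" using z(2) w(1) by simp
      moreover have "P = p \<or> q = 0" using z(3) w(2) by simp
      ultimately have "p = P" "q = Q" using PQ(1,2) by auto
      then show ?thesis using M2 that by (simp add: w_def)
    qed
    ultimately show ?thesis unfolding w_def P_def Q_def diff_ge_0_iff_ge by blast
  qed
  then show "60 * pair_form S T z p q \<le> limit_value" by (simp add: M_def)
  show "p = S ^ 2 / 4 \<and> q = T ^ 2 / 4 \<and> S = alpha / 2 \<and> T = alpha / 2" if "60 * pair_form S T z p q = limit_value"
    using * that by (simp add: M_def)
qed

definition optimum :: "nat \<Rightarrow> real" where
  "optimum = nth_default 0 [alpha / 4, alpha / 4, alpha / 4, alpha / 4, 1 - alpha]"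

lemma optimum_simps [simp]: "optimum 0 = alpha / 4" "optimum 1 = alpha / 4" "optimum 2 = alpha / 4" "optimum 3 = alpha / 4" "optimum 4 = 1 - alpha"
  "optimum (Suc 0) = alpha / 4" "5 \<le> i \<Longrightarrow> optimum i = 0"
  by (simp_all add: optimum_def nth_default_def numeral_eq_Suc)

lemma less_5_cases: "i < 5 \<Longrightarrow> i = 0 \<or> i = 1 \<or> i = 2 \<or> i = 3 \<or> i = (4 :: nat)"
  by linarith

lemma simplex_5: "x \<in> std_simplex 5 \<longleftrightarrow> 0 \<le> x 0 \<and> 0 \<le> x 1 \<and> 0 \<le> x 2 \<and> 0 \<le> x 3 \<and> 0 \<le> x 4 \<and> (\<forall>i\<ge>5. x i = 0) \<and> x 0 + x 1 + x 2 + x 3 + x 4 = 1"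
proof -
  have "(\<forall>i<5. 0 \<le> x i) \<longleftrightarrow> 0 \<le> x 0 \<and> 0 \<le> x 1 \<and> 0 \<le> x 2 \<and> 0 \<le> x 3 \<and> 0 \<le> x 4"
    using less_5_cases by auto
  moreover have "(\<Sum>i<5. x i) = x 0 + x 1 + x 2 + x 3 + x 4" by (simp add: numeral_eq_Suc)
  ultimately show ?thesis unfolding std_simplex_def by auto
qed

lemma optimum_in_simplex: "optimum \<in> std_simplex 5"
  unfolding simplex_5 using alpha_bounds by simp

lemma blowup_poly_le:
  assumes "x \<in> std_simplex 5"
  shows "blowup_poly x \<le> limit_value" and "blowup_poly x = limit_value \<Longrightarrow> x = optimum"
proof -
  have x: "0 \<le> x 0" "0 \<le> x 1" "0 \<le> x 2" "0 \<le> x 3" "0 \<le> x 4" "\<And>i. 5 \<le> i \<Longrightarrow> x i = 0" "x 0 + x 1 + x 2 + x 3 + x 4 = 1"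
    using assms unfolding simplex_5 by auto
  have p: "x 0 * x 1 \<le> (x 0 + x 1) ^ 2 / 4" "x 2 * x 3 \<le> (x 2 + x 3) ^ 2 / 4"
    using four_mult_le_square[of "x 0" "x 1"] four_mult_le_square[of "x 2" "x 3"] by auto
  have le: "0 \<le> x 0 + x 1" "0 \<le> x 2 + x 3" "x 0 + x 1 + (x 2 + x 3) + x 4 = 1" "0 \<le> x 0 * x 1" "0 \<le> x 2 * x 3"
    using x by auto
  note bl = pair_form_le[OF le(1,2) x(5) le(3) le(4) p(1) le(5) p(2)]
  show "blowup_poly x \<le> limit_value" unfolding blowup_poly_pair_form by (rule bl(1))
  assume "blowup_poly x = limit_value"
  from bl(2)[folded blowup_poly_pair_form, OF this]
  have e: "(x 0 - x 1) ^ 2 = 0" "(x 2 - x 3) ^ 2 = 0" "x 0 + x 1 = alpha / 2" "x 2 + x 3 = alpha / 2"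
    by (auto simp: power2_eq_square algebra_simps)
  then have v: "x 0 = alpha / 4" "x 1 = alpha / 4" "x 2 = alpha / 4" "x 3 = alpha / 4" "x 4 = 1 - alpha"
    using x by auto
  show "x = optimum"
  proof
    fix i
    show "x i = optimum i"
      using v x(6)[of i] less_5_cases[of i] by (cases "i < 5") auto
  qed
qed

lemma blowup_poly_optimum: "blowup_poly optimum = limit_value"
proof -
  have "4 * pair_form (alpha / 2) (alpha / 2) (1 - alpha) ((alpha / 2) ^ 2 / 4) ((alpha / 2) ^ 2 / 4) = profile alpha (alpha ^ 2 / 4)"
    using pair_form_corner[of "alpha / 2" "alpha / 2" "1 - alpha"] by (simp add: power2_eq_square)
  moreover have "blowup_poly optimum = 60 * pair_form (alpha / 2) (alpha / 2) (1 - alpha) ((alpha / 2) ^ 2 / 4) ((alpha / 2) ^ 2 / 4)"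
    unfolding blowup_poly_pair_form by (simp add: power2_eq_square)
  ultimately show ?thesis using diagonal_alpha profile_diagonal[of alpha] by simp
qed

text \<open>
  By compactness of the simplex and uniqueness of the maximiser.
\<close>

lemma blowup_poly_near:
  assumes "0 < \<delta>"
  shows "\<exists>\<epsilon>>0. \<forall>x\<in>std_simplex 5. limit_value - \<epsilon> \<le> blowup_poly x \<longrightarrow> (\<forall>i<5. \<bar>x i - optimum i\<bar> < \<delta>)"
proof -
  \<comment> \<open>compactness is used in a product of five copies of the reals, to which \<open>vec\<close> is the passage\<close>
  define D where "D x = \<bar>x 0 - optimum 0\<bar> + \<bar>x 1 - optimum 1\<bar> + \<bar>x 2 - optimum 2\<bar> + \<bar>x 3 - optimum 3\<bar> + \<bar>x 4 - optimum 4\<bar>" for x :: "nat \<Rightarrow> real"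
  define vec :: "real \<times> real \<times> real \<times> real \<times> real \<Rightarrow> nat \<Rightarrow> real" where "vec = (\<lambda>(a, b, c, d, e). nth_default 0 [a, b, c, d, e])"
  have vec: "vec (a, b, c, d, e) 0 = a" "vec (a, b, c, d, e) 1 = b" "vec (a, b, c, d, e) 2 = c" "vec (a, b, c, d, e) 3 = d" "vec (a, b, c, d, e) 4 = e"
    "5 \<le> i \<Longrightarrow> vec (a, b, c, d, e) i = 0" for a b c d e i
    by (simp_all add: vec_def nth_default_def numeral_eq_Suc)
  have cont: "continuous_on UNIV (\<lambda>p. vec p 0)" "continuous_on UNIV (\<lambda>p. vec p 1)" "continuous_on UNIV (\<lambda>p. vec p 2)" "continuous_on UNIV (\<lambda>p. vec p 3)" "continuous_on UNIV (\<lambda>p. vec p 4)"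
    unfolding vec_def by (simp_all add: case_prod_unfold nth_default_def numeral_eq_Suc continuous_intros)
  define K where "K = {p. 0 \<le> vec p 0} \<inter> {p. 0 \<le> vec p 1} \<inter> {p. 0 \<le> vec p 2} \<inter> {p. 0 \<le> vec p 3} \<inter> {p. 0 \<le> vec p 4} \<inter>
     {p. vec p 0 + vec p 1 + vec p 2 + vec p 3 + vec p 4 = 1} \<inter> {p. \<delta> \<le> D (vec p)}"
  have "closed K"
    unfolding K_def D_def
    by (intro closed_Int closed_Collect_le closed_Collect_eq continuous_intros cont)
  moreover have "K \<subseteq> {0..1} \<times> {0..1} \<times> {0..1} \<times> {0..1} \<times> {0..1}"
    by (auto simp: K_def vec vec(2)[simplified])
  moreover have "compact ({0..1} \<times> {0..1} \<times> {0..1} \<times> {0..1} \<times> {0..1::real} :: (real \<times> real \<times> real \<times> real \<times> real) set)"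
    by (intro compact_Times compact_Icc)
  ultimately have "compact K" by (metis closed_Int_compact inf.absorb_iff1)
  have K_simplex: "vec p \<in> std_simplex 5" "vec p \<noteq> optimum" if "p \<in> K" for p
  proof -
    obtain a b c d e where p: "p = (a, b, c, d, e)" by (cases p)
    show "vec p \<in> std_simplex 5" using that unfolding simplex_5 K_def p by (auto simp: vec)
    show "vec p \<noteq> optimum" using that assms by (auto simp: K_def D_def)
  qed
  have ex: "\<exists>\<epsilon>>0. \<forall>p\<in>K. blowup_poly (vec p) < limit_value - \<epsilon>"
  proof (cases "K = {}")
    case False
    have "continuous_on K (\<lambda>p. blowup_poly (vec p))"
      unfolding blowup_poly_def by (intro continuous_intros continuous_on_subset[OF cont(1)] continuous_on_subset[OF cont(2)]
        continuous_on_subset[OF cont(3)] continuous_on_subset[OF cont(4)] continuous_on_subset[OF cont(5)]) auto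
    then obtain m where m: "m \<in> K" "\<And>p. p \<in> K \<Longrightarrow> blowup_poly (vec p) \<le> blowup_poly (vec m)"
      using continuous_attains_sup[OF \<open>compact K\<close> False] by blast
    have "blowup_poly (vec m) < limit_value"
      using blowup_poly_le[OF K_simplex(1)[OF m(1)]] K_simplex(2)[OF m(1)] by fastforce
    then show ?thesis
      using m(2) by (intro exI[of _ "(limit_value - blowup_poly (vec m)) / 2"]) (fastforce simp: field_simps)
  qed (auto intro: exI[of _ 1])
  then obtain \<epsilon> where \<epsilon>: "0 < \<epsilon>" "\<And>p. p \<in> K \<Longrightarrow> blowup_poly (vec p) < limit_value - \<epsilon>" by blast
  have "\<bar>x i - optimum i\<bar> < \<delta>" if x: "x \<in> std_simplex 5" "limit_value - \<epsilon> \<le> blowup_poly x" and i: "i < 5" for x i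
  proof -
    let ?p = "(x 0, x 1, x 2, x 3, x 4)"
    have same: "blowup_poly (vec ?p) = blowup_poly x" "D (vec ?p) = D x"
      unfolding blowup_poly_def D_def vec by (rule refl)+
    then have "?p \<notin> K" using \<epsilon>(2)[of ?p] x(2) by auto
    then have "D x < \<delta>"
      using x(1) same(2) unfolding simplex_5 K_def by (auto simp: vec vec(2)[simplified])
    moreover have "\<bar>x i - optimum i\<bar> \<le> D x"
      using less_5_cases[OF i] unfolding D_def by (elim disjE) auto
    ultimately show ?thesis by simp
  qed
  then show ?thesis using \<epsilon>(1) by blast
qed

section \<open>Copies of the target graph as tuples\<close>

definition star :: "nat \<Rightarrow> nat \<Rightarrow> bool" where
  "star i j \<longleftrightarrow> (i = 0 \<and> j \<in> {1, 2}) \<or> (j = 0 \<and> i \<in> {1, 2})"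

text \<open>
  Tuples in the order centre, leaves, isolated vertices; entries may repeat.
\<close>

definition copies :: "'a set \<Rightarrow> ('a \<Rightarrow> 'a \<Rightarrow> bool) \<Rightarrow> (nat \<Rightarrow> 'a) set" where
  "copies V E = {x \<in> PiE {..<6} (\<lambda>_. V). \<forall>i<6. \<forall>j<6. E (x i) (x j) = star i j}"

lemma less_6_cases: "i < 6 \<Longrightarrow> i = 0 \<or> i = 1 \<or> i = 2 \<or> i = 3 \<or> i = 4 \<or> i = (5 :: nat)"
  by linarith

lemma all_less_6: "(\<forall>i<6. P i) \<longleftrightarrow> P 0 \<and> P 1 \<and> P 2 \<and> P 3 \<and> P 4 \<and> P (5 :: nat)"
  using less_6_cases by auto

context weighted_graph begin

lemma target_at_iff:
  "target_at (x 0) (x 1) (x 2) (x 3) (x 4) (x 5) \<longleftrightarrow> (\<forall>i<6. \<forall>j<6. E (x i) (x j) = star i j)"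
proof -
  have s: "E u v = E v u" "\<not> E u u" for u v using simple_E by (auto simp: simple_rel_def)
  show ?thesis
    unfolding target_at_def all_less_6 star_def
    using s(1)[of "x 1" "x 0"] s(1)[of "x 2" "x 0"] s(1)[of "x 3" "x 0"] s(1)[of "x 4" "x 0"] s(1)[of "x 5" "x 0"]
      s(1)[of "x 2" "x 1"] s(1)[of "x 3" "x 1"] s(1)[of "x 4" "x 1"] s(1)[of "x 5" "x 1"]
      s(1)[of "x 3" "x 2"] s(1)[of "x 4" "x 2"] s(1)[of "x 5" "x 2"]
      s(1)[of "x 4" "x 3"] s(1)[of "x 5" "x 3"] s(1)[of "x 5" "x 4"]
    by (simp add: s(2)) blast
qed

lemma target_sum_copies: "target_sum = (\<Sum>x\<in>copies V E. \<Prod>i<6. \<mu> (x i))"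
proof -
  have "target_sum = (\<Sum>x\<in>tuples 6. if x \<in> copies V E then \<Prod>i<6. \<mu> (x i) else 0)"
    unfolding target_sum_def wsum_def target_at_iff
    by (intro sum.cong refl) (simp add: copies_def tuples_def)
  also have "\<dots> = (\<Sum>x\<in>tuples 6 \<inter> copies V E. \<Prod>i<6. \<mu> (x i))"
    by (simp add: sum.inter_restrict finite_tuples)
  also have "tuples 6 \<inter> copies V E = copies V E" by (auto simp: copies_def tuples_def)
  finally show ?thesis .
qed

end

lemma finite_copies: "finite V \<Longrightarrow> finite (copies V E)"
  unfolding copies_def by (rule finite_Collect_conjI, rule disjI1) (auto simp: finite_PiE)

text \<open>
  The genuine copies; all but \<open>O(n ^ 5)\<close> of the tuples are of this kind.
\<close>

definition injective_copies :: "'a set \<Rightarrow> ('a \<Rightarrow> 'a \<Rightarrow> bool) \<Rightarrow> (nat \<Rightarrow> 'a) set" where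
  "injective_copies V E = {x \<in> copies V E. inj_on x {..<6}}"

text \<open>
  Orbits of the automorphism group of the target graph: the centre, the leaves, the isolated vertices.
\<close>

definition star_class :: "nat \<Rightarrow> nat" where
  "star_class i = (if i = 0 then 0 else if i \<in> {1, 2} then 1 else 2)"

lemma star_star_class: "star i j \<longleftrightarrow> (star_class i = 0 \<and> star_class j = 1) \<or> (star_class i = 1 \<and> star_class j = 0)"
  by (auto simp: star_def star_class_def)

lemma permutes_restrict:
  assumes "inj f" "finite A" "f ` A \<subseteq> A"
  shows "(\<lambda>i. if i \<in> A then f i else i) permutes A"
proof (rule bij_imp_permutes)
  have "f ` A = A" using assms by (intro endo_inj_surj) (auto intro: inj_on_subset)
  then show "bij_betw (\<lambda>i. if i \<in> A then f i else i) A A"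
    using assms(1) by (auto simp: bij_betw_def inj_on_def)
qed simp

definition star_automorphisms :: "(nat \<Rightarrow> nat) set" where
  "star_automorphisms = {\<pi>. \<pi> permutes {..<6} \<and> (\<forall>i<6. \<forall>j<6. star (\<pi> i) (\<pi> j) = star i j)}"

text \<open>
  The group permutes the two leaves and the three isolated vertices independently.
\<close>

lemma card_star_automorphisms: "card star_automorphisms = 12"
proof -
  let ?P = "{p. p permutes {1, 2 :: nat}}" and ?Q = "{q. q permutes {3, 4, 5 :: nat}}"
  let ?f = "\<lambda>(p, q). p \<circ> q :: nat \<Rightarrow> nat"
  have pieces: "(p \<circ> q) i = (if i \<in> {1, 2} then p i else q i)" "p i \<in> {1, 2} \<longleftrightarrow> i \<in> {1, 2}" "q i \<in> {3, 4, 5} \<longleftrightarrow> i \<in> {3, 4, 5}"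
    if "p \<in> ?P" "q \<in> ?Q" for p q and i :: nat
  proof -
    show pi: "p i \<in> {1, 2} \<longleftrightarrow> i \<in> {1, 2}" and qi: "q i \<in> {3, 4, 5} \<longleftrightarrow> i \<in> {3, 4, 5}"
      using that permutes_in_image[of p "{1, 2}" i] permutes_in_image[of q "{3, 4, 5}" i] by simp_all
    show "(p \<circ> q) i = (if i \<in> {1, 2} then p i else q i)"
    proof (cases "i \<in> {3, 4, 5}")
      case True
      then have "q i \<notin> {1, 2}" using qi by auto
      then show ?thesis using True that permutes_not_in[of p "{1, 2}" "q i"] by auto
    next
      case False
      then have "q i = i" using that permutes_not_in[of q "{3, 4, 5}" i] by blast
      then show ?thesis using that permutes_not_in[of p "{1, 2}" i] by auto
    qed
  qed
  have "inj_on ?f (?P \<times> ?Q)"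
  proof (rule inj_onI, clarify)
    fix p q p' q' :: "nat \<Rightarrow> nat"
    assume *: "p permutes {1, 2}" "q permutes {3, 4, 5}" "p' permutes {1, 2}" "q' permutes {3, 4, 5}" "p \<circ> q = p' \<circ> q'"
    have eq: "(if i \<in> {1, 2} then p i else q i) = (if i \<in> {1, 2} then p' i else q' i)" for i
      using pieces(1)[of p q i] pieces(1)[of p' q' i] * by auto
    have "p i = p' i" for i
      using eq[of i] permutes_not_in[OF *(1), of i] permutes_not_in[OF *(3), of i] by (cases "i \<in> {1, 2}") auto
    moreover have "q i = q' i" for i
      using eq[of i] permutes_not_in[OF *(2), of i] permutes_not_in[OF *(4), of i] by (cases "i \<in> {1, 2}") auto
    ultimately show "p = p' \<and> q = q'" by auto
  qed
  moreover have "?f ` (?P \<times> ?Q) = star_automorphisms"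
  proof (intro equalityI subsetI)
    fix \<pi> assume "\<pi> \<in> ?f ` (?P \<times> ?Q)"
    then obtain p q where pq: "p \<in> ?P" "q \<in> ?Q" "\<pi> = p \<circ> q" by auto
    have "p permutes {..<6}" "q permutes {..<6}"
      using pq by (auto intro: permutes_subset)
    then have "\<pi> permutes {..<6}" unfolding pq(3) by (intro permutes_compose)
    moreover have "star_class (\<pi> i) = star_class i" for i
    proof (cases "i \<in> {1, 2}")
      case True
      then show ?thesis using pieces[OF pq(1,2), of i] by (auto simp: star_class_def pq(3))
    next
      case False
      then have \<pi>q: "\<pi> i = q i" using pieces(1)[OF pq(1,2), of i] by (simp add: pq(3))
      show ?thesis
      proof (cases "i \<in> {3, 4, 5}")
        case True
        then have "q i \<in> {3, 4, 5}" using pieces(3)[OF pq(1,2), of i] by blast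
        then have "star_class (q i) = 2" by (auto simp: star_class_def)
        then show ?thesis using True by (auto simp: \<pi>q star_class_def)
      next
        case False
        then have "q i = i" using pq(2) permutes_not_in[of q "{3, 4, 5}" i] by blast
        then show ?thesis by (simp add: \<pi>q)
      qed
    qed
    ultimately show "\<pi> \<in> star_automorphisms"
      by (simp add: star_automorphisms_def star_star_class)
  next
    fix \<pi> assume "\<pi> \<in> star_automorphisms"
    then have \<pi>: "\<pi> permutes {..<6}" and st: "\<And>i j. i < 6 \<Longrightarrow> j < 6 \<Longrightarrow> star (\<pi> i) (\<pi> j) = star i j"
      by (auto simp: star_automorphisms_def)
    have inj: "inj \<pi>" using \<pi> by (rule permutes_inj)
    have "star (\<pi> 0) (\<pi> 1)" "star (\<pi> 0) (\<pi> 2)" by (simp_all add: st) (simp_all add: star_def)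
    moreover have "\<pi> 1 \<noteq> \<pi> 2" using inj by (simp add: inj_eq)
    ultimately have 0: "\<pi> 0 = 0" by (auto simp: star_def)
    have 12: "\<pi> ` {1, 2} \<subseteq> {1, 2}"
      using \<open>star (\<pi> 0) (\<pi> 1)\<close> \<open>star (\<pi> 0) (\<pi> 2)\<close> by (auto simp: 0 star_def)
    have 345: "\<pi> i \<in> {3, 4, 5}" if "i \<in> {3, 4, 5}" for i
    proof -
      have "\<not> star 0 (\<pi> i)" using st[of 0 i] that by (auto simp: 0 star_def)
      moreover have "\<pi> i \<noteq> 0" using inj_eq[OF inj, of i 0] that 0 by auto
      moreover have "\<pi> i < 6" using permutes_in_image[OF \<pi>, of i] that by auto
      ultimately show ?thesis using less_6_cases[of "\<pi> i"] by (auto simp: star_def)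
    qed
    let ?p = "\<lambda>i. if i \<in> {1, 2} then \<pi> i else i" and ?q = "\<lambda>i. if i \<in> {3, 4, 5} then \<pi> i else i"
    have pq: "?p \<in> ?P" "?q \<in> ?Q"
      using permutes_restrict[OF inj, of "{1, 2}"] permutes_restrict[OF inj, of "{3, 4, 5}"] 12 345 by auto
    have "(?p \<circ> ?q) i = \<pi> i" for i
    proof (cases "i < 6")
      case True
      then show ?thesis using less_6_cases[of i] pieces(1)[OF pq, of i] 0 by auto
    next
      case False
      then have "\<pi> i = i" using permutes_not_in[OF \<pi>, of i] by simp
      then show ?thesis using pieces(1)[OF pq, of i] False by auto
    qed
    then have "\<pi> = ?f (?p, ?q)" by auto
    then show "\<pi> \<in> ?f ` (?P \<times> ?Q)" using pq by blast
  qed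
  ultimately have "card star_automorphisms = card (?P \<times> ?Q)"
    by (metis card_image)
  also have "\<dots> = 12"
    using card_permutations[of "{1, 2 :: nat}" 2] card_permutations[of "{3, 4, 5 :: nat}" 3]
    by (simp add: card_cartesian_product fact_numeral)
  finally show ?thesis .
qed

lemma star_permuted_copy:
  assumes "\<pi> \<in> star_automorphisms" "y \<in> injective_copies V E"
  shows "restrict (y \<circ> \<pi>) {..<6} \<in> injective_copies V E" "restrict (y \<circ> \<pi>) {..<6} ` {..<6} = y ` {..<6}"
proof -
  have \<pi>: "\<pi> permutes {..<6}" and st: "\<And>i j. i < 6 \<Longrightarrow> j < 6 \<Longrightarrow> star (\<pi> i) (\<pi> j) = star i j"
    using assms(1) by (auto simp: star_automorphisms_def)
  have less: "\<pi> i < 6 \<longleftrightarrow> i < 6" for i using permutes_in_image[OF \<pi>, of i] by simp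
  have img: "\<pi> ` {..<6} = {..<6}" using \<pi> by (rule permutes_image)
  have y: "\<And>i. i < 6 \<Longrightarrow> y i \<in> V" "\<And>i j. i < 6 \<Longrightarrow> j < 6 \<Longrightarrow> E (y i) (y j) = star i j" "inj_on y {..<6}"
    using assms(2) by (auto simp: injective_copies_def copies_def)
  have "inj_on (y \<circ> \<pi>) {..<6}"
    using permutes_inj_on[OF \<pi>] y(3) by (intro comp_inj_on) (simp_all add: img)
  then show "restrict (y \<circ> \<pi>) {..<6} \<in> injective_copies V E"
    using y less st by (auto simp: injective_copies_def copies_def inj_on_restrict_eq)
  show "restrict (y \<circ> \<pi>) {..<6} ` {..<6} = y ` {..<6}"
    using img by (metis image_comp image_restrict_eq inf.idem)
qed

text \<open>
  The tuples on a fixed vertex set form a torsor under the automorphism group.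
\<close>

lemma card_copies_on_set:
  assumes y: "y \<in> injective_copies V E"
  shows "card {x \<in> injective_copies V E. x ` {..<6} = y ` {..<6}} = 12"
proof -
  let ?f = "\<lambda>\<pi>. restrict (y \<circ> \<pi>) {..<6}"
  have inj: "inj_on y {..<6}" using y by (simp add: injective_copies_def)
  have "inj_on ?f star_automorphisms"
  proof (rule inj_onI)
    fix \<pi> \<rho> assume *: "\<pi> \<in> star_automorphisms" "\<rho> \<in> star_automorphisms" "?f \<pi> = ?f \<rho>"
    then have p: "\<pi> permutes {..<6}" "\<rho> permutes {..<6}" by (auto simp: star_automorphisms_def)
    show "\<pi> = \<rho>"
    proof
      fix i
      show "\<pi> i = \<rho> i"
      proof (cases "i < 6")
        case True
        then have "y (\<pi> i) = y (\<rho> i)" using fun_cong[OF *(3), of i] by simp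
        then show ?thesis using inj True p permutes_in_image[of _ "{..<6}" i] by (auto dest: inj_onD)
      next
        case False
        then show ?thesis using permutes_not_in[OF p(1), of i] permutes_not_in[OF p(2), of i] by simp
      qed
    qed
  qed
  moreover have "?f ` star_automorphisms = {x \<in> injective_copies V E. x ` {..<6} = y ` {..<6}}"
  proof (intro equalityI subsetI)
    fix x assume "x \<in> ?f ` star_automorphisms"
    then show "x \<in> {x \<in> injective_copies V E. x ` {..<6} = y ` {..<6}}"
      using star_permuted_copy[OF _ y] by blast
  next
    fix x assume "x \<in> {x \<in> injective_copies V E. x ` {..<6} = y ` {..<6}}"
    then have x: "x \<in> injective_copies V E" and img: "x ` {..<6} = y ` {..<6}" by auto
    define \<pi> where "\<pi> i = (if i < 6 then the_inv_into {..<6} y (x i) else i)" for i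
    have in_y: "x i \<in> y ` {..<6}" if "i < 6" for i using img that by auto
    have y\<pi>: "\<pi> i < 6" "y (\<pi> i) = x i" if "i < 6" for i
      using the_inv_into_into[OF inj in_y[OF that], of "{..<6}"] f_the_inv_into_f[OF inj in_y[OF that]] that
      by (auto simp: \<pi>_def)
    have injx: "inj_on x {..<6}" using x by (simp add: injective_copies_def)
    have "inj_on \<pi> {..<6}"
      by (rule inj_onI) (metis injx inj_onD lessThan_iff y\<pi>(2))
    moreover from this have "\<pi> ` {..<6} = {..<6}"
      using y\<pi>(1) by (intro endo_inj_surj) auto
    ultimately have "bij_betw \<pi> {..<6} {..<6}" by (simp add: bij_betw_def)
    then have "\<pi> permutes {..<6}" by (rule bij_imp_permutes) (simp add: \<pi>_def)
    moreover have "star (\<pi> i) (\<pi> j) = star i j" if "i < 6" "j < 6" for i j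
    proof -
      have "star (\<pi> i) (\<pi> j) = E (y (\<pi> i)) (y (\<pi> j))"
        using y y\<pi>(1)[OF that(1)] y\<pi>(1)[OF that(2)] by (simp add: injective_copies_def copies_def)
      also have "\<dots> = star i j" using x that by (simp add: y\<pi> injective_copies_def copies_def)
      finally show ?thesis .
    qed
    moreover have "x = ?f \<pi>"
    proof (rule PiE_ext)
      show "x \<in> PiE {..<6} (\<lambda>_. V)" "?f \<pi> \<in> PiE {..<6} (\<lambda>_. V)"
        using x y y\<pi>(1) by (auto simp: injective_copies_def copies_def)
    qed (simp add: y\<pi>)
    ultimately show "x \<in> ?f ` star_automorphisms" by (auto simp: star_automorphisms_def)
  qed
  ultimately show ?thesis
    by (metis card_image card_star_automorphisms)
qed

definition adj :: "pattern \<Rightarrow> nat \<Rightarrow> nat \<Rightarrow> bool" where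
  "adj G u v \<longleftrightarrow> {u, v} \<in> edges G"

lemma simple_adj: "simple_graph G \<Longrightarrow> simple_rel (adj G)"
  by (simp add: simple_rel_def simple_graph_def adj_def insert_commute)

lemma finite_verts: "simple_graph G \<Longrightarrow> finite (verts G)"
  by (simp add: simple_graph_def wf_pattern_def)

text \<open>
  The given graph has the leaves 1 and 4; exchanging 2 and 4 moves the leaves to the positions 1 and 2.
\<close>

lemma edges_F2: "u < 6 \<Longrightarrow> v < 6 \<Longrightarrow> {u, v} \<in> edges F2 \<longleftrightarrow> star (Transposition.transpose 2 4 u) (Transposition.transpose 2 4 v)"
  by (drule less_6_cases, drule less_6_cases, elim disjE)
    (simp_all add: F2_def mk_pattern_def star_def Transposition.transpose_def doubleton_eq_iff)

lemma isomorphic_F2_iff: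
  assumes "S \<subseteq> verts G"
  shows "isomorphic (induced_subgraph G S) F2 \<longleftrightarrow> (\<exists>x\<in>injective_copies (verts G) (adj G). x ` {..<6} = S)"
proof
  have F2v: "verts F2 = {..<6}" by (auto simp: F2_def mk_pattern_def)
  have \<tau>: "Transposition.transpose 2 4 permutes {..<6 :: nat}" by (rule permutes_swap_id) auto
  note \<tau>_less = permutes_in_image[OF \<tau>, simplified]
  assume "isomorphic (induced_subgraph G S) F2"
  then obtain f where f: "bij_betw f S {..<6}" and e: "\<And>u v. u \<in> S \<Longrightarrow> v \<in> S \<Longrightarrow> {u, v} \<in> edges G \<longleftrightarrow> {f u, f v} \<in> edges F2"
    unfolding isomorphic_def is_isomorphism_def induced_subgraph_def F2v by auto
  define x where "x = restrict (\<lambda>i. the_inv_into S f (Transposition.transpose 2 4 i)) {..<6}"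
  have xi: "x i \<in> S" "f (x i) = Transposition.transpose 2 4 i" if "i < 6" for i
  proof -
    have "Transposition.transpose 2 4 i \<in> f ` S" using f \<tau>_less[of i] that by (auto simp: bij_betw_def)
    then show "x i \<in> S" "f (x i) = Transposition.transpose 2 4 i"
      using the_inv_into_into[of f S "Transposition.transpose 2 4 i" S] f_the_inv_into_f[of f S "Transposition.transpose 2 4 i"] f that
      by (auto simp: x_def bij_betw_def)
  qed
  have "inj_on x {..<6}"
    by (rule inj_onI) (metis lessThan_iff transpose_eq_imp_eq xi(2) transpose_involutory)
  moreover have "x ` {..<6} = S"
  proof (intro equalityI subsetI)
    fix u assume u: "u \<in> S"
    then have "f u < 6" using f by (auto simp: bij_betw_def)
    then have "Transposition.transpose 2 4 (f u) < 6" "f (x (Transposition.transpose 2 4 (f u))) = f u" "x (Transposition.transpose 2 4 (f u)) \<in> S"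
      using xi[of "Transposition.transpose 2 4 (f u)"] \<tau>_less[of "f u"] by auto
    then show "u \<in> x ` {..<6}" using f u by (metis bij_betw_def imageI inj_onD lessThan_iff)
  qed (use xi in auto)
  moreover have "adj G (x i) (x j) = star i j" if "i < 6" "j < 6" for i j
    using e[OF xi(1) xi(1), OF that] edges_F2[of "f (x i)" "f (x j)"] xi(2) that \<tau>_less by (simp add: adj_def)
  moreover have "x \<in> PiE {..<6} (\<lambda>_. verts G)"
    using xi assms by (auto simp: x_def)
  ultimately show "\<exists>x\<in>injective_copies (verts G) (adj G). x ` {..<6} = S"
    by (auto simp: injective_copies_def copies_def intro!: bexI[of _ x])
next
  assume "\<exists>x\<in>injective_copies (verts G) (adj G). x ` {..<6} = S"
  then obtain x where inj: "inj_on x {..<6}" and S: "S = x ` {..<6}" and a: "\<And>i j. i < 6 \<Longrightarrow> j < 6 \<Longrightarrow> adj G (x i) (x j) = star i j"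
    by (auto simp: injective_copies_def copies_def)
  have F2v: "verts F2 = {..<6}" by (auto simp: F2_def mk_pattern_def)
  have \<tau>: "Transposition.transpose 2 4 permutes {..<6 :: nat}" by (rule permutes_swap_id) auto
  note \<tau>_less = permutes_in_image[OF \<tau>, simplified]
  define f where "f u = Transposition.transpose 2 4 (the_inv_into {..<6} x u)" for u
  have fx: "f (x i) = Transposition.transpose 2 4 i" if "i < 6" for i
    using the_inv_into_f_f[OF inj, of i] that by (simp add: f_def)
  have "bij_betw f S {..<6}"
  proof (rule bij_betw_byWitness[where f' = "\<lambda>i. x (Transposition.transpose 2 4 i)"])
    show "\<forall>u\<in>S. x (Transposition.transpose 2 4 (f u)) = u" "f ` S \<subseteq> {..<6}" by (auto simp: S fx \<tau>_less)
    show "\<forall>i\<in>{..<6}. f (x (Transposition.transpose 2 4 i)) = i" "(\<lambda>i. x (Transposition.transpose 2 4 i)) ` {..<6} \<subseteq> S"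
      using \<tau>_less by (auto simp: S fx)
  qed
  moreover have "{u, v} \<in> edges G \<longleftrightarrow> {f u, f v} \<in> edges F2" if "u \<in> S" "v \<in> S" for u v
    using that a by (auto simp: S fx edges_F2 \<tau>_less adj_def)
  ultimately show "isomorphic (induced_subgraph G S) F2"
    unfolding isomorphic_def is_isomorphism_def induced_subgraph_def F2v by (intro exI[of _ f]) auto
qed

lemma ind_density_F2:
  assumes "simple_graph G"
  shows "ind_density F2 G = 60 * real (card (injective_copies (verts G) (adj G))) / (720 * real (num_verts G choose 6))"
proof -
  let ?T = "injective_copies (verts G) (adj G)"
  let ?S = "{S. S \<subseteq> verts G \<and> card S = 6 \<and> isomorphic (induced_subgraph G S) F2}"
  have fin: "finite ?T" using finite_copies[OF finite_verts[OF assms]] by (simp add: injective_copies_def)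
  have "?S = (\<lambda>x. x ` {..<6}) ` ?T"
  proof (intro equalityI subsetI)
    fix S assume "S \<in> ?S"
    then show "S \<in> (\<lambda>x. x ` {..<6}) ` ?T" using isomorphic_F2_iff[of S G] by blast
  next
    fix S assume "S \<in> (\<lambda>x. x ` {..<6}) ` ?T"
    then obtain x where x: "x \<in> ?T" "S = x ` {..<6}" by blast
    then have "S \<subseteq> verts G" "card S = 6" by (auto simp: injective_copies_def copies_def card_image)
    then show "S \<in> ?S" using isomorphic_F2_iff[of S G] x by blast
  qed
  then have "card ?T = (\<Sum>S\<in>?S. card {x \<in> ?T. x ` {..<6} = S})"
    using sum.image_gen[OF fin, of "\<lambda>_. 1 :: nat" "\<lambda>x. x ` {..<6}"] by (simp only: card_eq_sum)
  also have "\<dots> = (\<Sum>S\<in>?S. 12)"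
    using card_copies_on_set \<open>?S = _\<close> by (intro sum.cong refl) auto
  finally have "card ?T = 12 * card ?S" by simp
  moreover have "num_verts F2 = 6" by (simp add: num_verts_def F2_def mk_pattern_def)
  ultimately show ?thesis by (simp add: ind_density_def)
qed

section \<open>Tuples with constraints\<close>

text \<open>
  Tuples that are determined by a datum in \<open>W\<close> and by their entries at the positions in \<open>J\<close> are few.
\<close>

lemma card_determined_le:
  assumes "finite V" "finite W" "J \<subseteq> I" "finite I" "A \<subseteq> PiE I (\<lambda>_. V)" "\<And>x. x \<in> A \<Longrightarrow> g x \<in> W"
    and det: "\<And>x y. x \<in> A \<Longrightarrow> y \<in> A \<Longrightarrow> g x = g y \<Longrightarrow> (\<And>j. j \<in> J \<Longrightarrow> x j = y j) \<Longrightarrow> x = y"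
  shows "card A \<le> card W * card V ^ card J"
proof -
  have finJ: "finite J" using assms(3,4) by (rule finite_subset)
  have "card A \<le> card (W \<times> PiE J (\<lambda>_. V))"
  proof (rule card_inj_on_le[where f = "\<lambda>x. (g x, restrict x J)"])
    show "inj_on (\<lambda>x. (g x, restrict x J)) A"
    proof (rule inj_onI)
      fix x y assume *: "x \<in> A" "y \<in> A" "(g x, restrict x J) = (g y, restrict y J)"
      then have "x j = y j" if "j \<in> J" for j using that by (metis Pair_inject restrict_apply')
      then show "x = y" using * det by blast
    qed
    show "(\<lambda>x. (g x, restrict x J)) ` A \<subseteq> W \<times> PiE J (\<lambda>_. V)"
      using assms(3,5,6) by (fastforce simp: PiE_iff)
    show "finite (W \<times> PiE J (\<lambda>_. V))" using assms(1,2) finJ by (auto intro: finite_PiE)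
  qed
  then show ?thesis using finJ by (simp add: card_cartesian_product card_PiE)
qed

lemma finite_tuples_with: "finite V \<Longrightarrow> finite {x \<in> PiE {..<6 :: nat} (\<lambda>_. V). P x}"
  by (rule finite_Collect_conjI, rule disjI1) (simp add: finite_PiE)

lemma card_equal_entries_le:
  assumes "finite V" "k < (6 :: nat)" "l < 6" "k \<noteq> l"
  shows "card {x \<in> PiE {..<6} (\<lambda>_. V). x k = x l} \<le> card V ^ 5"
proof -
  have "card {x \<in> PiE {..<6} (\<lambda>_. V). x k = x l} \<le> card {()} * card V ^ card ({..<6} - {l})"
  proof (rule card_determined_le[where g = "\<lambda>_. ()" and I = "{..<6}"])
    fix x y assume *: "x \<in> {x \<in> PiE {..<6} (\<lambda>_. V). x k = x l}" "y \<in> {x \<in> PiE {..<6} (\<lambda>_. V). x k = x l}"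
      and eq: "\<And>j. j \<in> {..<6} - {l} \<Longrightarrow> x j = y j"
    show "x = y"
      by (rule PiE_ext[of _ "{..<6}" "\<lambda>_. V"]) (use * eq assms in \<open>force\<close>)+
  qed (use assms in auto)
  then show ?thesis using assms by simp
qed

lemma card_touching_le:
  assumes "finite V" "finite W" "i < (6 :: nat)" "j < 6" "i \<noteq> j"
  shows "card {x \<in> PiE {..<6} (\<lambda>_. V). (x i, x j) \<in> W} \<le> card W * card V ^ 4"
proof -
  have "card {x \<in> PiE {..<6} (\<lambda>_. V). (x i, x j) \<in> W} \<le> card W * card V ^ card ({..<6} - {i, j})"
  proof (rule card_determined_le[where g = "\<lambda>x. (x i, x j)" and I = "{..<6}"])
    fix x y assume *: "x \<in> {x \<in> PiE {..<6} (\<lambda>_. V). (x i, x j) \<in> W}" "y \<in> {x \<in> PiE {..<6} (\<lambda>_. V). (x i, x j) \<in> W}"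
      and eq: "(x i, x j) = (y i, y j)" "\<And>l. l \<in> {..<6} - {i, j} \<Longrightarrow> x l = y l"
    show "x = y"
      by (rule PiE_ext[of _ "{..<6}" "\<lambda>_. V"]) (use * eq in \<open>force\<close>)+
  qed (use assms in auto)
  moreover have "card ({..<6} - {i, j}) = 4"
    using assms by (subst card_Diff_subset) auto
  ultimately show ?thesis by simp
qed

lemma card_touching_equal_le:
  assumes "finite V" "finite W" "\<And>v. (v, v) \<notin> W" "i < (6 :: nat)" "j < 6" "i \<noteq> j" "k < 6" "l < 6" "k \<noteq> l"
  shows "card {x \<in> PiE {..<6} (\<lambda>_. V). (x i, x j) \<in> W \<and> x k = x l} \<le> card W * card V ^ 3"
proof (cases "{k, l} = {i, j}")
  case True
  then have "{x \<in> PiE {..<6} (\<lambda>_. V). (x i, x j) \<in> W \<and> x k = x l} = {}"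
    using assms(3) by (auto simp: doubleton_eq_iff)
  then show ?thesis by (simp only: card.empty zero_le)
next
  case False
  let ?A = "{x \<in> PiE {..<6} (\<lambda>_. V). (x i, x j) \<in> W \<and> x k = x l}"
  obtain m m' where m: "m \<notin> {i, j}" "m < 6" "m' < 6" "m' \<noteq> m" and mm: "\<And>x. x \<in> ?A \<Longrightarrow> x m = x m'"
  proof (cases "k \<in> {i, j}")
    case True
    then have "l \<notin> {i, j}" using False assms(9) by auto
    then show ?thesis using that[of l k] assms(7-9) by simp
  next
    case k: False
    then show ?thesis using that[of k l] assms(7-9) by simp
  qed
  have "card ?A \<le> card W * card V ^ card ({..<6} - {i, j, m})"
  proof (rule card_determined_le[where g = "\<lambda>x. (x i, x j)" and I = "{..<6}"])
    fix x y assume *: "x \<in> ?A" "y \<in> ?A"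
      and eq: "(x i, x j) = (y i, y j)" "\<And>l. l \<in> {..<6} - {i, j, m} \<Longrightarrow> x l = y l"
    have ne: "x l = y l" if "l < 6" "l \<noteq> m" for l
      using eq(1) eq(2)[of l] that by auto
    then have "x m = y m" using mm[OF *(1)] mm[OF *(2)] m by simp
    with ne show "x = y"
      by (intro PiE_ext[of x "{..<6}" "\<lambda>_. V"]) (use * in blast)+
  qed (use assms in auto)
  moreover have "card ({..<6} - {i, j, m}) = 3"
    using assms m by (subst card_Diff_subset) auto
  ultimately show ?thesis by simp
qed

lemma card_UN_pairs_le:
  assumes "finite X" "A \<subseteq> (\<Union>p\<in>X. B p)" "\<And>p. p \<in> X \<Longrightarrow> card (B p) \<le> m" "\<And>p. p \<in> X \<Longrightarrow> finite (B p)" "card X \<le> N"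
  shows "card A \<le> N * m"
proof -
  have "card A \<le> card (\<Union>p\<in>X. B p)" using assms by (intro card_mono) auto
  also have "\<dots> \<le> (\<Sum>p\<in>X. card (B p))" using assms(1) by (rule card_UN_le)
  also have "\<dots> \<le> (\<Sum>p\<in>X. m)" using assms(3) by (rule sum_mono)
  also have "\<dots> \<le> N * m" using assms(5) by simp
  finally show ?thesis .
qed

definition distinct_pairs :: "(nat \<times> nat) set" where
  "distinct_pairs = {(i, j). i < 6 \<and> j < 6 \<and> i \<noteq> j}"

lemma distinct_pairs: "finite distinct_pairs" "card distinct_pairs \<le> 36"
proof -
  have sub: "distinct_pairs \<subseteq> {..<6} \<times> {..<6}" by (auto simp: distinct_pairs_def)
  then show "finite distinct_pairs" by (rule finite_subset) simp
  show "card distinct_pairs \<le> 36" using card_mono[OF _ sub] by simp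
qed

lemma card_non_injective_le:
  assumes "finite V"
  shows "card (copies V E - injective_copies V E) \<le> 36 * card V ^ 5"
proof (rule card_UN_pairs_le[OF distinct_pairs(1), where B = "\<lambda>(k, l). {x \<in> PiE {..<6 :: nat} (\<lambda>_. V). x k = x l}"])
  show "copies V E - injective_copies V E \<subseteq> (\<Union>p\<in>distinct_pairs. case p of (k, l) \<Rightarrow> {x \<in> PiE {..<6 :: nat} (\<lambda>_. V). x k = x l})"
    by (fastforce simp: copies_def injective_copies_def distinct_pairs_def inj_on_def)
  show "card (case p of (k, l) \<Rightarrow> {x \<in> PiE {..<6 :: nat} (\<lambda>_. V). x k = x l}) \<le> card V ^ 5" if "p \<in> distinct_pairs" for p
    using that card_equal_entries_le[OF assms] by (auto simp: distinct_pairs_def)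
  show "finite (case p of (k, l) \<Rightarrow> {x \<in> PiE {..<6 :: nat} (\<lambda>_. V). x k = x l})" for p
    using assms by (cases p) (simp add: finite_tuples_with)
qed (rule distinct_pairs(2))

text \<open>
  Tuples with two entries at distinct positions that form a pair in \<open>W\<close>: only these distinguish two graphs that
  differ on \<open>W\<close>.
\<close>

definition touching :: "'a set \<Rightarrow> ('a \<times> 'a) set \<Rightarrow> (nat \<Rightarrow> 'a) set" where
  "touching V W = {x \<in> PiE {..<6 :: nat} (\<lambda>_. V). \<exists>i<6. \<exists>j<6. i \<noteq> j \<and> (x i, x j) \<in> W}"

lemma finite_touching: "finite V \<Longrightarrow> finite (touching V W)"
  unfolding touching_def by (rule finite_Collect_conjI, rule disjI1) (auto simp: finite_PiE)

lemma card_all_touching_le: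
  assumes "finite V" "finite W"
  shows "card (touching V W) \<le> 36 * (card W * card V ^ 4)"
proof (rule card_UN_pairs_le[OF distinct_pairs(1), where B = "\<lambda>(i, j). {x \<in> PiE {..<6 :: nat} (\<lambda>_. V). (x i, x j) \<in> W}"])
  show "touching V W \<subseteq> (\<Union>p\<in>distinct_pairs. case p of (i, j) \<Rightarrow> {x \<in> PiE {..<6 :: nat} (\<lambda>_. V). (x i, x j) \<in> W})"
    by (fastforce simp: touching_def distinct_pairs_def)
  show "card (case p of (i, j) \<Rightarrow> {x \<in> PiE {..<6 :: nat} (\<lambda>_. V). (x i, x j) \<in> W}) \<le> card W * card V ^ 4" if "p \<in> distinct_pairs" for p
    using that card_touching_le[OF assms] by (auto simp: distinct_pairs_def)
  show "finite (case p of (i, j) \<Rightarrow> {x \<in> PiE {..<6 :: nat} (\<lambda>_. V). (x i, x j) \<in> W})" for p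
    using assms by (cases p) (simp add: finite_tuples_with)
qed (rule distinct_pairs(2))

text \<open>
  One factor of the order is gained over all touching tuples. This refinement keeps the comparison of densities
  below linear in the number of wrong pairs, however small that number is.
\<close>

lemma card_non_injective_touching_le:
  assumes "finite V" "finite W" "\<And>v. (v, v) \<notin> W"
  shows "card {x \<in> touching V W. \<not> inj_on x {..<6}} \<le> 1296 * (card W * card V ^ 3)"
proof -
  define B where "B p = {x \<in> PiE {..<6 :: nat} (\<lambda>_. V). (x (fst (fst p)), x (snd (fst p))) \<in> W \<and> x (fst (snd p)) = x (snd (snd p))}"
    for p :: "(nat \<times> nat) \<times> (nat \<times> nat)"
  show ?thesis
  proof (rule card_UN_pairs_le[where X = "distinct_pairs \<times> distinct_pairs" and B = B])
    show "finite (distinct_pairs \<times> distinct_pairs)" using distinct_pairs by simp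
    show "card (distinct_pairs \<times> distinct_pairs) \<le> 1296"
      using mult_mono[OF distinct_pairs(2) distinct_pairs(2)] by (simp add: card_cartesian_product)
    show "{x \<in> touching V W. \<not> inj_on x {..<6}} \<subseteq> (\<Union>p\<in>distinct_pairs \<times> distinct_pairs. B p)"
    proof
      fix x assume x: "x \<in> {x \<in> touching V W. \<not> inj_on x {..<6}}"
      then obtain i j k l where "(i, j) \<in> distinct_pairs" "(k, l) \<in> distinct_pairs" "(x i, x j) \<in> W" "x k = x l"
        by (auto simp: touching_def distinct_pairs_def inj_on_def)
      then show "x \<in> (\<Union>p\<in>distinct_pairs \<times> distinct_pairs. B p)"
        using x by (intro UN_I[of "((i, j), (k, l))"]) (auto simp: touching_def B_def)
    qed
    show "card (B p) \<le> card W * card V ^ 3" if "p \<in> distinct_pairs \<times> distinct_pairs" for p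
      unfolding B_def using that by (intro card_touching_equal_le assms) (auto simp: distinct_pairs_def)
    show "finite (B p)" for p
      unfolding B_def by (rule finite_tuples_with[OF assms(1)])
  qed
qed

section \<open>Densities of blowups\<close>

definition part_weight :: "'a set \<Rightarrow> ('a \<Rightarrow> real) \<Rightarrow> ('a \<Rightarrow> nat) \<Rightarrow> nat \<Rightarrow> real" where
  "part_weight V \<mu> c i = (\<Sum>v\<in>{v \<in> V. c v = i}. \<mu> v)"

lemma simple_base_adj: "simple_rel base_adj"
  using base_adj_simple[of id] by simp

lemma (in weighted_graph) part_weight_nonneg: "0 \<le> part_weight V \<mu> c i"
  unfolding part_weight_def by (intro sum_nonneg) (auto intro: \<mu>_nonneg)

lemma sum_over_parts:
  assumes "finite V" "\<And>v. v \<in> V \<Longrightarrow> c v < 5"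
  shows "(\<Sum>v\<in>V. \<mu> v * g (c v)) = (\<Sum>i<5. part_weight V \<mu> c i * g i)"
proof -
  have "(\<Sum>v\<in>V. \<mu> v * g (c v)) = (\<Sum>i<5. \<Sum>v\<in>{v \<in> V. c v = i}. \<mu> v * g (c v))"
    by (rule sum.group[symmetric]) (use assms in auto)
  then show ?thesis by (simp add: part_weight_def sum_distrib_right)
qed

text \<open>
  A sum that depends only on the parts of the entries is a sum over the pattern, with the weights of the parts.
\<close>

lemma wsum_over_parts:
  assumes "weighted_graph V \<mu> E" and c: "\<And>v. v \<in> V \<Longrightarrow> c v < 5"
    and "\<And>y y'. (\<And>i. i < n \<Longrightarrow> y i = y' i) \<Longrightarrow> \<phi> y = \<phi> y'"
  shows "weighted_graph.wsum V \<mu> n (\<lambda>x. \<phi> (\<lambda>i. c (x i))) = weighted_graph.wsum {..<5} (part_weight V \<mu> c) n \<phi>"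
  using assms(3)
proof (induction n arbitrary: \<phi>)
  case 0
  interpret K: weighted_graph V \<mu> E by fact
  interpret Q: weighted_graph "{..<5}" "part_weight V \<mu> c" base_adj
    by unfold_locales (auto simp: K.part_weight_nonneg simple_base_adj)
  show ?case unfolding K.wsum_0 Q.wsum_0 by (rule 0) simp
next
  case (Suc n)
  interpret K: weighted_graph V \<mu> E by fact
  interpret Q: weighted_graph "{..<5}" "part_weight V \<mu> c" base_adj
    by unfold_locales (auto simp: K.part_weight_nonneg simple_base_adj)
  have "K.wsum n (\<lambda>x. \<phi> (\<lambda>i. c ((x(n := v)) i))) = Q.wsum n (\<lambda>y. \<phi> (y(n := c v)))" for v
  proof -
    have "(\<lambda>i. c ((x(n := v)) i)) = (\<lambda>i. c (x i))(n := c v)" for x by auto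
    then have "K.wsum n (\<lambda>x. \<phi> (\<lambda>i. c ((x(n := v)) i))) = K.wsum n (\<lambda>x. \<phi> ((\<lambda>i. c (x i))(n := c v)))"
      by simp
    also have "\<dots> = Q.wsum n (\<lambda>y. \<phi> (y(n := c v)))"
      by (rule Suc.IH) (auto intro: Suc.prems)
    finally show ?thesis .
  qed
  then show ?case
    unfolding K.wsum_Suc Q.wsum_Suc
    by (simp add: sum_over_parts[OF K.finite_V c, where g = "\<lambda>k. Q.wsum n (\<lambda>y. \<phi> (y(n := k)))"])
qed

lemma reversal_permutes: "(\<lambda>i. if i < 6 then 5 - i else i) permutes {..<6 :: nat}"
  by (rule bij_imp_permutes, rule bij_betw_byWitness[where f' = "\<lambda>i. 5 - i"]) auto

lemma (in weighted_graph) target_sum_nested: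
  "target_sum = (\<Sum>a\<in>V. \<mu> a * (\<Sum>b\<in>V. \<mu> b * (\<Sum>c\<in>V. \<mu> c * (\<Sum>d\<in>V. \<mu> d * (\<Sum>e\<in>V. \<mu> e * (\<Sum>f\<in>V. \<mu> f * of_bool (target_at a b c d e f)))))))"
proof -
  have "target_sum = wsum 6 (\<lambda>x. of_bool (target_at (x 5) (x 4) (x 3) (x 2) (x 1) (x 0)))"
    unfolding target_sum_def
    using wsum_permute[OF reversal_permutes, of "\<lambda>x. of_bool (target_at (x 0) (x 1) (x 2) (x 3) (x 4) (x 5))"] by simp
  also have "\<dots> = (\<Sum>a\<in>V. \<mu> a * (\<Sum>b\<in>V. \<mu> b * (\<Sum>c\<in>V. \<mu> c * (\<Sum>d\<in>V. \<mu> d * (\<Sum>e\<in>V. \<mu> e * (\<Sum>f\<in>V. \<mu> f * of_bool (target_at a b c d e f)))))))"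
    by (simp add: numeral_eq_Suc wsum_Suc wsum_0)
  finally show ?thesis .
qed

lemma sum_less_5: "(\<Sum>i<5. f i) = f 0 + f 1 + f 2 + f 3 + f (4 :: nat)" for f :: "nat \<Rightarrow> real"
  by (simp add: numeral_eq_Suc)

lemma base_adj_eval:
  "base_adj 0 0 = False"
    "base_adj 0 1 = True"
    "base_adj 0 2 = False"
    "base_adj 0 3 = False"
    "base_adj 0 4 = False"
    "base_adj 1 0 = True"
    "base_adj 1 1 = False"
    "base_adj 1 2 = False"
    "base_adj 1 3 = False"
    "base_adj 1 4 = False"
    "base_adj 2 0 = False"
    "base_adj 2 1 = False"
    "base_adj 2 2 = False"
    "base_adj 2 3 = True"
    "base_adj 2 4 = False"
    "base_adj 3 0 = False"
    "base_adj 3 1 = False"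
    "base_adj 3 2 = True"
    "base_adj 3 3 = False"
    "base_adj 3 4 = False"
    "base_adj 4 0 = False"
    "base_adj 4 1 = False"
    "base_adj 4 2 = False"
    "base_adj 4 3 = False"
    "base_adj 4 4 = False"
  by (simp_all add: base_adj_def)

text \<open>
  The sums over the three isolated vertices are evaluated by inclusion and exclusion.
\<close>

lemma base_target_sum:
  assumes "\<And>i. 0 \<le> w i"
  shows "60 * weighted_graph.target_sum {..<5} w base_adj = blowup_poly w"
proof -
  interpret Q: weighted_graph "{..<5}" w base_adj
    by unfold_locales (auto simp: assms simple_base_adj)
  define H where "H a b c = (\<Sum>d<5. w d * (\<Sum>e<5. w e * (\<Sum>f<5. w f * of_bool (Q.target_at a b c d e f))))" for a b c
  \<comment> \<open>three isolated vertices avoid one of the two vertices of the other pair, by inclusion and exclusion\<close>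
  have cube: "(\<Sum>d<5. w d * (\<Sum>e<5. w e * (\<Sum>f<5. w f * (g d * g e * g f)))) = (\<Sum>d<5. w d * g d) ^ 3" for g :: "nat \<Rightarrow> real"
  proof -
    have "(\<Sum>f<5. w f * (g d * g e * g f)) = g d * g e * (\<Sum>f<5. w f * g f)" for d e
      by (simp add: sum_distrib_left mult_ac)
    moreover have "(\<Sum>e<5. w e * (g d * g e * G)) = g d * G * (\<Sum>e<5. w e * g e)" for d G
      by (simp add: sum_distrib_left mult_ac)
    moreover have "(\<Sum>d<5. w d * (g d * G * K)) = G * K * (\<Sum>d<5. w d * g d)" for G K
      by (simp add: sum_distrib_left mult_ac)
    ultimately show ?thesis by (simp add: power3_eq_cube)
  qed
  have inclusion_exclusion: "H a b c = (w p + w 4) ^ 3 + (w q + w 4) ^ 3 - w 4 ^ 3"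
    if pq: "(p, q) = (0, 1) \<or> (p, q) = (2, 3)"
      and at: "\<And>d e f. d < 5 \<Longrightarrow> e < 5 \<Longrightarrow> f < 5 \<Longrightarrow> Q.target_at a b c d e f \<longleftrightarrow> {d, e, f} \<subseteq> {p, 4} \<or> {d, e, f} \<subseteq> {q, 4}" for a b c p q
  proof -
    let ?g = "\<lambda>p d. of_bool (d = p \<or> d = 4) :: real"
    have ne: "p \<noteq> q" "p \<noteq> 4" "q \<noteq> 4" using pq by auto
    have "of_bool (Q.target_at a b c d e f) = ?g p d * ?g p e * ?g p f + ?g q d * ?g q e * ?g q f - ?g 4 d * ?g 4 e * ?g 4 f"
      if "d < 5" "e < 5" "f < 5" for d e f
      unfolding at[OF that] using ne by (auto simp: of_bool_def)
    then have "H a b c = (\<Sum>d<5. w d * (\<Sum>e<5. w e * (\<Sum>f<5. w f * (?g p d * ?g p e * ?g p f + ?g q d * ?g q e * ?g q f - ?g 4 d * ?g 4 e * ?g 4 f))))"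
      unfolding H_def by (intro sum.cong refl arg_cong2[where f = "(*)"]) simp
    also have "\<dots> = (\<Sum>d<5. w d * ?g p d) ^ 3 + (\<Sum>d<5. w d * ?g q d) ^ 3 - (\<Sum>d<5. w d * ?g 4 d) ^ 3"
      unfolding cube[symmetric] by (simp only: distrib_left right_diff_distrib sum.distrib sum_subtractf)
    also have "\<dots> = (w p + w 4) ^ 3 + (w q + w 4) ^ 3 - w 4 ^ 3"
      using pq by (auto simp: sum_less_5)
    finally show ?thesis .
  qed
  have at:
    "Q.target_at 0 1 1 d e f \<longleftrightarrow> {d, e, f} \<subseteq> {2, 4} \<or> {d, e, f} \<subseteq> {3, 4}"
    "Q.target_at 1 0 0 d e f \<longleftrightarrow> {d, e, f} \<subseteq> {2, 4} \<or> {d, e, f} \<subseteq> {3, 4}"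
    "Q.target_at 2 3 3 d e f \<longleftrightarrow> {d, e, f} \<subseteq> {0, 4} \<or> {d, e, f} \<subseteq> {1, 4}"
    "Q.target_at 3 2 2 d e f \<longleftrightarrow> {d, e, f} \<subseteq> {0, 4} \<or> {d, e, f} \<subseteq> {1, 4}"
    if "d < 5" "e < 5" "f < 5" for d e f
    using that[THEN less_5_cases] by (elim disjE; simp add: Q.target_at_def base_adj_eval[simplified])+
  have H: "H 0 1 1 = (w 2 + w 4) ^ 3 + (w 3 + w 4) ^ 3 - w 4 ^ 3" "H 1 0 0 = (w 2 + w 4) ^ 3 + (w 3 + w 4) ^ 3 - w 4 ^ 3"
    "H 2 3 3 = (w 0 + w 4) ^ 3 + (w 1 + w 4) ^ 3 - w 4 ^ 3" "H 3 2 2 = (w 0 + w 4) ^ 3 + (w 1 + w 4) ^ 3 - w 4 ^ 3"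
    by (intro inclusion_exclusion at; simp)+
  have H0: "H a b c = 0" if "\<not> base_adj a b \<or> \<not> base_adj a c" for a b c
  proof -
    have "\<not> Q.target_at a b c d e f" for d e f using that unfolding Q.target_at_def by blast
    then show ?thesis by (simp add: H_def)
  qed
  have "Q.target_sum = (\<Sum>a<5. w a * (\<Sum>b<5. w b * (\<Sum>c<5. w c * H a b c)))"
    unfolding Q.target_sum_nested H_def ..
  also have "\<dots> = w 0 * (w 1 * (w 1 * H 0 1 1)) + w 1 * (w 0 * (w 0 * H 1 0 0)) + w 2 * (w 3 * (w 3 * H 2 3 3)) + w 3 * (w 2 * (w 2 * H 3 2 2))"
    unfolding sum_less_5 by (simp add: H0 base_adj_eval[simplified])
  finally show ?thesis
    unfolding H blowup_poly_def by (simp add: algebra_simps power_numeral_reduce)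
qed

lemma target_sum_colouring:
  assumes "weighted_graph V \<mu> E" "\<And>v. v \<in> V \<Longrightarrow> c v < 5"
  shows "60 * weighted_graph.target_sum V \<mu> (\<lambda>u v. base_adj (c u) (c v)) = blowup_poly (part_weight V \<mu> c)"
proof -
  interpret G: weighted_graph V \<mu> E by fact
  interpret K: weighted_graph V \<mu> "\<lambda>u v. base_adj (c u) (c v)"
    by unfold_locales (auto simp: G.finite_V G.\<mu>_nonneg base_adj_simple)
  interpret Q: weighted_graph "{..<5}" "part_weight V \<mu> c" base_adj
    by unfold_locales (auto simp: G.part_weight_nonneg simple_base_adj)
  have "K.target_sum = K.wsum 6 (\<lambda>x. of_bool (Q.target_at (c (x 0)) (c (x 1)) (c (x 2)) (c (x 3)) (c (x 4)) (c (x 5))))"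
    unfolding K.target_sum_def K.target_at_def Q.target_at_def ..
  also have "\<dots> = Q.target_sum"
    unfolding Q.target_sum_def
    by (rule wsum_over_parts[OF K.weighted_graph_axioms assms(2),
          where n = 6 and \<phi> = "\<lambda>y. of_bool (Q.target_at (y 0) (y 1) (y 2) (y 3) (y 4) (y 5))"]) auto
  finally show ?thesis using base_target_sum[OF G.part_weight_nonneg] by simp
qed

lemma unweighted: "finite V \<Longrightarrow> simple_rel E \<Longrightarrow> weighted_graph V (\<lambda>_. 1) E"
  by unfold_locales auto

lemma unweighted_target_sum:
  assumes "finite V" "simple_rel E"
  shows "weighted_graph.target_sum V (\<lambda>_. 1) E = real (card (copies V E))"
  using weighted_graph.target_sum_copies[OF unweighted[OF assms]] by simp

lemma copies_colouring:
  assumes "finite V" "\<And>v. v \<in> V \<Longrightarrow> c v < 5"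
  shows "60 * real (card (copies V (\<lambda>u v. base_adj (c u) (c v)))) = blowup_poly (\<lambda>i. real (card {v \<in> V. c v = i}))"
proof -
  have "part_weight V (\<lambda>_. 1) c = (\<lambda>i. real (card {v \<in> V. c v = i}))"
    by (simp add: part_weight_def fun_eq_iff)
  then show ?thesis
    using target_sum_colouring[where c = c, OF unweighted[OF assms(1) base_adj_simple[of c]] assms(2)]
      unweighted_target_sum[OF assms(1) base_adj_simple[of c]] by simp
qed

lemma copies_cong:
  assumes "\<And>u v. u \<in> V \<Longrightarrow> v \<in> V \<Longrightarrow> E u v = E' u v"
  shows "copies V E = copies V E'"
  using assms by (fastforce simp: copies_def PiE_iff)

lemma edges_B_F2: "i < 5 \<Longrightarrow> j < 5 \<Longrightarrow> {i, j} \<in> edges B_F2 \<longleftrightarrow> base_adj i j"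
  by (auto simp: B_F2_def mk_pattern_def base_adj_def doubleton_eq_iff)

lemma verts_B_F2: "verts B_F2 = {..<5}"
  by (auto simp: B_F2_def mk_pattern_def)

text \<open>
  The map that sends a vertex to its part.
\<close>

lemma colouring_of_blowup:
  assumes "blowup_parts B_F2 U"
  shows "\<exists>c. (\<forall>v\<in>verts (blowup B_F2 U). c v < 5) \<and> (\<forall>i<5. {v \<in> verts (blowup B_F2 U). c v = i} = U i) \<and>
    (\<forall>u\<in>verts (blowup B_F2 U). \<forall>v\<in>verts (blowup B_F2 U). adj (blowup B_F2 U) u v = base_adj (c u) (c v))"
proof -
  define c where "c v = (SOME i. i < 5 \<and> v \<in> U i)" for v
  have vs: "verts (blowup B_F2 U) = (\<Union>i<5. U i)" by (simp add: blowup_def verts_B_F2)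
  have disj: "i = j" if "v \<in> U i" "v \<in> U j" "i < 5" "j < 5" for v i j
    using assms that unfolding blowup_parts_def verts_B_F2 disjoint_family_on_def by blast
  have c: "c v < 5" "v \<in> U (c v)" if "v \<in> verts (blowup B_F2 U)" for v
    using someI_ex[of "\<lambda>i. i < 5 \<and> v \<in> U i"] that by (auto simp: c_def vs)
  have c_eq: "c v = i" if "v \<in> U i" "i < 5" for v i
    using disj[OF that(1) c(2) that(2) c(1)] that by (auto simp: vs)
  show ?thesis
  proof (intro exI[of _ c] conjI ballI allI impI)
    show "{v \<in> verts (blowup B_F2 U). c v = i} = U i" if "i < 5" for i
      using that c c_eq by (auto simp: vs)
    show "adj (blowup B_F2 U) u v = base_adj (c u) (c v)" if uv: "u \<in> verts (blowup B_F2 U)" "v \<in> verts (blowup B_F2 U)" for u v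
    proof
      assume "adj (blowup B_F2 U) u v"
      then obtain x y i j where *: "{u, v} = {x, y}" "i < 5" "j < 5" "x \<in> U i" "y \<in> U j" "{i, j} \<in> edges B_F2"
        by (auto simp: adj_def blowup_def verts_B_F2)
      then have "base_adj (c x) (c y)" using edges_B_F2[of i j] c_eq[of x i] c_eq[of y j] by simp
      then show "base_adj (c u) (c v)" using *(1) by (auto simp: doubleton_eq_iff base_adj_def)
    next
      assume b: "base_adj (c u) (c v)"
      then have "u \<noteq> v" by (auto simp: base_adj_def)
      then show "adj (blowup B_F2 U) u v"
        using b c[OF uv(1)] c[OF uv(2)] edges_B_F2[of "c u" "c v"] unfolding adj_def blowup_def verts_B_F2 by auto
    qed
  qed (rule c)
qed

lemma simple_blowup:
  assumes "blowup_parts B_F2 U"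
  shows "simple_graph (blowup B_F2 U)" "num_verts (blowup B_F2 U) = (\<Sum>i<5. card (U i))"
proof -
  have fin: "finite (U i)" if "i < 5" for i using assms that by (auto simp: blowup_parts_def verts_B_F2)
  then show "simple_graph (blowup B_F2 U)"
    unfolding simple_graph_def wf_pattern_def blowup_def verts_B_F2 by (auto simp: doubleton_eq_iff)
  show "num_verts (blowup B_F2 U) = (\<Sum>i<5. card (U i))"
    unfolding num_verts_def blowup_def verts_B_F2 pattern.simps
    by (rule card_UN_disjoint) (use assms fin in \<open>auto simp: blowup_parts_def verts_B_F2 disjoint_family_on_def\<close>)
qed

lemma copies_blowup:
  assumes "blowup_parts B_F2 U"
  shows "60 * real (card (copies (verts (blowup B_F2 U)) (adj (blowup B_F2 U)))) = blowup_poly (\<lambda>i. real (card (U i)))"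
proof -
  obtain c where "\<forall>v\<in>verts (blowup B_F2 U). c v < 5" "\<forall>i<5. {v \<in> verts (blowup B_F2 U). c v = i} = U i"
    "\<forall>u\<in>verts (blowup B_F2 U). \<forall>v\<in>verts (blowup B_F2 U). adj (blowup B_F2 U) u v = base_adj (c u) (c v)"
    using colouring_of_blowup[OF assms] by blast
  note c = this[rule_format]
  have "60 * real (card (copies (verts (blowup B_F2 U)) (adj (blowup B_F2 U))))
      = blowup_poly (\<lambda>i. real (card {v \<in> verts (blowup B_F2 U). c v = i}))"
    using copies_cong[of "verts (blowup B_F2 U)" "adj (blowup B_F2 U)" "\<lambda>u v. base_adj (c u) (c v)"] c(3)
      copies_colouring[of "verts (blowup B_F2 U)" c] finite_verts[OF simple_blowup(1)[OF assms]] c(1) by simp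
  also have "\<dots> = blowup_poly (\<lambda>i. real (card (U i)))"
    by (simp add: blowup_poly_def c(2))
  finally show ?thesis .
qed

section \<open>The limit of the maximum density\<close>

definition ordered_choices :: "nat \<Rightarrow> real" where
  "ordered_choices n = 720 * real (n choose 6)"

lemma ordered_choices_prod: "ordered_choices n = (\<Prod>i<6. real n - real i)"
proof -
  have "ordered_choices n = fact 6 * (real n gchoose 6)"
    by (simp add: ordered_choices_def binomial_gbinomial fact_numeral)
  also have "\<dots> = (\<Prod>i<6. real n - real i)"
    by (simp add: gbinomial_mult_fact atLeast0LessThan)
  finally show ?thesis .
qed

lemma ordered_choices_pos: "6 \<le> n \<Longrightarrow> 0 < ordered_choices n"
  by (simp add: ordered_choices_def)

lemma ordered_choices_le: "ordered_choices n \<le> real n ^ 6"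
proof (cases "6 \<le> n")
  case True
  then have "(\<Prod>i<6. real n - real i) \<le> (\<Prod>i<6 :: nat. real n)" by (intro prod_mono) auto
  then show ?thesis by (simp add: ordered_choices_prod)
qed (simp add: ordered_choices_def binomial_eq_0)

lemma ind_density_eq:
  "simple_graph G \<Longrightarrow> ind_density F2 G = 60 * real (card (injective_copies (verts G) (adj G))) / ordered_choices (num_verts G)"
  using ind_density_F2 by (simp add: ordered_choices_def)

lemma injective_copies_le: "finite V \<Longrightarrow> card (injective_copies V E) \<le> card (copies V E)"
  by (intro card_mono finite_copies) (auto simp: injective_copies_def)

text \<open>
  The certificate with all weights 1, without the nonnegative last term.
\<close>

lemma copies_le:
  assumes "finite V" "simple_rel E"
  shows "60 * real (card (copies V E)) \<le> limit_value * real (card V) ^ 6"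
proof (cases "V = {}")
  case True
  have "x 0 \<in> {}" if "x \<in> copies V E" for x
    using that PiE_mem[of x "{..<6}" "\<lambda>_. V" 0] True by (simp add: copies_def)
  then have "copies V E = {}" by blast
  then show ?thesis by (simp add: True)
next
  case False
  interpret G: weighted_graph V "\<lambda>_. 1" E by (rule unweighted[OF assms])
  have n: "0 < real (card V)" using False assms(1) by (simp add: card_gt_0_iff)
  have "0 \<le> G.wsum 7 (\<lambda>x. of_bool (\<not> colourable 7 (G.pull x)))" by (intro G.wsum_nonneg) simp
  then have "18900 * (real (card V) * real (card (copies V E))) \<le> 315 * limit_value * real (card V) ^ 7"
    using G.certificate unfolding unweighted_target_sum[OF assms] G.mass_def by simp
  then have "real (card V) * (60 * real (card (copies V E))) \<le> real (card V) * (limit_value * real (card V) ^ 6)"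
    by (simp add: power_numeral_reduce algebra_simps)
  then show ?thesis using n by (simp only: mult_le_cancel_left_pos)
qed

lemma ind_density_le:
  assumes "simple_graph G" "60 * real (card (copies (verts G) (adj G))) \<le> l * real (num_verts G) ^ 6"
  shows "ind_density F2 G \<le> l * (real (num_verts G) ^ 6 / ordered_choices (num_verts G))"
proof -
  have "60 * real (card (injective_copies (verts G) (adj G))) \<le> l * real (num_verts G) ^ 6"
    using injective_copies_le[OF finite_verts[OF assms(1)], of "adj G"] assms(2) by linarith
  moreover have "0 \<le> ordered_choices (num_verts G)" by (simp add: ordered_choices_def)
  ultimately show ?thesis
    unfolding ind_density_eq[OF assms(1)] times_divide_eq_right by (rule divide_right_mono)
qed

lemma inverse_tendsto: "(\<lambda>n. c / real n) \<longlonglongrightarrow> 0"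
  by (rule tendsto_divide_0[OF tendsto_const]) (simp add: filterlim_at_top_imp_at_infinity filterlim_real_sequentially)

lemma ordered_choices_limit:
  assumes "(\<lambda>n. real (N n) / real n) \<longlonglongrightarrow> 1"
  shows "(\<lambda>n. ordered_choices (N n) / real n ^ 6) \<longlonglongrightarrow> 1"
proof -
  have "(\<lambda>n. \<Prod>i<6. (real (N n) / real n - real i / real n)) \<longlonglongrightarrow> (\<Prod>i<6::nat. (1 - 0))"
    by (intro tendsto_prod tendsto_diff assms inverse_tendsto)
  moreover have "(\<Prod>i<6. (real (N n) / real n - real i / real n)) = ordered_choices (N n) / real n ^ 6" for n
    unfolding ordered_choices_prod by (simp add: prod_dividef flip: diff_divide_distrib)
  ultimately show ?thesis by simp
qed

lemma ratio_limit: "(\<lambda>n. real n ^ 6 / ordered_choices n) \<longlonglongrightarrow> 1"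
proof -
  have "(\<lambda>n. real n / real n) \<longlonglongrightarrow> 1"
    by (rule tendsto_eventually) (auto intro: eventually_mono[OF eventually_gt_at_top[of 0]])
  from tendsto_inverse[OF ordered_choices_limit[OF this]] show ?thesis by (simp add: field_simps)
qed

lemma blowup_poly_scale: "blowup_poly (\<lambda>i. x i / t) = blowup_poly x / t ^ 6"
proof -
  have "blowup_poly (\<lambda>i. x i * s) = blowup_poly x * s ^ 6" for s
    unfolding blowup_poly_def by algebra
  from this[of "1 / t"] show ?thesis by (simp add: power_inverse divide_inverse)
qed

text \<open>
  Tuples with repetitions are counted exactly by the homogeneous polynomial of the part sizes; the non-injective
  ones and the normalisation disappear in the limit.
\<close>

lemma blowup_density_poly:
  assumes "x \<in> std_simplex 5"
  shows "is_blowup_density F2 B_F2 x (blowup_poly x)"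
  unfolding is_blowup_density_def
proof (intro allI impI, elim conjE)
  fix U :: "nat \<Rightarrow> nat \<Rightarrow> nat set"
  assume U: "\<forall>n. blowup_parts B_F2 (U n)" and lim: "\<forall>i\<in>verts B_F2. (\<lambda>n. real (card (U n i)) / real n) \<longlonglongrightarrow> x i"
  define N where "N n = (\<Sum>i<5. card (U n i))" for n
  have lim: "(\<lambda>n. real (card (U n i)) / real n) \<longlonglongrightarrow> x i" if "i < 5" for i
    using lim that by (simp add: verts_B_F2)
  have "(\<lambda>n. \<Sum>i<5. real (card (U n i)) / real n) \<longlonglongrightarrow> (\<Sum>i<5. x i)"
    by (intro tendsto_sum lim) simp
  then have N: "(\<lambda>n. real (N n) / real n) \<longlonglongrightarrow> 1"
    using assms by (simp add: N_def std_simplex_def sum_divide_distrib)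
  define C I where "C n = real (card (copies (verts (blowup B_F2 (U n))) (adj (blowup B_F2 (U n)))))"
    and "I n = real (card (injective_copies (verts (blowup B_F2 (U n))) (adj (blowup B_F2 (U n)))))" for n
  have vs: "card (verts (blowup B_F2 (U n))) = N n" "finite (verts (blowup B_F2 (U n)))" for n
    using simple_blowup[of "U n"] U finite_verts by (auto simp: N_def num_verts_def)
  have poly: "(\<lambda>n. 60 * C n / real n ^ 6) \<longlonglongrightarrow> blowup_poly x"
  proof -
    have "(\<lambda>n. blowup_poly (\<lambda>i. real (card (U n i)) / real n)) \<longlonglongrightarrow> blowup_poly x"
      unfolding blowup_poly_def by (intro tendsto_intros lim) simp_all
    then show ?thesis unfolding blowup_poly_scale C_def using copies_blowup U by simp
  qed
  have gap: "0 \<le> 60 * C n / real n ^ 6 - 60 * I n / real n ^ 6"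
    "60 * C n / real n ^ 6 - 60 * I n / real n ^ 6 \<le> 2160 * (real (N n) / real n) ^ 5 * (1 / real n)" for n
  proof -
    let ?c = "copies (verts (blowup B_F2 (U n))) (adj (blowup B_F2 (U n)))" and ?i = "injective_copies (verts (blowup B_F2 (U n))) (adj (blowup B_F2 (U n)))"
    have "?i \<subseteq> ?c" by (auto simp: injective_copies_def)
    moreover have "finite ?c" using vs(2) by (rule finite_copies)
    ultimately have "card (?c - ?i) + card ?i = card ?c"
      by (metis card_Diff_subset card_mono finite_subset le_add_diff_inverse2)
    then have "C n - I n = real (card (?c - ?i))" unfolding C_def I_def by linarith
    moreover have "card (?c - ?i) \<le> 36 * N n ^ 5"
      using card_non_injective_le[OF vs(2)] by (simp add: vs(1))
    then have "real (card (?c - ?i)) \<le> real (36 * N n ^ 5)" by (rule of_nat_mono)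
    then have "real (card (?c - ?i)) \<le> 36 * real (N n) ^ 5" by (simp only: of_nat_mult of_nat_power of_nat_numeral)
    ultimately have CI: "0 \<le> C n - I n" "C n - I n \<le> 36 * real (N n) ^ 5" by simp_all
    have e: "60 * C n / real n ^ 6 - 60 * I n / real n ^ 6 = 60 * (C n - I n) / real n ^ 6"
      by (simp add: diff_divide_distrib right_diff_distrib)
    show "0 \<le> 60 * C n / real n ^ 6 - 60 * I n / real n ^ 6" unfolding e using CI by simp
    have "60 * (C n - I n) / real n ^ 6 \<le> 60 * (36 * real (N n) ^ 5) / real n ^ 6"
      using CI by (intro divide_right_mono mult_left_mono) auto
    also have "\<dots> = 2160 * (real (N n) / real n) ^ 5 * (1 / real n)"
      by (simp add: power_divide power_numeral_reduce)
    finally show "60 * C n / real n ^ 6 - 60 * I n / real n ^ 6 \<le> 2160 * (real (N n) / real n) ^ 5 * (1 / real n)"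
      unfolding e .
  qed
  have "(\<lambda>n. 2160 * (real (N n) / real n) ^ 5 * (1 / real n)) \<longlonglongrightarrow> 2160 * 1 ^ 5 * 0"
    by (intro tendsto_mult tendsto_power tendsto_const N inverse_tendsto)
  then have "(\<lambda>n. 2160 * (real (N n) / real n) ^ 5 * (1 / real n)) \<longlonglongrightarrow> 0" by simp
  then have "(\<lambda>n. 60 * C n / real n ^ 6 - 60 * I n / real n ^ 6) \<longlonglongrightarrow> 0"
    by (rule tendsto_sandwich[OF always_eventually always_eventually tendsto_const, rotated 2]) (use gap in blast)+
  from tendsto_diff[OF poly this] have "(\<lambda>n. 60 * I n / real n ^ 6) \<longlonglongrightarrow> blowup_poly x" by simp
  from tendsto_divide[OF this ordered_choices_limit[OF N]]
  have "(\<lambda>n. (60 * I n / real n ^ 6) / (ordered_choices (N n) / real n ^ 6)) \<longlonglongrightarrow> blowup_poly x" by simp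
  moreover have "\<forall>\<^sub>F n in sequentially. (60 * I n / real n ^ 6) / (ordered_choices (N n) / real n ^ 6) = ind_density F2 (blowup B_F2 (U n))"
    using eventually_gt_at_top[of 0]
  proof eventually_elim
    case (elim n)
    have "ind_density F2 (blowup B_F2 (U n)) = 60 * I n / ordered_choices (N n)"
      using simple_blowup[of "U n"] U by (simp add: ind_density_eq N_def I_def)
    then show ?case using elim by simp
  qed
  ultimately show "(\<lambda>n. ind_density F2 (blowup B_F2 (U n))) \<longlonglongrightarrow> blowup_poly x"
    by (rule Lim_transform_eventually)
qed

lemma floor_limit:
  fixes t :: real
  assumes "0 \<le> t"
  shows "(\<lambda>n. real (nat \<lfloor>t * real n\<rfloor>) / real n) \<longlonglongrightarrow> t"
proof (rule tendsto_sandwich[where f = "\<lambda>n. t - 1 / real n" and h = "\<lambda>_. t"])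
  have *: "real (nat \<lfloor>t * real n\<rfloor>) = of_int \<lfloor>t * real n\<rfloor>" for n using assms by simp
  show "\<forall>\<^sub>F n in sequentially. t - 1 / real n \<le> real (nat \<lfloor>t * real n\<rfloor>) / real n"
    using eventually_gt_at_top[of 0]
  proof eventually_elim
    case (elim n)
    have "t * real n - 1 \<le> real (nat \<lfloor>t * real n\<rfloor>)" unfolding * by linarith
    then have "(t * real n - 1) / real n \<le> real (nat \<lfloor>t * real n\<rfloor>) / real n" by (rule divide_right_mono) simp
    then show ?case using elim by (simp add: diff_divide_distrib)
  qed
  show "\<forall>\<^sub>F n in sequentially. real (nat \<lfloor>t * real n\<rfloor>) / real n \<le> t"
    using eventually_gt_at_top[of 0]
  proof eventually_elim
    case (elim n)
    have "real (nat \<lfloor>t * real n\<rfloor>) \<le> t * real n" unfolding * by linarith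
    then show ?case using elim by (simp add: field_simps)
  qed
  show "(\<lambda>n. t - 1 / real n) \<longlonglongrightarrow> t"
    using tendsto_diff[OF tendsto_const inverse_tendsto[of 1], of t] by simp
qed simp

text \<open>
  Rounding down the first four parts, the fifth absorbs the rest, so that the orders are exactly \<open>n\<close>.
\<close>

lemma parts_exist:
  assumes "x \<in> std_simplex 5"
  shows "\<exists>U. (\<forall>n. blowup_parts B_F2 (U n)) \<and> (\<forall>i<5. (\<lambda>n. real (card (U n i)) / real n) \<longlonglongrightarrow> x i) \<and> (\<forall>n. (\<Sum>i<5. card (U n i)) = n)"
proof -
  have x: "0 \<le> x 0" "0 \<le> x 1" "0 \<le> x 2" "0 \<le> x 3" "0 \<le> x 4" "x 0 + x 1 + x 2 + x 3 + x 4 = 1"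
    using assms by (auto simp: simplex_5)
  define r where "r n i = nat \<lfloor>x i * real n\<rfloor>" for n i
  define s where "s n i = (if i = 4 then n - (r n 0 + r n 1 + r n 2 + r n 3) else r n i)" for n i
  define U where "U n i = (\<lambda>k. 5 * k + i) ` {..<s n i}" for n i :: nat
  have card: "card (U n i) = s n i" for n i
    unfolding U_def by (subst card_image) (auto simp: inj_on_def)
  have r_le: "r n 0 + r n 1 + r n 2 + r n 3 \<le> n" for n
  proof -
    have "real (r n 0) \<le> x 0 * real n" "real (r n 1) \<le> x 1 * real n" "real (r n 2) \<le> x 2 * real n" "real (r n 3) \<le> x 3 * real n"
      unfolding r_def using x by (simp_all add: of_nat_nat)
    moreover have "0 \<le> x 4 * real n" using x by simp
    moreover have "x 0 * real n + x 1 * real n + x 2 * real n + x 3 * real n + x 4 * real n = real n"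
      using x(6) by (metis distrib_right mult_1)
    ultimately have "real (r n 0 + r n 1 + r n 2 + r n 3) \<le> real n" unfolding of_nat_add by linarith
    then show ?thesis by (simp only: of_nat_le_iff)
  qed
  show ?thesis
  proof (intro exI[of _ U] conjI allI impI)
    show "blowup_parts B_F2 (U n)" for n
      unfolding blowup_parts_def disjoint_family_on_def verts_B_F2
    proof (intro conjI ballI impI)
      fix i j :: nat assume "i \<in> {..<5}" "j \<in> {..<5}" "i \<noteq> j"
      then show "U n i \<inter> U n j = {}" unfolding U_def by (auto; presburger)
    qed (simp add: U_def)
    show "(\<Sum>i<5. card (U n i)) = n" for n
      using r_le[of n] by (simp add: card s_def numeral_eq_Suc)
    have lim: "(\<lambda>n. real (r n i) / real n) \<longlonglongrightarrow> x i" if "0 \<le> x i" for i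
      unfolding r_def by (rule floor_limit[OF that])
    show "(\<lambda>n. real (card (U n i)) / real n) \<longlonglongrightarrow> x i" if "i < 5" for i
    proof (cases "i = 4")
      case True
      have "(\<lambda>n. 1 - (real (r n 0) / real n + real (r n 1) / real n + real (r n 2) / real n + real (r n 3) / real n)) \<longlonglongrightarrow> 1 - (x 0 + x 1 + x 2 + x 3)"
        using x by (intro tendsto_diff tendsto_add tendsto_const lim)
      moreover have "\<forall>\<^sub>F n in sequentially. 1 - (real (r n 0) / real n + real (r n 1) / real n + real (r n 2) / real n + real (r n 3) / real n) = real (card (U n i)) / real n"
        using eventually_gt_at_top[of 0]
      proof eventually_elim
        case (elim n)
        have "real (card (U n i)) = real n - (real (r n 0) + real (r n 1) + real (r n 2) + real (r n 3))"
          unfolding card s_def using True r_le[of n] by (simp add: of_nat_diff)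
        then show ?case using elim by (simp add: diff_divide_distrib add_divide_distrib)
      qed
      moreover have "1 - (x 0 + x 1 + x 2 + x 3) = x i" using x True by simp
      ultimately show ?thesis by (simp only:) (rule Lim_transform_eventually)
    next
      case False
      have "0 \<le> x i" using assms that by (simp add: std_simplex_def)
      from lim[OF this] show ?thesis unfolding card s_def by (simp add: False)
    qed
  qed
qed

lemma blowup_density_eq:
  assumes "x \<in> std_simplex 5"
  shows "blowup_density F2 B_F2 x = blowup_poly x"
  unfolding blowup_density_def
proof (rule the_equality)
  show "is_blowup_density F2 B_F2 x (blowup_poly x)" by (rule blowup_density_poly[OF assms])
  fix L assume L: "is_blowup_density F2 B_F2 x L"
  obtain U where "\<forall>n. blowup_parts B_F2 (U n)" "\<forall>i<5. (\<lambda>n. real (card (U n i)) / real n) \<longlonglongrightarrow> x i"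
    "\<forall>n. (\<Sum>i<5. card (U n i)) = n"
    using parts_exist[OF assms] by blast
  note U = this[rule_format]
  have "(\<lambda>n. ind_density F2 (blowup B_F2 (U n))) \<longlonglongrightarrow> L"
    "(\<lambda>n. ind_density F2 (blowup B_F2 (U n))) \<longlonglongrightarrow> blowup_poly x"
    using L[unfolded is_blowup_density_def verts_B_F2, rule_format, of U]
      blowup_density_poly[OF assms, unfolded is_blowup_density_def verts_B_F2, rule_format, of U] U by simp_all
  then show "L = blowup_poly x" by (rule LIMSEQ_unique)
qed

lemma densities_finite: "finite {ind_density F G |G. simple_graph G \<and> num_verts G = n}"
proof (rule finite_subset)
  show "{ind_density F G |G. simple_graph G \<and> num_verts G = n} \<subseteq> (\<lambda>k. real k / real (n choose num_verts F)) ` {..n choose num_verts F}"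
  proof clarify
    fix G assume G: "simple_graph G" "n = num_verts G"
    let ?S = "{S. S \<subseteq> verts G \<and> card S = num_verts F \<and> isomorphic (induced_subgraph G S) F}"
    have "finite {S. S \<subseteq> verts G \<and> card S = num_verts F}"
      by (rule finite_subset[of _ "Pow (verts G)"]) (use finite_verts[OF G(1)] in auto)
    then have "card ?S \<le> card {S. S \<subseteq> verts G \<and> card S = num_verts F}"
      by (rule card_mono) blast
    also have "\<dots> = num_verts G choose num_verts F"
      unfolding num_verts_def[of G] by (rule n_subsets[OF finite_verts[OF G(1)]])
    finally show "ind_density F G \<in> (\<lambda>k. real k / real (num_verts G choose num_verts F)) ` {..num_verts G choose num_verts F}"
      by (auto simp: ind_density_def)
  qed
qed simp

lemma ind_density_le_max: "simple_graph G \<Longrightarrow> ind_density F G \<le> max_density F (num_verts G)"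
  unfolding max_density_def by (rule Max_ge[OF densities_finite]) blast

lemma max_density_upper:
  "max_density F2 n \<le> limit_value * (real n ^ 6 / ordered_choices n)"
  unfolding max_density_def
proof (subst Max_le_iff[OF densities_finite])
  have "simple_graph \<lparr>verts = {..<n}, edges = {}\<rparr>" "num_verts \<lparr>verts = {..<n}, edges = {}\<rparr> = n"
    by (simp_all add: simple_graph_def wf_pattern_def num_verts_def)
  then show "{ind_density F2 G |G. simple_graph G \<and> num_verts G = n} \<noteq> {}" by blast
  show "\<forall>a\<in>{ind_density F2 G |G. simple_graph G \<and> num_verts G = n}. a \<le> limit_value * (real n ^ 6 / ordered_choices n)"
    using ind_density_le copies_le[OF finite_verts simple_adj] by (auto simp: num_verts_def)
qed

lemma max_density_limit: "max_density F2 \<longlonglongrightarrow> limit_value"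
proof -
  obtain U where "\<forall>n. blowup_parts B_F2 (U n)" "\<forall>i<5. (\<lambda>n. real (card (U n i)) / real n) \<longlonglongrightarrow> optimum i"
    "\<forall>n. (\<Sum>i<5. card (U n i)) = n"
    using parts_exist[OF optimum_in_simplex] by blast
  note U = this[rule_format]
  have lower: "(\<lambda>n. ind_density F2 (blowup B_F2 (U n))) \<longlonglongrightarrow> limit_value"
    using blowup_density_poly[OF optimum_in_simplex, unfolded is_blowup_density_def verts_B_F2 blowup_poly_optimum, rule_format, of U] U(1,2)
    by simp
  have le: "ind_density F2 (blowup B_F2 (U n)) \<le> max_density F2 n" for n
    using ind_density_le_max[OF simple_blowup(1)[OF U(1)[of n]], of F2] simple_blowup(2)[OF U(1)[of n]] U(3)[of n] by simp
  have upper: "(\<lambda>n. limit_value * (real n ^ 6 / ordered_choices n)) \<longlonglongrightarrow> limit_value"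
    using tendsto_mult_left[OF ratio_limit, of limit_value] by simp
  show ?thesis
    by (rule tendsto_sandwich[OF _ _ lower upper]) (intro always_eventually allI le max_density_upper)+
qed

section \<open>Graphs that differ from a blowup\<close>

definition wrong :: "'a set \<Rightarrow> ('a \<Rightarrow> 'a \<Rightarrow> bool) \<Rightarrow> ('a \<Rightarrow> nat) \<Rightarrow> ('a \<times> 'a) set" where
  "wrong V E c = {(u, v) \<in> V \<times> V. E u v \<noteq> base_adj (c u) (c v)}"

lemma finite_wrong: "finite V \<Longrightarrow> finite (wrong V E c)"
  by (rule finite_subset[of _ "V \<times> V"]) (auto simp: wrong_def)

lemma wrong_irrefl: "simple_rel E \<Longrightarrow> (v, v) \<notin> wrong V E c"
  by (auto simp: wrong_def simple_rel_def base_adj_def)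

lemma copies_off_wrong:
  assumes "simple_rel E" "x \<in> PiE {..<6} (\<lambda>_. V)" "x \<notin> touching V (wrong V E c)"
  shows "x \<in> copies V E \<longleftrightarrow> x \<in> copies V (\<lambda>u v. base_adj (c u) (c v))"
proof -
  have "E (x i) (x j) = base_adj (c (x i)) (c (x j))" if "i < 6" "j < 6" for i j
  proof (cases "i = j")
    case True
    then show ?thesis using wrong_irrefl[OF assms(1), of "x i" V c] assms(2) that
      by (auto simp: wrong_def)
  next
    case False
    have "x i \<in> V" "x j \<in> V" using assms(2) that by auto
    moreover have "(x i, x j) \<notin> wrong V E c" using assms(2,3) that False unfolding touching_def by blast
    ultimately show ?thesis by (simp add: wrong_def)
  qed
  then show ?thesis using assms(2) by (simp add: copies_def)
qed

lemma copies_le_colouring: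
  assumes "finite V" "simple_rel E"
  shows "real (card (copies V E)) \<le> real (card (copies V (\<lambda>u v. base_adj (c u) (c v)))) + 36 * (real (card (wrong V E c)) * real (card V) ^ 4)"
proof -
  let ?K = "copies V (\<lambda>u v. base_adj (c u) (c v))" and ?T = "touching V (wrong V E c)"
  have "copies V E \<subseteq> ?K \<union> ?T"
  proof
    fix x assume x: "x \<in> copies V E"
    then have "x \<in> PiE {..<6} (\<lambda>_. V)" by (simp add: copies_def)
    then show "x \<in> ?K \<union> ?T" using copies_off_wrong[OF assms(2), of x V c] x by blast
  qed
  then have "card (copies V E) \<le> card (?K \<union> ?T)"
    by (intro card_mono finite_UnI finite_copies finite_touching assms)
  also have "\<dots> \<le> card ?K + card ?T" by (rule card_Un_le)
  also have "\<dots> \<le> card ?K + 36 * (card (wrong V E c) * card V ^ 4)"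
    using card_all_touching_le[OF assms(1) finite_wrong[OF assms(1)]] by simp
  finally have "real (card (copies V E)) \<le> real (card ?K + 36 * (card (wrong V E c) * card V ^ 4))" by (rule of_nat_mono)
  then show ?thesis by simp
qed

lemma injective_copies_gain:
  assumes "finite V" "simple_rel E"
  shows "real (card (copies V (\<lambda>u v. base_adj (c u) (c v)))) - real (card (copies V E)) - 1296 * (real (card (wrong V E c)) * real (card V) ^ 3)
    \<le> real (card (injective_copies V (\<lambda>u v. base_adj (c u) (c v)))) - real (card (injective_copies V E))"
proof -
  let ?K = "\<lambda>u v. base_adj (c u) (c v)"
  let ?N = "{x \<in> touching V (wrong V E c). \<not> inj_on x {..<6}}"
  define D where "D E' = copies V E' - injective_copies V E'" for E'
  have split: "real (card (copies V E')) = real (card (injective_copies V E')) + real (card (D E'))" for E'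
  proof -
    have "injective_copies V E' \<subseteq> copies V E'" by (auto simp: injective_copies_def)
    then have "copies V E' = injective_copies V E' \<union> D E'" "injective_copies V E' \<inter> D E' = {}" by (auto simp: D_def)
    moreover have "finite (injective_copies V E')" "finite (D E')"
      using finite_copies[OF assms(1)] by (auto simp: injective_copies_def D_def)
    ultimately show ?thesis by (metis card_Un_disjoint of_nat_add)
  qed
  have "D ?K \<subseteq> D E \<union> ?N"
  proof
    fix x assume x: "x \<in> D ?K"
    then have "x \<in> PiE {..<6} (\<lambda>_. V)" "x \<in> copies V ?K" "\<not> inj_on x {..<6}"
      by (auto simp: D_def copies_def injective_copies_def)
    then show "x \<in> D E \<union> ?N"
      using copies_off_wrong[OF assms(2), of x V c] by (auto simp: D_def injective_copies_def)
  qed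
  then have "card (D ?K) \<le> card (D E \<union> ?N)"
    using finite_copies[OF assms(1)] finite_touching[OF assms(1)] by (intro card_mono finite_UnI) (auto simp: D_def)
  also have "\<dots> \<le> card (D E) + card ?N" by (rule card_Un_le)
  also have "\<dots> \<le> card (D E) + 1296 * (card (wrong V E c) * card V ^ 3)"
    using card_non_injective_touching_le[OF assms(1) finite_wrong[OF assms(1)] wrong_irrefl[OF assms(2)]] by simp
  finally have "real (card (D ?K)) \<le> real (card (D E) + 1296 * (card (wrong V E c) * card V ^ 3))" by (rule of_nat_mono)
  then show ?thesis using split[of ?K] split[of E] by simp
qed

text \<open>
  Passing from weights to the uniform ones changes the difference of the two counts only through touching tuples,
  each by at most \<open>\<eta>\<close> relative to the uniform weight.
\<close>

lemma reweighting:
  assumes "weighted_graph V \<mu> E" and \<eta>: "\<And>x. x \<in> PiE {..<6 :: nat} (\<lambda>_. V) \<Longrightarrow> \<bar>real (card V) ^ 6 * (\<Prod>i<6. \<mu> (x i)) - 1\<bar> \<le> \<eta>"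
  shows "real (card V) ^ 6 * (weighted_graph.target_sum V \<mu> (\<lambda>u v. base_adj (c u) (c v)) - weighted_graph.target_sum V \<mu> E)
     - 36 * \<eta> * (real (card (wrong V E c)) * real (card V) ^ 4)
   \<le> real (card (copies V (\<lambda>u v. base_adj (c u) (c v)))) - real (card (copies V E))"
proof -
  interpret G: weighted_graph V \<mu> E by fact
  interpret K: weighted_graph V \<mu> "\<lambda>u v. base_adj (c u) (c v)"
    by unfold_locales (auto simp: G.finite_V G.\<mu>_nonneg base_adj_simple)
  let ?K = "\<lambda>u v. base_adj (c u) (c v)" and ?P = "PiE {..<6 :: nat} (\<lambda>_. V)"
  let ?T = "touching V (wrong V E c)"
  define s where "s x = (of_bool (x \<in> copies V ?K) - of_bool (x \<in> copies V E) :: real)" for x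
  define w where "w x = real (card V) ^ 6 * (\<Prod>i<6. \<mu> (x i))" for x :: "nat \<Rightarrow> 'a"
  have finP: "finite ?P" using G.finite_V by (simp add: finite_PiE)
  have sum_copies: "(\<Sum>x\<in>copies V E'. g x) = (\<Sum>x\<in>?P. of_bool (x \<in> copies V E') * g x)" for E' and g :: "(nat \<Rightarrow> 'a) \<Rightarrow> real"
  proof -
    have "(\<Sum>x\<in>?P. of_bool (x \<in> copies V E') * g x) = (\<Sum>x\<in>?P. if x \<in> copies V E' then g x else 0)"
      by (intro sum.cong) auto
    also have "\<dots> = (\<Sum>x\<in>?P \<inter> copies V E'. g x)" using finP by (simp add: sum.inter_restrict)
    also have "?P \<inter> copies V E' = copies V E'" by (auto simp: copies_def)
    finally show ?thesis by simp
  qed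
  have card_copies: "real (card (copies V E')) = (\<Sum>x\<in>?P. of_bool (x \<in> copies V E'))" for E'
    using sum_copies[where E' = E' and g = "\<lambda>_. 1"] by simp
  have "real (card V) ^ 6 * (K.target_sum - G.target_sum) - (real (card (copies V ?K)) - real (card (copies V E)))
      = (\<Sum>x\<in>?P. s x * (w x - 1))"
    unfolding G.target_sum_copies K.target_sum_copies sum_copies card_copies s_def w_def
    by (simp add: sum_distrib_left sum_subtractf left_diff_distrib right_diff_distrib mult_ac)
  also have "\<dots> = (\<Sum>x\<in>?T. s x * (w x - 1))"
  proof (rule sum.mono_neutral_right[OF finP])
    show "?T \<subseteq> ?P" by (auto simp: touching_def)
    show "\<forall>x\<in>?P - ?T. s x * (w x - 1) = 0"
      using copies_off_wrong[OF G.simple_E] by (auto simp: s_def)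
  qed
  also have "\<dots> \<le> (\<Sum>x\<in>?T. \<eta>)"
  proof (rule sum_mono)
    fix x assume "x \<in> ?T"
    then have "\<bar>w x - 1\<bar> \<le> \<eta>" using \<eta> by (auto simp: touching_def w_def)
    then show "s x * (w x - 1) \<le> \<eta>" by (auto simp: s_def of_bool_def)
  qed
  also have "\<dots> = \<eta> * real (card ?T)" by simp
  also have "\<dots> \<le> \<eta> * real (36 * (card (wrong V E c) * card V ^ 4))"
  proof (cases "V = {}")
    case True
    then have "wrong V E c = {}" by (simp add: wrong_def)
    then show ?thesis by (simp add: touching_def)
  next
    case False
    then obtain v where "v \<in> V" by blast
    then have "0 \<le> \<eta>" using \<eta>[of "\<lambda>i\<in>{..<6}. v"] by auto
    then show ?thesis
      by (intro mult_left_mono of_nat_mono card_all_touching_le G.finite_V finite_wrong)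
  qed
  finally show ?thesis by simp
qed

section \<open>Wrong pairs are seen by uncolourable tuples\<close>

definition bad :: "'a set \<Rightarrow> ('a \<Rightarrow> 'a \<Rightarrow> bool) \<Rightarrow> (nat \<Rightarrow> 'a) set" where
  "bad V E = {x \<in> PiE {..<7} (\<lambda>_. V). \<not> colourable 7 (\<lambda>i j. E (x i) (x j))}"

lemma finite_bad: "finite V \<Longrightarrow> finite (bad V E)"
  unfolding bad_def by (rule finite_Collect_conjI, rule disjI1) (simp add: finite_PiE)

lemma (in weighted_graph) bad_weight: "wsum 7 (\<lambda>x. of_bool (\<not> colourable 7 (pull x))) = (\<Sum>x\<in>bad V E. \<Prod>i<7. \<mu> (x i))"
proof -
  have "wsum 7 (\<lambda>x. of_bool (\<not> colourable 7 (pull x))) = (\<Sum>x\<in>tuples 7. if x \<in> bad V E then \<Prod>i<7. \<mu> (x i) else 0)"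
    unfolding wsum_def by (intro sum.cong refl) (simp add: bad_def tuples_def pull_def[abs_def])
  also have "\<dots> = (\<Sum>x\<in>tuples 7 \<inter> bad V E. \<Prod>i<7. \<mu> (x i))"
    by (simp add: sum.inter_restrict finite_tuples)
  also have "tuples 7 \<inter> bad V E = bad V E" by (auto simp: bad_def tuples_def)
  finally show ?thesis .
qed

definition matchings :: "'a set \<Rightarrow> ('a \<Rightarrow> 'a \<Rightarrow> bool) \<Rightarrow> ('a \<times> 'a \<times> 'a \<times> 'a) set" where
  "matchings V E = {(a, b, c, d). a \<in> V \<and> b \<in> V \<and> c \<in> V \<and> d \<in> V \<and> E a b \<and> E c d \<and> \<not> E a c \<and> \<not> E a d \<and> \<not> E b c \<and> \<not> E b d}"

text \<open>
  The partition guessed from an induced matching: in a blowup, a vertex belongs to the part of \<open>a\<close> if and only if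
  its only neighbour in the matching is \<open>b\<close>, and similarly for the other three; the remaining vertices form the
  last part.
\<close>

definition attach :: "('a \<Rightarrow> 'a \<Rightarrow> bool) \<Rightarrow> 'a \<times> 'a \<times> 'a \<times> 'a \<Rightarrow> 'a \<Rightarrow> nat" where
  "attach E = (\<lambda>(a, b, c, d) v. if E b v \<and> \<not> E a v \<and> \<not> E c v \<and> \<not> E d v then 0 else if E a v \<and> \<not> E b v \<and> \<not> E c v \<and> \<not> E d v then 1
     else if E d v \<and> \<not> E a v \<and> \<not> E b v \<and> \<not> E c v then 2 else if E c v \<and> \<not> E a v \<and> \<not> E b v \<and> \<not> E d v then 3 else 4)"

text \<open>
  The same guess from a single edge, for a blowup with one pair of parts only.
\<close>

definition edge_attach :: "('a \<Rightarrow> 'a \<Rightarrow> bool) \<Rightarrow> 'a \<times> 'a \<Rightarrow> 'a \<Rightarrow> nat" where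
  "edge_attach E = (\<lambda>(a, b) v. if E b v \<and> \<not> E a v then 0 else if E a v \<and> \<not> E b v then 1 else 4)"

lemma attach_less: "attach E \<tau> v < 5" "edge_attach E e v < 5"
  by (auto simp: attach_def edge_attach_def split: prod.split)

lemma base_adj_cases:
  assumes "base_adj i j"
  obtains "i = 0" "j = 1" | "i = 1" "j = 0" | "i = 2" "j = 3" | "i = 3" "j = 2"
  using assms by (auto simp: base_adj_def)

text \<open>
  In the pattern itself the guess is correct up to an automorphism.
\<close>

lemma base_attach:
  assumes "(p, q, r, s) \<in> matchings UNIV base_adj"
  shows "base_adj (attach base_adj (p, q, r, s) u) (attach base_adj (p, q, r, s) v) = base_adj u v"
proof -
  have pq: "base_adj p q" and rs: "base_adj r s" and "\<not> base_adj p r" "\<not> base_adj p s"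
    using assms by (auto simp: matchings_def)
  have att: "attach base_adj (p, q, r, s) w = (if w = p then 0 else if w = q then 1 else if w = r then 2 else if w = s then 3 else 4)" for w
    using pq rs assms by (elim base_adj_cases) (simp_all add: matchings_def attach_def base_adj_def)
  show ?thesis
    unfolding att using pq rs assms by (elim base_adj_cases) (simp_all add: matchings_def base_adj_def)
qed

lemma base_edge_attach:
  assumes "base_adj p q"
  shows "base_adj (edge_attach base_adj (p, q) u) (edge_attach base_adj (p, q) v) = base_adj u v \<or> (p, q, u, v) \<in> matchings UNIV base_adj"
proof -
  have att: "edge_attach base_adj (p, q) w = (if w = p then 0 else if w = q then 1 else 4)" for w
    using assms by (elim base_adj_cases) (simp_all add: edge_attach_def base_adj_def)
  show ?thesis
    unfolding att using assms by (elim base_adj_cases) (auto simp: matchings_def base_adj_def)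
qed

text \<open>
  A colouring of the six vertices would fix the colours of \<open>u\<close> and \<open>v\<close> up to an automorphism, and thus their
  adjacency.
\<close>

lemma wrong_uncolourable:
  assumes "(x 0, x 1, x 2, x 3) \<in> matchings V E" "(x 4, x 5) \<in> wrong V E (attach E (x 0, x 1, x 2, x 3))"
  shows "\<not> colourable 7 (\<lambda>i j. E (x i) (x j))"
proof
  assume "colourable 7 (\<lambda>i j. E (x i) (x j))"
  then obtain f where f: "\<And>i j. i < 7 \<Longrightarrow> j < 7 \<Longrightarrow> E (x i) (x j) = base_adj (f i) (f j)"
    unfolding colourable_def by blast
  have "(f 0, f 1, f 2, f 3) \<in> matchings UNIV base_adj"
    using assms(1) by (simp add: matchings_def f)
  moreover have "attach E (x 0, x 1, x 2, x 3) (x k) = attach base_adj (f 0, f 1, f 2, f 3) (f k)" if "k < 7" for k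
    using that by (simp add: attach_def f)
  ultimately have "base_adj (attach E (x 0, x 1, x 2, x 3) (x 4)) (attach E (x 0, x 1, x 2, x 3) (x 5)) = base_adj (f 4) (f 5)"
    using base_attach by simp
  then show False using assms(2) f[of 4 5] by (simp add: wrong_def)
qed

lemma edge_wrong_uncolourable:
  assumes "E (x 0) (x 1)" "(x 2, x 3) \<in> wrong V E (edge_attach E (x 0, x 1))" "x 0 \<in> V" "x 1 \<in> V"
  shows "\<not> colourable 7 (\<lambda>i j. E (x i) (x j)) \<or> (x 0, x 1, x 2, x 3) \<in> matchings V E"
proof (rule disjCI)
  assume no: "(x 0, x 1, x 2, x 3) \<notin> matchings V E"
  show "\<not> colourable 7 (\<lambda>i j. E (x i) (x j))"
  proof
    assume "colourable 7 (\<lambda>i j. E (x i) (x j))"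
    then obtain f where f: "\<And>i j. i < 7 \<Longrightarrow> j < 7 \<Longrightarrow> E (x i) (x j) = base_adj (f i) (f j)"
      unfolding colourable_def by blast
    have "(f 0, f 1, f 2, f 3) \<notin> matchings UNIV base_adj"
      using no assms by (auto simp: matchings_def f wrong_def)
    moreover have "base_adj (f 0) (f 1)" using assms(1) by (simp add: f)
    moreover have "edge_attach E (x 0, x 1) (x k) = edge_attach base_adj (f 0, f 1) (f k)" if "k < 7" for k
      using that by (simp add: edge_attach_def f)
    ultimately have "base_adj (edge_attach E (x 0, x 1) (x 2)) (edge_attach E (x 0, x 1) (x 3)) = base_adj (f 2) (f 3)"
      using base_edge_attach[of "f 0" "f 1" "f 2" "f 3"] by simp
    then show False using assms(2) f[of 2 3] by (simp add: wrong_def)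
  qed
qed

text \<open>
  Restricted to the index set, so that tuples are elements of the extensional function space.
\<close>

definition tuple7 :: "'a \<Rightarrow> 'a \<Rightarrow> 'a \<Rightarrow> 'a \<Rightarrow> 'a \<Rightarrow> 'a \<Rightarrow> 'a \<Rightarrow> nat \<Rightarrow> 'a" where
  "tuple7 a b c d e f g = (\<lambda>i\<in>{..<7}. [a, b, c, d, e, f, g] ! i)"

lemma tuple7_nth [simp]: "tuple7 a b c d e f g 0 = a" "tuple7 a b c d e f g 1 = b" "tuple7 a b c d e f g (Suc 0) = b" "tuple7 a b c d e f g 2 = c" "tuple7 a b c d e f g 3 = d"
  "tuple7 a b c d e f g 4 = e" "tuple7 a b c d e f g 5 = f" "tuple7 a b c d e f g 6 = g"
  by (simp_all add: tuple7_def nth_Cons')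

lemma less_7_cases: "i < 7 \<Longrightarrow> i = 0 \<or> i = 1 \<or> i = 2 \<or> i = 3 \<or> i = 4 \<or> i = 5 \<or> i = (6 :: nat)"
  by linarith

lemma tuple7_PiE:
  assumes "a \<in> V" "b \<in> V" "c \<in> V" "d \<in> V" "e \<in> V" "f \<in> V" "g \<in> V"
  shows "tuple7 a b c d e f g \<in> PiE {..<7} (\<lambda>_. V)"
proof (rule PiE_I)
  fix i :: nat assume "i \<in> {..<7}"
  then have "i < 7" by simp
  from less_7_cases[OF this] show "tuple7 a b c d e f g i \<in> V" using assms by (elim disjE) simp_all
qed (simp add: tuple7_def)

lemma tuple7_inject: "tuple7 a b c d e f g = tuple7 a' b' c' d' e' f' g' \<longleftrightarrow> a = a' \<and> b = b' \<and> c = c' \<and> d = d' \<and> e = e' \<and> f = f' \<and> g = g'"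
proof
  assume eq: "tuple7 a b c d e f g = tuple7 a' b' c' d' e' f' g'"
  show "a = a' \<and> b = b' \<and> c = c' \<and> d = d' \<and> e = e' \<and> f = f' \<and> g = g'"
    using fun_cong[OF eq, of 0] fun_cong[OF eq, of 1] fun_cong[OF eq, of 2] fun_cong[OF eq, of 3] fun_cong[OF eq, of 4] fun_cong[OF eq, of 5] fun_cong[OF eq, of 6]
    by simp
qed simp

lemma finite_matchings: "finite V \<Longrightarrow> finite (matchings V E)"
  by (rule finite_subset[of _ "V \<times> V \<times> V \<times> V"]) (auto simp: matchings_def)

lemma bad_ge_matchings:
  assumes "finite V"
  shows "card V * (\<Sum>\<tau>\<in>matchings V E. card (wrong V E (attach E \<tau>))) \<le> card (bad V E)"
proof -
  \<comment> \<open>the seventh entry is arbitrary\<close>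
  let ?S = "(SIGMA \<tau>:matchings V E. wrong V E (attach E \<tau>)) \<times> V"
  let ?f = "\<lambda>(((a, b, c, d), (u, v)), w). tuple7 a b c d u v w"
  have "card ?S \<le> card (bad V E)"
  proof (rule card_inj_on_le[where f = ?f])
    show "inj_on ?f ?S" by (auto simp: inj_on_def tuple7_inject)
    show "?f ` ?S \<subseteq> bad V E"
    proof clarify
      fix a b c d u v w
      assume *: "(a, b, c, d) \<in> matchings V E" "(u, v) \<in> wrong V E (attach E (a, b, c, d))" "w \<in> V"
      have "tuple7 a b c d u v w \<in> PiE {..<7} (\<lambda>_. V)"
        using * by (intro tuple7_PiE) (auto simp: matchings_def wrong_def)
      moreover have "\<not> colourable 7 (\<lambda>i j. E (tuple7 a b c d u v w i) (tuple7 a b c d u v w j))"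
        by (rule wrong_uncolourable) (use * in simp_all)
      ultimately show "tuple7 a b c d u v w \<in> bad V E" by (simp add: bad_def)
    qed
    show "finite (bad V E)" by (rule finite_bad[OF assms])
  qed
  moreover have "card ?S = card V * (\<Sum>\<tau>\<in>matchings V E. card (wrong V E (attach E \<tau>)))"
    using assms by (simp add: card_cartesian_product finite_matchings finite_wrong)
  ultimately show ?thesis by simp
qed

definition edge_pairs :: "'a set \<Rightarrow> ('a \<Rightarrow> 'a \<Rightarrow> bool) \<Rightarrow> ('a \<times> 'a) set" where
  "edge_pairs V E = {(a, b) \<in> V \<times> V. E a b}"

lemma finite_edge_pairs: "finite V \<Longrightarrow> finite (edge_pairs V E)"
  by (rule finite_subset[of _ "V \<times> V"]) (auto simp: edge_pairs_def)

lemma matchings_ge_edges: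
  assumes "finite V"
  shows "card V ^ 3 * (\<Sum>e\<in>edge_pairs V E. card (wrong V E (edge_attach E e))) \<le> card (bad V E) + card V ^ 3 * card (matchings V E)"
proof -
  let ?S = "SIGMA e:edge_pairs V E. wrong V E (edge_attach E e)"
  let ?M = "{((a, b), (c, d)) | a b c d. (a, b, c, d) \<in> matchings V E}"
  let ?f = "\<lambda>(((a, b), (u, v)), (w, y, z)). tuple7 a b u v w y z"
  have finS: "finite ?S" using assms by (auto intro!: finite_SigmaI finite_edge_pairs finite_wrong)
  have M_image: "?M = (\<lambda>(a, b, c, d). ((a, b), (c, d))) ` matchings V E" by force
  have cM: "card ?M \<le> card (matchings V E)" "finite ?M"
    unfolding M_image using finite_matchings[OF assms] by (auto intro: card_image_le)
  have "card ((?S - ?M) \<times> (V \<times> V \<times> V)) \<le> card (bad V E)"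
  proof (rule card_inj_on_le[where f = ?f])
    show "inj_on ?f ((?S - ?M) \<times> (V \<times> V \<times> V))" by (auto simp: inj_on_def tuple7_inject)
    show "?f ` ((?S - ?M) \<times> (V \<times> V \<times> V)) \<subseteq> bad V E"
    proof (rule image_subsetI)
      fix t assume t: "t \<in> (?S - ?M) \<times> (V \<times> V \<times> V)"
      obtain a b u v w y z where eq: "t = (((a, b), (u, v)), (w, y, z))" by (metis surj_pair)
      have *: "(a, b) \<in> edge_pairs V E" "(u, v) \<in> wrong V E (edge_attach E (a, b))" "w \<in> V" "y \<in> V" "z \<in> V"
        and no: "(a, b, u, v) \<notin> matchings V E"
        using t by (auto simp: eq)
      have "tuple7 a b u v w y z \<in> PiE {..<7} (\<lambda>_. V)"
        using * by (intro tuple7_PiE) (auto simp: edge_pairs_def wrong_def)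
      moreover have "\<not> colourable 7 (\<lambda>i j. E (tuple7 a b u v w y z i) (tuple7 a b u v w y z j))"
        using edge_wrong_uncolourable[of E "tuple7 a b u v w y z" V] * no by (auto simp: edge_pairs_def)
      ultimately show "?f t \<in> bad V E" by (simp add: bad_def eq)
    qed
    show "finite (bad V E)" by (rule finite_bad[OF assms])
  qed
  then have "card (?S - ?M) * card V ^ 3 \<le> card (bad V E)"
    by (simp add: card_cartesian_product power3_eq_cube mult_ac)
  moreover have "card ?S \<le> card (?S - ?M) + card (matchings V E)"
    using diff_card_le_card_Diff[OF cM(2), of ?S] cM(1) by linarith
  then have "card ?S * card V ^ 3 \<le> (card (?S - ?M) + card (matchings V E)) * card V ^ 3"
    by (rule mult_right_mono) simp
  moreover have S: "card ?S = (\<Sum>e\<in>edge_pairs V E. card (wrong V E (edge_attach E e)))"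
    using assms by (simp add: finite_edge_pairs finite_wrong)
  ultimately show ?thesis unfolding S[symmetric] distrib_right mult.commute[of "card V ^ 3"] by linarith
qed

section \<open>Perfect stability\<close>

text \<open>
  The certificate, read as an upper bound for the number of uncolourable tuples in a nearly extremal graph.
\<close>

lemma bad_le:
  assumes "finite V" "simple_rel E" "(limit_value - \<epsilon>) * real (card V) ^ 6 \<le> 60 * real (card (copies V E))"
  shows "real (card (bad V E)) \<le> 1076 * \<epsilon> * real (card V) ^ 7"
proof -
  interpret G: weighted_graph V "\<lambda>_. 1" E by (rule unweighted[OF assms(1,2)])
  let ?n = "real (card V)"
  have "G.wsum 7 (\<lambda>x. of_bool (\<not> colourable 7 (G.pull x))) = real (card (bad V E))"
    by (simp add: G.bad_weight)
  then have c: "18900 * (?n * real (card (copies V E))) + 30000 / 102400 * real (card (bad V E)) \<le> 315 * limit_value * ?n ^ 7"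
    using G.certificate unfolding unweighted_target_sum[OF assms(1,2)] G.mass_def by simp
  have "?n * ((limit_value - \<epsilon>) * ?n ^ 6) \<le> ?n * (60 * real (card (copies V E)))"
    by (rule mult_left_mono[OF assms(3)]) simp
  moreover have "?n * ((limit_value - \<epsilon>) * ?n ^ 6) = limit_value * ?n ^ 7 - \<epsilon> * ?n ^ 7"
    by (simp add: power_numeral_reduce algebra_simps)
  ultimately have b: "30000 / 102400 * real (card (bad V E)) \<le> 315 * (\<epsilon> * ?n ^ 7)" using c by linarith
  moreover have "0 \<le> \<epsilon> * ?n ^ 7" using b of_nat_0_le_iff[of "card (bad V E)", where 'a = real] by linarith
  ultimately have "real (card (bad V E)) \<le> 1076 * (\<epsilon> * ?n ^ 7)" by linarith
  then show ?thesis by (simp add: mult.assoc)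
qed

lemma pair_poly_le:
  assumes "0 \<le> x 0" "0 \<le> x 1" "x 2 = 0" "x 3 = 0" "0 \<le> x 4" "x 0 + x 1 + x 4 = t" "0 < t"
  shows "blowup_poly x \<le> 15 / 64 * t ^ 6"
proof -
  define y where "y i = x i / t" for i
  have y: "0 \<le> y 0" "0 \<le> y 1" "y 2 = 0" "y 3 = 0" "0 \<le> y 4" using assms by (auto simp: y_def)
  have s: "y 0 + y 1 + y 4 = 1"
    using assms by (simp add: y_def flip: add_divide_distrib)
  have "y 4 = 1 - (y 0 + y 1)" using s by simp
  then have "blowup_poly y = 60 * ((y 0 * y 1) * (y 0 + y 1) * (1 - (y 0 + y 1)) ^ 3)"
    by (simp add: blowup_poly_def y)
  also have "\<dots> \<le> 60 * (1 / 256)"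
    using y s four_mult_le_square[of "y 0" "y 1"] by (intro mult_left_mono one_pair_le) auto
  finally have "blowup_poly x / t ^ 6 \<le> 15 / 64"
    unfolding y_def blowup_poly_scale by simp
  then show ?thesis using assms(7) by (simp add: divide_le_eq)
qed

lemma sum_part_sizes:
  assumes "finite V" "\<And>v. v \<in> V \<Longrightarrow> c v < (5 :: nat)"
  shows "(\<Sum>i<5. real (card {v \<in> V. c v = i})) = real (card V)"
  using sum_over_parts[of V c "\<lambda>_. 1" "\<lambda>_. 1", OF assms] by (simp add: part_weight_def)

text \<open>
  Suppose that there were few induced matchings. Then, for some edge, the graph is close to the guess from this
  edge, a complete bipartite graph with isolated vertices. The density of the target graph in such a graph is at
  most \<open>15 / 64\<close>, which is less than the limit value. Quantitatively: every edge has many wrong pairs, each of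
  which yields an induced matching or uncolourable tuples.
\<close>

lemma many_matchings:
  assumes fin: "finite V" and E: "simple_rel E" and n: "0 < card V"
    and near: "(limit_value - \<epsilon>) * real (card V) ^ 6 \<le> 60 * real (card (copies V E))" and \<epsilon>: "\<epsilon> \<le> 5 / 10 ^ 12"
  shows "5 / 10 ^ 9 * real (card V) ^ 4 \<le> real (card (matchings V E))"
proof -
  define t where "t = real (card V)"
  have t: "0 < t" using n by (simp add: t_def)
  have "(2407 / 10000) * t ^ 6 \<le> (limit_value - \<epsilon>) * t ^ 6"
    using limit_value_bounds \<epsilon> t by (intro mult_right_mono) auto
  then have copies: "(2407 / 10000) * t ^ 6 \<le> 60 * real (card (copies V E))" using near by (simp add: t_def)
  have "copies V E \<subseteq> {x \<in> PiE {..<6 :: nat} (\<lambda>_. V). (x 0, x 1) \<in> edge_pairs V E}"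
    by (auto simp: copies_def edge_pairs_def star_def PiE_mem)
  then have "card (copies V E) \<le> card {x \<in> PiE {..<6 :: nat} (\<lambda>_. V). (x 0, x 1) \<in> edge_pairs V E}"
    by (intro card_mono finite_tuples_with[OF fin])
  also have "\<dots> \<le> card (edge_pairs V E) * card V ^ 4"
    by (rule card_touching_le[OF fin finite_edge_pairs[OF fin]]) auto
  finally have "real (card (copies V E)) \<le> real (card (edge_pairs V E) * card V ^ 4)" by (rule of_nat_mono)
  then have "(2407 / 10000) * t ^ 6 \<le> 60 * (real (card (edge_pairs V E)) * t ^ 4)" using copies by (simp add: t_def)
  then have "t ^ 4 * ((2407 / 600000) * t ^ 2) \<le> t ^ 4 * real (card (edge_pairs V E))" by (simp add: power_numeral_reduce algebra_simps)
  \<comment> \<open>each copy has an edge at its first two positions, so there are many edges\<close>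
  then have edges: "(2407 / 600000) * t ^ 2 \<le> real (card (edge_pairs V E))"
    using t by (simp only: mult_le_cancel_left_pos zero_less_power)
  \<comment> \<open>the constant is below \<open>(2407 / 10000 - 15 / 64) / 2160\<close>\<close>
  have each: "29 / 10 ^ 7 * t ^ 2 \<le> real (card (wrong V E (edge_attach E e)))" for e
  proof -
    let ?c = "edge_attach E e"
    define y where "y i = real (card {v \<in> V. ?c v = i})" for i
    have "{v \<in> V. ?c v = 2} = {}" "{v \<in> V. ?c v = 3} = {}" by (auto simp: edge_attach_def split: prod.splits)
    then have y: "y 2 = 0" "y 3 = 0" by (simp_all only: y_def card.empty of_nat_0)
    have "y 0 + y 1 + y 4 = t"
      using sum_part_sizes[of V ?c, OF fin attach_less(2)] y unfolding sum_less_5 y_def t_def by simp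
    then have "blowup_poly y \<le> 15 / 64 * t ^ 6"
      using y t by (intro pair_poly_le) (simp_all add: y_def)
    then have "60 * real (card (copies V (\<lambda>u v. base_adj (?c u) (?c v)))) \<le> 15 / 64 * t ^ 6"
      using copies_colouring[of V ?c, OF fin attach_less(2)] by (simp add: y_def[abs_def])
    then have "(2407 / 10000) * t ^ 6 \<le> 15 / 64 * t ^ 6 + 2160 * (real (card (wrong V E ?c)) * t ^ 4)"
      using copies_le_colouring[OF fin E, of ?c] copies by (simp add: t_def)
    moreover have "0 \<le> t ^ 6" using t by simp
    ultimately have "29 / 10000000 * t ^ 6 \<le> real (card (wrong V E ?c)) * t ^ 4" by linarith
    then have "t ^ 4 * (29 / 10 ^ 7 * t ^ 2) \<le> t ^ 4 * real (card (wrong V E ?c))"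
      by (simp add: power_numeral_reduce mult_ac)
    then show ?thesis using t by (simp only: mult_le_cancel_left_pos zero_less_power)
  qed
  have "t ^ 4 * (11 / 10 ^ 9) \<le> (2407 / 600000 * t ^ 2) * (29 / 10 ^ 7 * t ^ 2)"
    using t by (simp add: power_numeral_reduce)
  also have "\<dots> \<le> real (card (edge_pairs V E)) * (29 / 10 ^ 7 * t ^ 2)"
    using edges t by (intro mult_right_mono) auto
  also have "\<dots> = (\<Sum>e\<in>edge_pairs V E. 29 / 10 ^ 7 * t ^ 2)" by simp
  also have "\<dots> \<le> (\<Sum>e\<in>edge_pairs V E. real (card (wrong V E (edge_attach E e))))"
    by (rule sum_mono) (rule each)
  finally have sum: "t ^ 4 * (11 / 10 ^ 9) \<le> (\<Sum>e\<in>edge_pairs V E. real (card (wrong V E (edge_attach E e))))" .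
  have "real (card V ^ 3 * (\<Sum>e\<in>edge_pairs V E. card (wrong V E (edge_attach E e)))) \<le> real (card (bad V E) + card V ^ 3 * card (matchings V E))"
    by (rule of_nat_mono[OF matchings_ge_edges[OF fin]])
  then have "t ^ 3 * (\<Sum>e\<in>edge_pairs V E. real (card (wrong V E (edge_attach E e)))) \<le> real (card (bad V E)) + t ^ 3 * real (card (matchings V E))"
    by (simp add: t_def)
  moreover have "t ^ 3 * (t ^ 4 * (11 / 10 ^ 9)) \<le> t ^ 3 * (\<Sum>e\<in>edge_pairs V E. real (card (wrong V E (edge_attach E e))))"
    using sum t by (intro mult_left_mono) auto
  moreover have "real (card (bad V E)) \<le> 1076 * (5 / 10 ^ 12) * t ^ 7"
  proof -
    have "1076 * \<epsilon> * t ^ 7 \<le> 1076 * (5 / 10 ^ 12) * t ^ 7" using \<epsilon> t by (intro mult_right_mono mult_left_mono) auto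
    then show ?thesis using bad_le[OF fin E near] by (simp add: t_def)
  qed
  moreover have "t ^ 3 * (t ^ 4 * (11 / 10 ^ 9)) = 11 / 10 ^ 9 * t ^ 7" by (simp add: power_numeral_reduce)
  ultimately have "5 / 10 ^ 9 * t ^ 7 \<le> t ^ 3 * real (card (matchings V E))"
    using zero_le_power[of t 7] t by simp
  moreover have "5 / 10 ^ 9 * t ^ 7 = t ^ 3 * (5 / 10 ^ 9 * t ^ 4)" by (simp add: power_numeral_reduce)
  ultimately have "t ^ 3 * (5 / 10 ^ 9 * t ^ 4) \<le> t ^ 3 * real (card (matchings V E))" by simp
  then have "5 / 10 ^ 9 * t ^ 4 \<le> real (card (matchings V E))"
    using t by (simp only: mult_le_cancel_left_pos zero_less_power)
  then show ?thesis by (simp add: t_def)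
qed

lemma prod_near_one:
  fixes f :: "nat \<Rightarrow> real"
  assumes "\<And>i. i < 6 \<Longrightarrow> \<bar>f i - 1\<bar> \<le> \<kappa>" "0 \<le> \<kappa>" "\<kappa> \<le> 1"
  shows "\<bar>(\<Prod>i<6. f i) - 1\<bar> \<le> 63 * \<kappa>"
proof -
  have f: "1 - \<kappa> \<le> f i" "f i \<le> 1 + \<kappa>" if "i < 6" for i using assms(1)[OF that] by auto
  have "(\<Prod>i<6::nat. 1 - \<kappa>) \<le> (\<Prod>i<6. f i)" using assms f by (intro prod_mono) auto
  moreover have "(\<Prod>i<6. f i) \<le> (\<Prod>i<6::nat. 1 + \<kappa>)"
    using assms f by (intro prod_mono) (force intro: order_trans[of 0 "1 - \<kappa>"])
  moreover have "1 + real 6 * (- \<kappa>) \<le> (1 + (- \<kappa>)) ^ 6"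
    using assms by (intro Bernoulli_inequality) auto
  moreover have "(1 + \<kappa>) ^ 6 \<le> 1 + 63 * \<kappa>"
  proof -
    have "\<kappa> ^ 2 \<le> \<kappa>" "\<kappa> ^ 3 \<le> \<kappa>" "\<kappa> ^ 4 \<le> \<kappa>" "\<kappa> ^ 5 \<le> \<kappa>" "\<kappa> ^ 6 \<le> \<kappa>"
      using assms power_decreasing[of 1 _ \<kappa>] by simp_all
    moreover have "(1 + \<kappa>) ^ 6 = 1 + 6 * \<kappa> + 15 * \<kappa> ^ 2 + 20 * \<kappa> ^ 3 + 15 * \<kappa> ^ 4 + 6 * \<kappa> ^ 5 + \<kappa> ^ 6"
      by algebra
    ultimately show ?thesis by linarith
  qed
  ultimately show ?thesis by (simp add: abs_le_iff)
qed

text \<open>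
  The matching \<open>\<tau>\<close> minimises the number of wrong pairs; so every induced matching has at least as many, and the
  number of uncolourable tuples is bounded below by a constant times \<open>n ^ 5\<close> times this minimum. Weights that turn
  the guessed blowup into the optimal one (constant on each part, close to \<open>1 / n\<close>) make its density equal to the
  limit value, so the certificate bounds the loss of the graph against this blowup from below. The loss exceeds
  the errors of returning to uniform weights and to injective tuples, which are also proportional to the number of
  wrong pairs.
\<close>

lemma reweighted_gain:
  assumes fin: "finite V" and E: "simple_rel E" and n: "2 * 10 ^ 17 \<le> card V"
    and many: "5 / 10 ^ 9 * real (card V) ^ 4 \<le> real (card (matchings V E))"
    and \<tau>: "\<And>\<sigma>. \<sigma> \<in> matchings V E \<Longrightarrow> card (wrong V E (attach E \<tau>)) \<le> card (wrong V E (attach E \<sigma>))"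
    and parts: "\<And>i. i < 5 \<Longrightarrow> \<bar>real (card {v \<in> V. attach E \<tau> v = i}) / real (card V) - optimum i\<bar> < 5 / 10 ^ 19"
  shows "5 / 10 ^ 13 * (real (card (wrong V E (attach E \<tau>))) * real (card V) ^ 4)
    \<le> 60 * (real (card (injective_copies V (\<lambda>u v. base_adj (attach E \<tau> u) (attach E \<tau> v)))) - real (card (injective_copies V E)))"
proof -
  define c where "c = attach E \<tau>"
  define t where "t = real (card V)"
  define m where "m = real (card (wrong V E c))"
  define y where "y i = real (card {v \<in> V. c v = i})" for i
  \<comment> \<open>the part weights become the optimal ones\<close>
  define \<mu> where "\<mu> v = optimum (c v) / y (c v)" for v
  \<comment> \<open>relative deviation of the weights from \<open>1 / t\<close>: the parts deviate by \<open>5 / 10 ^ 19\<close>, and all are at least \<open>17 t / 100\<close>\<close>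
  define \<kappa> :: real where "\<kappa> = 5 / 10 ^ 18"
  have t: "0 < t" "2 * 10 ^ 17 \<le> t"
    using n of_nat_mono[OF n, where 'a = real] by (simp_all add: t_def)
  have c5: "c v < 5" for v by (simp add: c_def attach_less)
  have y: "\<bar>y i / t - optimum i\<bar> < 5 / 10 ^ 19" if "i < 5" for i
    using parts[OF that] by (simp add: y_def t_def c_def)
  have opt: "18 / 100 \<le> optimum i" if "i < 5" for i
    using less_5_cases[OF that] alpha_bounds by (elim disjE) simp_all
  have y_pos: "0 < y i" "17 / 100 * t \<le> y i" if "i < 5" for i
  proof -
    have "\<bar>y i / t - optimum i\<bar> < 1 / 100" by (rule less_trans[OF y[OF that]]) simp
    then have "17 / 100 \<le> y i / t" using opt[OF that] by linarith
    then show "17 / 100 * t \<le> y i" using t by (simp add: le_divide_eq)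
    then show "0 < y i" using t by simp
  qed
  have near: "\<bar>t * \<mu> v - 1\<bar> \<le> \<kappa>" for v
  proof -
    let ?i = "c v"
    have "t * \<mu> v - 1 = (optimum ?i - y ?i / t) * (t / y ?i)"
      using t y_pos(1)[OF c5[of v]] by (simp add: \<mu>_def field_simps)
    moreover have "\<bar>(optimum ?i - y ?i / t) * (t / y ?i)\<bar> \<le> 5 / 10 ^ 19 * (100 / 17)"
      unfolding abs_mult
    proof (rule mult_mono)
      show "\<bar>optimum ?i - y ?i / t\<bar> \<le> 5 / 10 ^ 19" using y[OF c5[of v]] by (simp add: abs_minus_commute)
      show "\<bar>t / y ?i\<bar> \<le> 100 / 17" using y_pos[OF c5[of v]] t by (simp add: divide_le_eq)
    qed auto
    ultimately show ?thesis by (simp add: \<kappa>_def)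
  qed
  have \<mu>_pos: "9 / 10 / t \<le> \<mu> v" for v
  proof -
    have "\<bar>t * \<mu> v - 1\<bar> \<le> 1 / 10" by (rule order_trans[OF near]) (simp add: \<kappa>_def)
    then have "9 / 10 \<le> t * \<mu> v" by linarith
    then show ?thesis using t by (simp add: divide_le_eq mult_ac)
  qed
  have \<mu>0: "0 \<le> \<mu> v" for v using order_trans[OF _ \<mu>_pos[of v], of 0] t by simp
  interpret G: weighted_graph V \<mu> E by unfold_locales (auto simp: fin \<mu>0 E)
  have part: "part_weight V \<mu> c i = optimum i" if "i < 5" for i
  proof -
    have "part_weight V \<mu> c i = (\<Sum>v\<in>{v \<in> V. c v = i}. optimum i / y i)"
      unfolding part_weight_def by (intro sum.cong) (auto simp: \<mu>_def)
    also have "\<dots> = y i * (optimum i / y i)" by (simp add: y_def)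
    also have "\<dots> = optimum i" using y_pos(1)[OF that] by simp
    finally show ?thesis .
  qed
  have mass: "G.mass = 1"
    using sum_over_parts[of V c \<mu> "\<lambda>_. 1", OF fin c5] optimum_in_simplex
    by (simp add: G.mass_def part std_simplex_def)
  have K: "60 * weighted_graph.target_sum V \<mu> (\<lambda>u v. base_adj (c u) (c v)) = limit_value"
  proof -
    have "60 * weighted_graph.target_sum V \<mu> (\<lambda>u v. base_adj (c u) (c v)) = blowup_poly (part_weight V \<mu> c)"
      by (rule target_sum_colouring[OF G.weighted_graph_axioms c5])
    also have "\<dots> = blowup_poly optimum" by (simp add: blowup_poly_def part)
    finally show ?thesis by (simp add: blowup_poly_optimum)
  qed
  have "2 / 10 ^ 9 * m / t ^ 2 \<le> G.wsum 7 (\<lambda>x. of_bool (\<not> colourable 7 (G.pull x)))"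
  proof -
    have "real (card (matchings V E)) * m = (\<Sum>\<sigma>\<in>matchings V E. m)" by simp
    also have "\<dots> \<le> (\<Sum>\<sigma>\<in>matchings V E. real (card (wrong V E (attach E \<sigma>))))"
      unfolding m_def c_def by (intro sum_mono of_nat_mono \<tau>)
    finally have "t * (real (card (matchings V E)) * m) \<le> t * (\<Sum>\<sigma>\<in>matchings V E. real (card (wrong V E (attach E \<sigma>))))"
      using t by (intro mult_left_mono) auto
    also have "\<dots> \<le> real (card (bad V E))"
      using of_nat_mono[OF bad_ge_matchings[OF fin, of E], where 'a = real] by (simp add: t_def)
    finally have "t * (real (card (matchings V E)) * m) \<le> real (card (bad V E))" .
    moreover have "t * (5 / 10 ^ 9 * t ^ 4 * m) \<le> t * (real (card (matchings V E)) * m)"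
      using many t by (intro mult_left_mono mult_right_mono) (auto simp: t_def m_def)
    ultimately have bad: "t * (5 / 10 ^ 9 * t ^ 4 * m) \<le> real (card (bad V E))" by simp
    have "2 / 10 ^ 9 * m / t ^ 2 = 2 / 5 * (1 / t) ^ 7 * (t * (5 / 10 ^ 9 * t ^ 4 * m))"
      using t by (simp add: field_simps power_numeral_reduce)
    also have "\<dots> \<le> (9 / 10 / t) ^ 7 * (t * (5 / 10 ^ 9 * t ^ 4 * m))"
    proof (rule mult_right_mono)
      have "2 / 5 * (1 / t) ^ 7 \<le> (9 / 10) ^ 7 * (1 / t) ^ 7"
        using t by (intro mult_right_mono) (simp_all add: power_divide)
      then show "2 / 5 * (1 / t) ^ 7 \<le> (9 / 10 / t) ^ 7" by (simp add: power_divide)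
    qed (use t in \<open>simp add: m_def\<close>)
    also have "\<dots> \<le> (9 / 10 / t) ^ 7 * real (card (bad V E))"
      using bad t by (intro mult_left_mono) auto
    also have "\<dots> = (\<Sum>x\<in>bad V E. \<Prod>i<7::nat. 9 / 10 / t)" by simp
    also have "\<dots> \<le> (\<Sum>x\<in>bad V E. \<Prod>i<7. \<mu> (x i))"
      using \<mu>_pos t by (intro sum_mono prod_mono) auto
    finally show ?thesis by (simp only: G.bad_weight)
  qed
  then have "18900 * G.target_sum + 30000 / 102400 * (2 / 10 ^ 9 * m / t ^ 2) \<le> 315 * limit_value"
    using G.certificate unfolding mass by simp
  then have "18 / 10 ^ 13 * (m / t ^ 2) \<le> limit_value - 60 * G.target_sum"
  proof -
    assume le: "18900 * G.target_sum + 30000 / 102400 * (2 / 10 ^ 9 * m / t ^ 2) \<le> 315 * limit_value"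
    have eq: "30000 / 102400 * (2 / 10 ^ 9 * m / t ^ 2) = 3 / 5120000000 * (m / t ^ 2)" by simp
    have "0 \<le> m / t ^ 2" by (simp add: m_def)
    then have "18 / 10000000000000 * (m / t ^ 2) \<le> limit_value - 60 * G.target_sum"
      using le unfolding eq by linarith
    then show ?thesis by simp
  qed
  then have "t ^ 6 * (18 / 10 ^ 13 * (m / t ^ 2)) \<le> t ^ 6 * (60 * weighted_graph.target_sum V \<mu> (\<lambda>u v. base_adj (c u) (c v)) - 60 * G.target_sum)"
    unfolding K using t by (intro mult_left_mono) auto
  also have "\<dots> = 60 * (t ^ 6 * (weighted_graph.target_sum V \<mu> (\<lambda>u v. base_adj (c u) (c v)) - G.target_sum))"
    by (simp add: algebra_simps)
  also have "t ^ 6 * (18 / 10 ^ 13 * (m / t ^ 2)) = 18 / 10 ^ 13 * (m * t ^ 4)"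
    using t by (simp add: field_simps power_numeral_reduce)
  finally have gain: "18 / 10 ^ 13 * (m * t ^ 4) \<le> 60 * (t ^ 6 * (weighted_graph.target_sum V \<mu> (\<lambda>u v. base_adj (c u) (c v)) - G.target_sum))" .
  have "\<bar>t ^ 6 * (\<Prod>i<6. \<mu> (x i)) - 1\<bar> \<le> 63 * \<kappa>" for x :: "nat \<Rightarrow> 'a"
  proof -
    have "t ^ 6 * (\<Prod>i<6. \<mu> (x i)) = (\<Prod>i<6. t * \<mu> (x i))" by (simp add: prod.distrib)
    then show ?thesis using prod_near_one[of "\<lambda>i. t * \<mu> (x i)" \<kappa>] near by (simp add: \<kappa>_def)
  qed
  from reweighting[OF G.weighted_graph_axioms, of "63 * \<kappa>" c, folded t_def m_def, OF this]
  have "t ^ 6 * (weighted_graph.target_sum V \<mu> (\<lambda>u v. base_adj (c u) (c v)) - G.target_sum) - 36 * (63 * \<kappa>) * (m * t ^ 4)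
      \<le> real (card (copies V (\<lambda>u v. base_adj (c u) (c v)))) - real (card (copies V E))" .
  moreover have "real (card (copies V (\<lambda>u v. base_adj (c u) (c v)))) - real (card (copies V E)) - 1296 * (m * t ^ 3)
      \<le> real (card (injective_copies V (\<lambda>u v. base_adj (c u) (c v)))) - real (card (injective_copies V E))"
    using injective_copies_gain[OF fin E, of c] by (simp add: m_def t_def)
  moreover have "36 * (63 * \<kappa>) * (m * t ^ 4) \<le> 115 / 10000000000000000 * (m * t ^ 4)"
    by (rule mult_right_mono) (simp_all add: \<kappa>_def m_def t_def)
  moreover have "1296 * (m * t ^ 3) \<le> 7 / 1000000000000000 * (m * t ^ 4)"
  proof -
    have "1296 * (m * t ^ 3) \<le> (7 / 1000000000000000 * t) * (m * t ^ 3)"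
      using t by (intro mult_right_mono) (simp_all add: m_def)
    then show ?thesis by (simp add: power_numeral_reduce mult_ac)
  qed
  moreover have "18 / 10000000000000 * (m * t ^ 4) \<le> 60 * (t ^ 6 * (weighted_graph.target_sum V \<mu> (\<lambda>u v. base_adj (c u) (c v)) - G.target_sum))"
    using gain by simp
  moreover have "0 \<le> m * t ^ 4" by (simp add: m_def t_def)
  \<comment> \<open>the errors, multiplied by 60, use up less than 12 of the 18 units gained\<close>
  moreover have "5 / 10000000000000 * X \<le> 60 * (ic - ie)"
    if "D - e1 \<le> cc - ce" "cc - ce - e2 \<le> ic - ie" "e1 \<le> 115 / 10000000000000000 * X" "e2 \<le> 7 / 1000000000000000 * X"
      "18 / 10000000000000 * X \<le> 60 * D" "0 \<le> X" for D e1 e2 cc ce ic ie X :: real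
    using that by argo
  ultimately have "5 / 10000000000000 * (m * t ^ 4) \<le> 60 * (real (card (injective_copies V (\<lambda>u v. base_adj (c u) (c v)))) - real (card (injective_copies V E)))"
    by blast
  then show ?thesis by (simp add: m_def t_def c_def)
qed

text \<open>
  A matching with the least number of wrong pairs yields a blowup so close to the graph that it is nearly optimal
  itself. By compactness its part sizes are nearly the optimal ones, and the previous lemma applies.
\<close>

lemma near_optimal_gain:
  "\<exists>\<epsilon>>0. \<forall>(V :: 'a set) E. finite V \<and> simple_rel E \<and> 2 * 10 ^ 17 \<le> card V \<and> (limit_value - \<epsilon>) * real (card V) ^ 6 \<le> 60 * real (card (copies V E)) \<longrightarrow>
     (\<exists>c. (\<forall>v. c v < 5) \<and> 5 / 10 ^ 13 * (real (card (wrong V E c)) * real (card V) ^ 4)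
       \<le> 60 * (real (card (injective_copies V (\<lambda>u v. base_adj (c u) (c v)))) - real (card (injective_copies V E))))"
proof -
  obtain \<epsilon>\<^sub>1 where e1: "0 < \<epsilon>\<^sub>1" "\<forall>x\<in>std_simplex 5. limit_value - \<epsilon>\<^sub>1 \<le> blowup_poly x \<longrightarrow> (\<forall>i<5. \<bar>x i - optimum i\<bar> < 5 / 10 ^ 19)"
    using blowup_poly_near[of "5 / 10 ^ 19"] by auto
  \<comment> \<open>the first bound is for many matchings, the second one covers the loss \<open>648 * 10 ^ 12 * \<epsilon>\<close> below\<close>
  define \<epsilon> where "\<epsilon> = min (5 / 10 ^ 12) (\<epsilon>\<^sub>1 / 10 ^ 15)"
  have \<epsilon>: "0 < \<epsilon>" "\<epsilon> \<le> 5 / 10 ^ 12" "10 ^ 15 * \<epsilon> \<le> \<epsilon>\<^sub>1" using e1(1) by (auto simp: \<epsilon>_def min_def)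
  have "\<exists>c. (\<forall>v. c v < 5) \<and> 5 / 10 ^ 13 * (real (card (wrong V E c)) * real (card V) ^ 4)
       \<le> 60 * (real (card (injective_copies V (\<lambda>u v. base_adj (c u) (c v)))) - real (card (injective_copies V E)))"
    if fin: "finite V" and E: "simple_rel E" and n: "2 * 10 ^ 17 \<le> card V"
      and near: "(limit_value - \<epsilon>) * real (card V) ^ 6 \<le> 60 * real (card (copies V E))" for V :: "'a set" and E
  proof -
    define t where "t = real (card V)"
    have n0: "0 < card V" by (rule less_le_trans[OF _ n]) simp
    then have t: "0 < t" by (simp add: t_def)
    have many: "5 / 10 ^ 9 * t ^ 4 \<le> real (card (matchings V E))"
      unfolding t_def by (rule many_matchings[OF fin E n0 near \<epsilon>(2)])
    have "matchings V E \<noteq> {}"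
    proof
      assume "matchings V E = {}"
      then have "5 / 10 ^ 9 * t ^ 4 \<le> 0" using many by simp
      moreover have "0 < 5 / 10 ^ 9 * t ^ 4" using t by simp
      ultimately show False by linarith
    qed
    then obtain \<tau> where \<tau>: "\<tau> \<in> matchings V E" "\<And>\<sigma>. \<sigma> \<in> matchings V E \<Longrightarrow> card (wrong V E (attach E \<tau>)) \<le> card (wrong V E (attach E \<sigma>))"
      using arg_min_if_finite(1)[OF finite_matchings[OF fin], of E "\<lambda>\<sigma>. card (wrong V E (attach E \<sigma>))"]
        arg_min_least[OF finite_matchings[OF fin], of E _ "\<lambda>\<sigma>. card (wrong V E (attach E \<sigma>))"] by blast
    let ?c = "attach E \<tau>"
    define m where "m = real (card (wrong V E ?c))"
    define y where "y i = (if i < 5 then real (card {v \<in> V. ?c v = i}) / t else 0)" for i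
    have "t * (real (card (matchings V E)) * m) \<le> real (card (bad V E))"
    proof -
      have "real (card (matchings V E)) * m = (\<Sum>\<sigma>\<in>matchings V E. m)" by simp
      also have "\<dots> \<le> (\<Sum>\<sigma>\<in>matchings V E. real (card (wrong V E (attach E \<sigma>))))"
        unfolding m_def by (intro sum_mono of_nat_mono \<tau>(2))
      finally have "t * (real (card (matchings V E)) * m) \<le> t * (\<Sum>\<sigma>\<in>matchings V E. real (card (wrong V E (attach E \<sigma>))))"
        using t by (intro mult_left_mono) auto
      also have "\<dots> \<le> real (card (bad V E))"
        using of_nat_mono[OF bad_ge_matchings[OF fin, of E], where 'a = real] by (simp add: t_def)
      finally show ?thesis .
    qed
    moreover have "t * (5 / 10 ^ 9 * t ^ 4 * m) \<le> t * (real (card (matchings V E)) * m)"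
      using many t by (intro mult_left_mono mult_right_mono) (auto simp: m_def)
    ultimately have "t * (5 / 10 ^ 9 * t ^ 4 * m) \<le> 1076 * \<epsilon> * t ^ 7"
      using bad_le[OF fin E near] by (simp add: t_def)
    then have "5 / 10 ^ 9 * (t ^ 5 * m) \<le> 1076 * (\<epsilon> * t ^ 7)" by (simp add: power_numeral_reduce mult_ac)
    moreover have "0 \<le> \<epsilon> * t ^ 7" using \<epsilon> t by simp
    ultimately have "t ^ 5 * m \<le> 3 * 10 ^ 11 * (\<epsilon> * t ^ 7)" by simp
    then have "t ^ 5 * m \<le> t ^ 5 * (3 * 10 ^ 11 * \<epsilon> * t ^ 2)" by (simp add: power_numeral_reduce mult_ac)
    then have m: "m \<le> 3 * 10 ^ 11 * \<epsilon> * t ^ 2" using t by (simp only: mult_le_cancel_left_pos zero_less_power)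
    have simplex: "y \<in> std_simplex 5"
    proof -
      have "(\<Sum>i<5. y i) = (\<Sum>i<5. real (card {v \<in> V. ?c v = i})) / t"
        by (simp add: y_def sum_divide_distrib)
      also have "\<dots> = 1"
        using sum_part_sizes[of V ?c, OF fin attach_less(1)] t by (simp add: t_def)
      finally show ?thesis using t by (auto simp: std_simplex_def y_def)
    qed
    have "blowup_poly y = blowup_poly (\<lambda>i. real (card {v \<in> V. ?c v = i}) / t)"
      by (simp add: blowup_poly_def y_def)
    also have "\<dots> = 60 * real (card (copies V (\<lambda>u v. base_adj (?c u) (?c v)))) / t ^ 6"
      using copies_colouring[of V ?c, OF fin attach_less(1)] by (simp add: blowup_poly_scale)
    finally have poly: "t ^ 6 * blowup_poly y = 60 * real (card (copies V (\<lambda>u v. base_adj (?c u) (?c v))))"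
      using t by simp
    have "2160 * (m * t ^ 4) \<le> 2160 * (3 * 10 ^ 11 * \<epsilon> * t ^ 2 * t ^ 4)"
      using m t by (intro mult_left_mono mult_right_mono) auto
    then have "2160 * (m * t ^ 4) \<le> 648 * 10 ^ 12 * (\<epsilon> * t ^ 6)" by (simp add: power_numeral_reduce)
    moreover have "(limit_value - \<epsilon>) * t ^ 6 \<le> t ^ 6 * blowup_poly y + 2160 * (m * t ^ 4)"
      using copies_le_colouring[OF fin E, of ?c] near unfolding poly by (simp add: t_def m_def)
    moreover have "10 ^ 15 * \<epsilon> * t ^ 6 \<le> \<epsilon>\<^sub>1 * t ^ 6" using \<epsilon>(3) t by (intro mult_right_mono) auto
    moreover have "0 \<le> \<epsilon> * t ^ 6" using \<epsilon> t by simp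
    ultimately have "t ^ 6 * (limit_value - \<epsilon>\<^sub>1) \<le> t ^ 6 * blowup_poly y"
      by (simp add: algebra_simps)
    then have "limit_value - \<epsilon>\<^sub>1 \<le> blowup_poly y" using t by (simp only: mult_le_cancel_left_pos zero_less_power)
    then have close: "\<bar>y i - optimum i\<bar> < 5 / 10 ^ 19" if "i < 5" for i
      using e1(2) simplex that by blast
    have "\<bar>real (card {v \<in> V. ?c v = i}) / real (card V) - optimum i\<bar> < 5 / 10 ^ 19" if "i < 5" for i
      using close[OF that] that by (simp add: y_def t_def)
    from reweighted_gain[OF fin E n many[unfolded t_def] \<tau>(2) this]
    show ?thesis using attach_less(1)[of E \<tau>] by blast
  qed
  then show ?thesis using \<epsilon>(1) by blast
qed

text \<open>
  The blowup with the given partition lives on the same vertices and differs only at wrong pairs.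
\<close>

lemma edit_distance_le:
  assumes G: "simple_graph G" and c: "\<And>v. c v < 5"
  obtains H where "simple_graph H" "verts H = verts G"
    "\<And>u v. u \<in> verts G \<Longrightarrow> v \<in> verts G \<Longrightarrow> adj H u v = base_adj (c u) (c v)"
    "edit_distance G B_F2 \<le> card (wrong (verts G) (adj G) c)"
proof -
  define U where "U i = {v \<in> verts G. c v = i}" for i
  let ?H = "blowup B_F2 U"
  have parts: "blowup_parts B_F2 U"
    using finite_verts[OF G] by (auto simp: blowup_parts_def disjoint_family_on_def U_def)
  have vs: "verts ?H = verts G"
    using c by (auto simp: blowup_def verts_B_F2 U_def)
  have simple: "simple_graph ?H" by (rule simple_blowup(1)[OF parts])
  obtain d where d: "\<forall>i<5. {v \<in> verts ?H. d v = i} = U i"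
    "\<forall>u\<in>verts ?H. \<forall>v\<in>verts ?H. adj ?H u v = base_adj (d u) (d v)"
    using colouring_of_blowup[OF parts] by blast
  have dc: "d v = c v" if "v \<in> verts G" for v
  proof -
    have "v \<in> U (c v)" using that by (simp add: U_def)
    then show ?thesis using d(1) c[of v] by blast
  qed
  have adjH: "adj ?H u v = base_adj (c u) (c v)" if "u \<in> verts G" "v \<in> verts G" for u v
    using d(2) dc that unfolding vs by auto
  have "sym_diff (edges G) (edges ?H) \<subseteq> (\<lambda>(u, v). {u, v}) ` wrong (verts G) (adj G) c"
  proof
    fix e assume e: "e \<in> sym_diff (edges G) (edges ?H)"
    have "edges G \<subseteq> {{u, v} |u v. u \<in> verts G \<and> v \<in> verts G}" "edges ?H \<subseteq> {{u, v} |u v. u \<in> verts G \<and> v \<in> verts G}"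
      using G simple vs by (auto simp: simple_graph_def wf_pattern_def)
    then obtain u v where uv: "e = {u, v}" "u \<in> verts G" "v \<in> verts G" using e by blast
    then have "adj G u v \<noteq> adj ?H u v" using e by (auto simp: adj_def)
    then have "(u, v) \<in> wrong (verts G) (adj G) c" using adjH uv by (simp add: wrong_def)
    then show "e \<in> (\<lambda>(u, v). {u, v}) ` wrong (verts G) (adj G) c" using uv(1) by force
  qed
  then have "card (sym_diff (edges G) (edges ?H)) \<le> card (wrong (verts G) (adj G) c)"
    by (rule surj_card_le[OF finite_wrong[OF finite_verts[OF G]]])
  moreover have "edit_distance G B_F2 \<le> card (sym_diff (edges G) (edges ?H))"
    unfolding edit_distance_def
  proof (rule cInf_lower)
    have "isomorphic ?H ?H"
      unfolding isomorphic_def is_isomorphism_def by (intro exI[of _ id]) auto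
    moreover have "?H \<in> blowups B_F2" using parts by (auto simp: blowups_def)
    ultimately show "card (sym_diff (edges G) (edges ?H)) \<in> {card (sym_diff (edges G) (edges H)) |H.
            simple_graph H \<and> verts H = verts G \<and> (\<exists>K\<in>blowups B_F2. isomorphic H K)}"
      using simple vs by blast
  qed simp
  ultimately have "edit_distance G B_F2 \<le> card (wrong (verts G) (adj G) c)" by simp
  then show ?thesis using that[of ?H] simple vs adjH by blast
qed

text \<open>
  A graph that is far from extremal satisfies the inequality trivially, as at most \<open>n ^ 2\<close> pairs are changed.
  Otherwise the blowup of the previous lemmas is both close to the graph and a lower bound for the maximum
  density.
\<close>

lemma perfectly_stable_F2: "perfectly_stable F2 B_F2"
proof -
  obtain \<epsilon> where \<epsilon>: "0 < \<epsilon>" and gain: "\<And>(V :: nat set) E. finite V \<Longrightarrow> simple_rel E \<Longrightarrow> 2 * 10 ^ 17 \<le> card V \<Longrightarrow>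
      (limit_value - \<epsilon>) * real (card V) ^ 6 \<le> 60 * real (card (copies V E)) \<Longrightarrow>
     \<exists>c. (\<forall>v. c v < 5) \<and> 5 / 10 ^ 13 * (real (card (wrong V E c)) * real (card V) ^ 4)
       \<le> 60 * (real (card (injective_copies V (\<lambda>u v. base_adj (c u) (c v)))) - real (card (injective_copies V E)))"
    using near_optimal_gain by blast
  have "(\<lambda>n. max_density F2 n - (limit_value - \<epsilon>) * (real n ^ 6 / ordered_choices n)) \<longlonglongrightarrow> limit_value - (limit_value - \<epsilon>) * 1"
    by (intro tendsto_diff max_density_limit tendsto_mult tendsto_const ratio_limit)
  then have "\<forall>\<^sub>F n in sequentially. \<epsilon> / 2 < max_density F2 n - (limit_value - \<epsilon>) * (real n ^ 6 / ordered_choices n)"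
    by (rule order_tendstoD(1)) (use \<epsilon> in simp)
  then obtain N where N: "\<And>n. N \<le> n \<Longrightarrow> \<epsilon> / 2 < max_density F2 n - (limit_value - \<epsilon>) * (real n ^ 6 / ordered_choices n)"
    unfolding eventually_sequentially by blast
  \<comment> \<open>large enough for the limits, for the order in the main case, and for the factor in both cases\<close>
  define C where "C = max (max (real N) (2 * 10 ^ 17)) (2 / \<epsilon>)"
  have C: "real N \<le> C" "2 * 10 ^ 17 \<le> C" "2 / \<epsilon> \<le> C" by (auto simp: C_def)
  have C0: "0 < C" using C(2) by simp
  have "real (edit_distance G B_F2) \<le> C * (max_density F2 (num_verts G) - ind_density F2 G) * (real (num_verts G))\<^sup>2"
    if G: "simple_graph G" and n: "C \<le> real (num_verts G)" for G
  proof -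
    let ?V = "verts G" and ?E = "adj G"
    define t where "t = real (num_verts G)"
    define gap where "gap = max_density F2 (num_verts G) - ind_density F2 G"
    have cardV: "card ?V = num_verts G" by (simp add: num_verts_def)
    have fin: "finite ?V" and E: "simple_rel ?E" using finite_verts simple_adj G by auto
    have t: "2 * 10 ^ 17 \<le> t" "real N \<le> t" "0 < t" using C n by (auto simp: t_def)
    have gap0: "0 \<le> gap" using ind_density_le_max[OF G, of F2] by (simp add: gap_def)
    show ?thesis
    proof (cases "(limit_value - \<epsilon>) * t ^ 6 \<le> 60 * real (card (copies ?V ?E))")
      case False
      have "real N \<le> real (num_verts G)" using t by (simp add: t_def)
      then have "N \<le> num_verts G" by simp
      from N[OF this] have "\<epsilon> / 2 \<le> gap"
        using ind_density_le[OF G, of "limit_value - \<epsilon>"] False by (simp add: gap_def t_def)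
      then have "1 \<le> 2 / \<epsilon> * gap" using \<epsilon> by (simp add: field_simps)
      also have "\<dots> \<le> C * gap" using C(3) gap0 by (rule mult_right_mono)
      finally have "1 * t\<^sup>2 \<le> C * gap * t\<^sup>2" by (rule mult_right_mono) simp
      moreover have "real (edit_distance G B_F2) \<le> t\<^sup>2"
      proof -
        \<comment> \<open>the empty graph is a blowup with a single nonempty part\<close>
        obtain H where "edit_distance G B_F2 \<le> card (wrong ?V ?E (\<lambda>_. 4))"
          by (rule edit_distance_le[OF G, of "\<lambda>_. 4"]) auto
        also have "\<dots> \<le> card (?V \<times> ?V)" using fin by (intro card_mono) (auto simp: wrong_def)
        finally have "edit_distance G B_F2 \<le> num_verts G ^ 2"
          by (simp add: card_cartesian_product cardV power2_eq_square)
        then have "real (edit_distance G B_F2) \<le> real (num_verts G ^ 2)" by (rule of_nat_mono)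
        then show ?thesis by (simp add: t_def)
      qed
      ultimately have "real (edit_distance G B_F2) \<le> C * gap * t\<^sup>2" by linarith
      then show ?thesis by (simp add: gap_def t_def)
    next
      case True
      have "real (2 * 10 ^ 17) \<le> real (num_verts G)" using t by (simp add: t_def)
      then have big: "2 * 10 ^ 17 \<le> card ?V" unfolding cardV by (simp only: of_nat_le_iff)
      obtain c where c: "\<forall>v. c v < 5" and g: "5 / 10 ^ 13 * (real (card (wrong ?V ?E c)) * t ^ 4)
         \<le> 60 * (real (card (injective_copies ?V (\<lambda>u v. base_adj (c u) (c v)))) - real (card (injective_copies ?V ?E)))"
        using gain[OF fin E big] True by (auto simp: cardV t_def)
      obtain H where H: "simple_graph H" "verts H = ?V"
        "\<And>u v. u \<in> ?V \<Longrightarrow> v \<in> ?V \<Longrightarrow> adj H u v = base_adj (c u) (c v)"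
        and edit: "edit_distance G B_F2 \<le> card (wrong ?V ?E c)"
        by (rule edit_distance_le[OF G, of c]) (use c in auto)
      define m where "m = real (card (wrong ?V ?E c))"
      have inj: "injective_copies ?V (adj H) = injective_copies ?V (\<lambda>u v. base_adj (c u) (c v))"
        unfolding injective_copies_def using copies_cong[of ?V "adj H" "\<lambda>u v. base_adj (c u) (c v)"] H(3) by simp
      have nH: "num_verts H = num_verts G" by (simp add: num_verts_def H(2))
      have "6 \<le> num_verts G" using big by (simp add: cardV)
      then have oc: "0 < ordered_choices (num_verts G)" by (rule ordered_choices_pos)
      have "5 / 10 ^ 13 * (m * t ^ 4) / t ^ 6 \<le> 5 / 10 ^ 13 * (m * t ^ 4) / ordered_choices (num_verts G)"
        using oc zero_less_power[OF t(3), of 6] ordered_choices_le[of "num_verts G"]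
        by (intro divide_left_mono mult_pos_pos) (auto simp: m_def t_def)
      also have "\<dots> \<le> 60 * (real (card (injective_copies ?V (\<lambda>u v. base_adj (c u) (c v)))) - real (card (injective_copies ?V ?E))) / ordered_choices (num_verts G)"
        using oc g by (intro divide_right_mono) (auto simp: m_def)
      also have "\<dots> = ind_density F2 H - ind_density F2 G"
        unfolding ind_density_eq[OF H(1)] ind_density_eq[OF G] H(2) nH inj by (simp add: diff_divide_distrib right_diff_distrib)
      also have "\<dots> \<le> gap" using ind_density_le_max[OF H(1), of F2] nH by (simp add: gap_def)
      finally have "5 / 10 ^ 13 * (m * t ^ 4) / t ^ 6 \<le> gap" .
      then have "5 / 10 ^ 13 * (m * t ^ 4) \<le> gap * t ^ 6" using t by (simp add: divide_le_eq)
      then have "t ^ 4 * (5 / 10 ^ 13 * m) \<le> t ^ 4 * (gap * t ^ 2)" by (simp add: power_numeral_reduce algebra_simps)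
      then have "5 / 10 ^ 13 * m \<le> gap * t ^ 2" using t by (simp only: mult_le_cancel_left_pos zero_less_power)
      then have "m \<le> (2 * 10 ^ 12) * (gap * t ^ 2)" by simp
      also have "\<dots> \<le> C * (gap * t ^ 2)" using C(2) gap0 by (intro mult_right_mono) auto
      finally have "m \<le> C * gap * t\<^sup>2" by (simp add: mult.assoc)
      moreover have "real (edit_distance G B_F2) \<le> m" using of_nat_mono[OF edit, where 'a = real] by (simp add: m_def)
      ultimately show ?thesis by (simp add: gap_def t_def)
    qed
  qed
  then show ?thesis unfolding perfectly_stable_def using C0 by blast
qed

theorem theorem3p1:
  shows "\<exists>\<alpha>::real. 0.7210 \<le> \<alpha> \<and> \<alpha> < 0.7211 \<and>
           \<alpha> ^ 3 + 2 * \<alpha> ^ 2 - 32 / 5 * \<alpha> + 16 / 5 = 0 \<and>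
           convergent (max_density F2) \<and>
           inducibility F2 = - (255 / 8) * \<alpha> ^ 2 + 591 / 10 * \<alpha> - 129 / 5 \<and>
           perfectly_stable F2 B_F2 \<and>
           (\<forall>x\<in>std_simplex 5. is_blowup_density F2 B_F2 x (blowup_density F2 B_F2 x)) \<and>
           (let x\<^sub>0 = nth_default 0 [\<alpha> / 4, \<alpha> / 4, \<alpha> / 4, \<alpha> / 4, 1 - \<alpha>] in
              x\<^sub>0 \<in> blowup_maximisers F2 B_F2 \<and>
              (\<forall>x\<in>blowup_maximisers F2 B_F2.
                 \<exists>\<sigma>. is_automorphism B_F2 \<sigma> \<and> (\<forall>i\<in>verts B_F2. x i = x\<^sub>0 (\<sigma> i))))"
proof (intro exI[of _ alpha] conjI)
  show "0.7210 \<le> alpha" "alpha < 0.7211" using alpha_bounds by simp_all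
  show "alpha ^ 3 + 2 * alpha ^ 2 - 32 / 5 * alpha + 16 / 5 = 0" by (rule alpha_root)
  show "convergent (max_density F2)" using max_density_limit by (rule convergentI)
  show "inducibility F2 = - (255 / 8) * alpha ^ 2 + 591 / 10 * alpha - 129 / 5"
    unfolding inducibility_def limI[OF max_density_limit] by (rule limit_value_alpha)
  show "perfectly_stable F2 B_F2" by (rule perfectly_stable_F2)
  show "\<forall>x\<in>std_simplex 5. is_blowup_density F2 B_F2 x (blowup_density F2 B_F2 x)"
    by (simp add: blowup_density_eq blowup_density_poly)
  have n5: "num_verts B_F2 = 5" by (simp add: num_verts_def verts_B_F2)
  have max: "blowup_maximisers F2 B_F2 = {optimum}"
  proof (intro equalityI subsetI)
    fix x assume "x \<in> blowup_maximisers F2 B_F2"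
    then have x: "x \<in> std_simplex 5" "blowup_density F2 B_F2 optimum \<le> blowup_density F2 B_F2 x"
      using optimum_in_simplex by (auto simp: blowup_maximisers_def n5)
    then have "blowup_poly x = limit_value"
      using blowup_poly_le(1)[OF x(1)] optimum_in_simplex by (simp add: blowup_density_eq blowup_poly_optimum)
    then show "x \<in> {optimum}" using blowup_poly_le(2)[OF x(1)] by simp
  next
    fix x assume "x \<in> {optimum}"
    then show "x \<in> blowup_maximisers F2 B_F2"
      using optimum_in_simplex blowup_poly_le(1) by (simp add: blowup_maximisers_def n5 blowup_density_eq blowup_poly_optimum)
  qed
  have "is_automorphism B_F2 id" by (auto simp: is_automorphism_def is_isomorphism_def)
  then show "let x\<^sub>0 = nth_default 0 [alpha / 4, alpha / 4, alpha / 4, alpha / 4, 1 - alpha] in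
              x\<^sub>0 \<in> blowup_maximisers F2 B_F2 \<and>
              (\<forall>x\<in>blowup_maximisers F2 B_F2.
                 \<exists>\<sigma>. is_automorphism B_F2 \<sigma> \<and> (\<forall>i\<in>verts B_F2. x i = x\<^sub>0 (\<sigma> i)))"
    unfolding Let_def max optimum_def[symmetric] by (auto intro!: exI[of _ id])
qed

end
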